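(* Let $X$ be a finite psyquandle, $R$ a commutative ring with identity and $(\phi,\psi)$ a Boltzmann weight for $X$ with coefficients in $R$. For a diagram $L$ let $\Phi_X^{\phi,\psi}(L)=\sum_{L_c\in\mathcal{C}(L,X)}w^{BW(L_c)}$, where $\mathcal{C}(L,X)$ is the set of $X$-colorings of $L$ and $BW(L_c)\in R$ is the Boltzmann weight of the coloring $L_c$. Then: (1) $\Phi_X^{\phi,\psi}$ is an invariant of oriented singular knots and links; that is, if $L$ and $L'$ are oriented singular knot or link diagrams related by a finite sequence of planar isotopies and oriented singular Reidemeister moves, then $\Phi_X^{\phi,\psi}(L)=\Phi_X^{\phi,\psi}(L')$. (2) If $X$ is $pI$-adequate and $(\phi,\psi)$ is $pI$-adequate, then $\Phi_X^{\phi,\psi}$ is an invariant of oriented pseudoknots and pseudolinks; that is, if $L$ and $L'$ are oriented pseudoknot or pseudolink diagrams related by a finite sequence of planar isotopies and oriented pseudoknot Reidemeister moves, then $\Phi_X^{\phi,\psi}(L)=\Phi_X^{\phi,\psi}(L')$.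
   Context: **Psyquandles.** A psyquandle is a set $X$ with four binary operations $\underline{\triangleright},\overline{\triangleright},\underline{\bullet},\overline{\bullet}:X\times X\to X$ such that: (0) each operation $*$ of the four is right-invertible: there is a binary operation $*^{-1}$ with $(x*y)*^{-1}y=(x*^{-1}y)*y=x$ for all $x,y\in X$; (i) $x\,\underline{\triangleright}\,x=x\,\overline{\triangleright}\,x$ for all $x\in X$; (ii) the maps $S,S':X\times X\to X\times X$, $S(x,y)=(y\,\overline{\triangleright}\,x,\;x\,\underline{\triangleright}\,y)$ and $S'(x,y)=(y\,\overline{\bullet}\,x,\;x\,\underline{\bullet}\,y)$, are invertible; (iii) for all $x,y,z\in X$: $(x\,\underline{\triangleright}\,y)\,\underline{\triangleright}\,(z\,\underline{\triangleright}\,y)=(x\,\underline{\triangleright}\,z)\,\underline{\triangleright}\,(y\,\overline{\triangleright}\,z)$, $(x\,\underline{\triangleright}\,y)\,\overline{\triangleright}\,(z\,\underline{\triangleright}\,y)=(x\,\overline{\triangleright}\,z)\,\underline{\triangleright}\,(y\,\overline{\triangleright}\,z)$, $(x\,\overline{\triangleright}\,y)\,\overline{\triangleright}\,(z\,\overline{\triangleright}\,y)=(x\,\overline{\triangleright}\,z)\,\overline{\triangleright}\,(y\,\underline{\triangleright}\,z)$; (iv) for all $x,y\in X$: $x\,\underline{\bullet}\,((y\,\overline{\triangleright}\,x)\,\overline{\bullet}^{-1}x)=[(x\,\underline{\triangleright}\,y)\,\overline{\bullet}^{-1}y]\;\overline{\triangleright}\;[(y\,\overline{\triangleright}\,x)\,\overline{\bullet}^{-1}x]$,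 $y\,\underline{\bullet}\,((x\,\underline{\triangleright}\,y)\,\overline{\bullet}^{-1}y)=[(y\,\overline{\triangleright}\,x)\,\overline{\bullet}^{-1}x]\;\underline{\triangleright}\;[(x\,\underline{\triangleright}\,y)\,\overline{\bullet}^{-1}y]$; (v) for all $x,y,z\in X$: $(x\,\overline{\triangleright}\,y)\,\overline{\triangleright}\,(z\,\overline{\bullet}\,y)=(x\,\overline{\triangleright}\,z)\,\overline{\triangleright}\,(y\,\underline{\bullet}\,z)$, $(x\,\underline{\triangleright}\,y)\,\underline{\triangleright}\,(z\,\overline{\bullet}\,y)=(x\,\underline{\triangleright}\,z)\,\underline{\triangleright}\,(y\,\underline{\bullet}\,z)$, $(x\,\overline{\triangleright}\,y)\,\overline{\bullet}\,(z\,\overline{\triangleright}\,y)=(x\,\overline{\bullet}\,z)\,\overline{\triangleright}\,(y\,\underline{\triangleright}\,z)$, $(x\,\underline{\triangleright}\,y)\,\underline{\bullet}\,(z\,\underline{\triangleright}\,y)=(x\,\underline{\bullet}\,z)\,\underline{\triangleright}\,(y\,\overline{\triangleright}\,z)$, $(x\,\overline{\triangleright}\,y)\,\underline{\bullet}\,(z\,\overline{\triangleright}\,y)=(x\,\underline{\bullet}\,z)\,\overline{\triangleright}\,(y\,\underline{\triangleright}\,z)$, $(x\,\underline{\triangleright}\,y)\,\overline{\bullet}\,(z\,\underline{\triangleright}\,y)=(x\,\overline{\bullet}\,z)\,\underline{\triangleright}\,(y\,\overline{\triangleright}\,z)$. A psyquandle is $pI$-adequate if moreover $x\,\underline{\bullet}\,x=x\,\overline{\bullet}\,x$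 for all $x\in X$. **Boltzmann weights.** Let $R$ be a commutative ring with identity. A Boltzmann weight for $X$ (with coefficients in $R$) is a pair of maps $\phi,\psi:X\times X\to R$ such that: (a) $\phi(x,x)=0$ for all $x\in X$; (b) for all $x,y\in X$, $\phi(x,y)+\psi(y,(x\,\underline{\triangleright}\,y)\,\overline{\bullet}^{-1}y)=\phi((y\,\overline{\triangleright}\,x)\,\overline{\bullet}^{-1}x,\;(x\,\underline{\triangleright}\,y)\,\overline{\bullet}^{-1}y)+\psi(x,(y\,\overline{\triangleright}\,x)\,\overline{\bullet}^{-1}x)$; (c) for all $x,y,z\in X$, $\phi(x,y)+\phi(y,z)+\phi(x\,\underline{\triangleright}\,y,z\,\overline{\triangleright}\,y)=\phi(x\,\underline{\triangleright}\,z,y\,\underline{\triangleright}\,z)+\phi(x,z)+\phi(y\,\overline{\triangleright}\,x,z\,\overline{\triangleright}\,x)$, $\psi(x,y)+\phi(y,z)+\phi(x\,\underline{\bullet}\,y,z\,\overline{\triangleright}\,y)=\psi(x\,\underline{\triangleright}\,z,y\,\underline{\triangleright}\,z)+\phi(x,z)+\phi(y\,\overline{\bullet}\,x,z\,\overline{\triangleright}\,x)$, $\psi(z,y)-\phi(x,y)-\phi(x\,\underline{\triangleright}\,y,z\,\underline{\bullet}\,y)=\psi(z\,\overline{\triangleright}\,x,y\,\overline{\triangleright}\,x)-\phi(x,z)-\phi(x\,\underline{\triangleright}\,z,y\,\overline{\bullet}\,z)$. If $X$ is $pI$-adequate, the pair $(\phi,\psi)$ is called $pI$-adequate if also $\psi(x,x)=0$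 for all $x\in X$. **Diagrams and moves.** An oriented singular knot or link diagram is an oriented link diagram with, besides classical (positive or negative) crossings, finitely many singular crossings (4-valent rigid vertices through which two strands pass transversally). An oriented pseudoknot/pseudolink diagram is the same kind of diagram with singular crossings replaced by precrossings (crossings lacking over/under information). Singular knots and links are equivalence classes of diagrams under planar isotopy and the oriented singular Reidemeister moves, namely, with all orientations: the classical Reidemeister moves I, II, III; the move IV, in which two strands that meet consecutively in a singular crossing and a classical crossing (bounding a bigon) are replaced by the same two strands meeting in the two crossings in the opposite order, the classical crossing keeping its sign (for parallel downward strands: singular crossing above a classical crossing $\leftrightarrow$ classical crossing of the same sign above a singular crossing); and the moves V, passing a strand entirely over, or entirely under, a singular crossing. Pseudoknots and pseudolinks are equivalence classes of pseudoknot/pseudolink diagrams under the same moves, with singular crossings replaced by precrossings, together with one additional move: introducing or removing a kink (monogon) whose crossing is a precrossing. **Colorings and crossing contributions.** A semiarc is a portion of the diagram between two consecutive crossing points (classical, singular or precrossing). An $X$-coloring of a diagram $L$ assigns an element of $X$ to each semiarc so that at each crossing, drawn in the plane with both strands directed downward, the four adjacent colors have the following form for some $x,y\in X$: - positive classical crossing (over strand from upper right to lower left): upper left $x$, lower left $y$, upper right $y\,\overline{\triangleright}\,x$, lower right $x\,\underline{\triangleright}\,y$; its contribution is $+\phi(x,y)$; - negative classical crossing (over strand from upper left to lower right): upper left $y$, lower left $x$, upper right $x\,\underline{\triangleright}\,y$, lower right $y\,\overline{\triangleright}\,x$; its contribution is $-\phi(x,y)$; - singular crossing or precrossing: upper left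 $x$, lower left $y$, upper right $y\,\overline{\bullet}\,x$, lower right $x\,\underline{\bullet}\,y$; its contribution is $+\psi(x,y)$. $\mathcal{C}(L,X)$ denotes the set of $X$-colorings of $L$. For $L_c\in\mathcal{C}(L,X)$, the Boltzmann weight $BW(L_c)\in R$ is the sum over all crossings of $L_c$ of their contributions. The single-variable Boltzmann-enhanced psyquandle polynomial is $\Phi_X^{\phi,\psi}(L)=\sum_{L_c\in\mathcal{C}(L,X)}w^{BW(L_c)}$, where $w$ is a formal variable with exponents in $R$; equivalently, it is an element of the group ring $\mathbb{Z}[(R,+)]$, encoding the multiset of Boltzmann weights of the $X$-colorings of $L$. *)

theory Defs
  imports "HOL-Analysis.Analysis" "HOL-Library.Poly_Mapping"
begin

section \<open>Psyquandles and Boltzmann weights\<close>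

definition is_right_inverse :: "('x \<Rightarrow> 'x \<Rightarrow> 'x) \<Rightarrow> ('x \<Rightarrow> 'x \<Rightarrow> 'x) \<Rightarrow> bool" where
  "is_right_inverse f g \<longleftrightarrow> (\<forall>x y. g (f x y) y = x \<and> f (g x y) y = x)"

definition right_inverse :: "('x \<Rightarrow> 'x \<Rightarrow> 'x) \<Rightarrow> 'x \<Rightarrow> 'x \<Rightarrow> 'x" where
  "right_inverse f = (THE g. is_right_inverse f g)"

lemma right_inverse_unique:
  assumes "is_right_inverse f g"
  shows "right_inverse f = g"
  unfolding right_inverse_def
proof (rule the_equality)
  fix g' assume g': "is_right_inverse f g'"
  have "g' x y = g x y" for x y
    using assms g' unfolding is_right_inverse_def by metis
  then show "g' = g" by blast
qed (rule assms)

text \<open>The subscripts u and o stand for the underlined and the overlined operations.\<close>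

locale psyquandle =
  fixes ut :: "'x \<Rightarrow> 'x \<Rightarrow> 'x"  (infixl "\<triangleright>\<^sub>u" 70)
    and ot :: "'x \<Rightarrow> 'x \<Rightarrow> 'x"  (infixl "\<triangleright>\<^sub>o" 70)
    and ub :: "'x \<Rightarrow> 'x \<Rightarrow> 'x"  (infixl "\<bullet>\<^sub>u" 70)
    and ob :: "'x \<Rightarrow> 'x \<Rightarrow> 'x"  (infixl "\<bullet>\<^sub>o" 70)
  assumes right_invertible:
      "\<exists>g. is_right_inverse (\<triangleright>\<^sub>u) g" "\<exists>g. is_right_inverse (\<triangleright>\<^sub>o) g"
      "\<exists>g. is_right_inverse (\<bullet>\<^sub>u) g" "\<exists>g. is_right_inverse (\<bullet>\<^sub>o) g"
    and diagonal: "x \<triangleright>\<^sub>u x = x \<triangleright>\<^sub>o x"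
    and bij_S: "bij (\<lambda>(x, y). (y \<triangleright>\<^sub>o x, x \<triangleright>\<^sub>u y))"
    and bij_S': "bij (\<lambda>(x, y). (y \<bullet>\<^sub>o x, x \<bullet>\<^sub>u y))"
    and exchange:
      "(x \<triangleright>\<^sub>u y) \<triangleright>\<^sub>u (z \<triangleright>\<^sub>u y) = (x \<triangleright>\<^sub>u z) \<triangleright>\<^sub>u (y \<triangleright>\<^sub>o z)"
      "(x \<triangleright>\<^sub>u y) \<triangleright>\<^sub>o (z \<triangleright>\<^sub>u y) = (x \<triangleright>\<^sub>o z) \<triangleright>\<^sub>u (y \<triangleright>\<^sub>o z)"
      "(x \<triangleright>\<^sub>o y) \<triangleright>\<^sub>o (z \<triangleright>\<^sub>o y) = (x \<triangleright>\<^sub>o z) \<triangleright>\<^sub>o (y \<triangleright>\<^sub>u z)"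
    and twist:
      "x \<bullet>\<^sub>u right_inverse (\<bullet>\<^sub>o) (y \<triangleright>\<^sub>o x) x =
         right_inverse (\<bullet>\<^sub>o) (x \<triangleright>\<^sub>u y) y \<triangleright>\<^sub>o right_inverse (\<bullet>\<^sub>o) (y \<triangleright>\<^sub>o x) x"
      "y \<bullet>\<^sub>u right_inverse (\<bullet>\<^sub>o) (x \<triangleright>\<^sub>u y) y =
         right_inverse (\<bullet>\<^sub>o) (y \<triangleright>\<^sub>o x) x \<triangleright>\<^sub>u right_inverse (\<bullet>\<^sub>o) (x \<triangleright>\<^sub>u y) y"
    and mixed_exchange:
      "(x \<triangleright>\<^sub>o y) \<triangleright>\<^sub>o (z \<bullet>\<^sub>o y) = (x \<triangleright>\<^sub>o z) \<triangleright>\<^sub>o (y \<bullet>\<^sub>u z)"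
      "(x \<triangleright>\<^sub>u y) \<triangleright>\<^sub>u (z \<bullet>\<^sub>o y) = (x \<triangleright>\<^sub>u z) \<triangleright>\<^sub>u (y \<bullet>\<^sub>u z)"
      "(x \<triangleright>\<^sub>o y) \<bullet>\<^sub>o (z \<triangleright>\<^sub>o y) = (x \<bullet>\<^sub>o z) \<triangleright>\<^sub>o (y \<triangleright>\<^sub>u z)"
      "(x \<triangleright>\<^sub>u y) \<bullet>\<^sub>u (z \<triangleright>\<^sub>u y) = (x \<bullet>\<^sub>u z) \<triangleright>\<^sub>u (y \<triangleright>\<^sub>o z)"
      "(x \<triangleright>\<^sub>o y) \<bullet>\<^sub>u (z \<triangleright>\<^sub>o y) = (x \<bullet>\<^sub>u z) \<triangleright>\<^sub>o (y \<triangleright>\<^sub>u z)"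
      "(x \<triangleright>\<^sub>u y) \<bullet>\<^sub>o (z \<triangleright>\<^sub>u y) = (x \<bullet>\<^sub>o z) \<triangleright>\<^sub>u (y \<triangleright>\<^sub>o z)"

definition pI_adequate :: "('x \<Rightarrow> 'x \<Rightarrow> 'x) \<Rightarrow> ('x \<Rightarrow> 'x \<Rightarrow> 'x) \<Rightarrow> bool" where
  "pI_adequate ub ob \<longleftrightarrow> (\<forall>x. ub x x = ob x x)"

locale boltzmann_weight = psyquandle ut ot ub ob
  for ut :: "'x \<Rightarrow> 'x \<Rightarrow> 'x"  (infixl "\<triangleright>\<^sub>u" 70)
    and ot :: "'x \<Rightarrow> 'x \<Rightarrow> 'x"  (infixl "\<triangleright>\<^sub>o" 70)
    and ub :: "'x \<Rightarrow> 'x \<Rightarrow> 'x"  (infixl "\<bullet>\<^sub>u" 70)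
    and ob :: "'x \<Rightarrow> 'x \<Rightarrow> 'x"  (infixl "\<bullet>\<^sub>o" 70) +
  fixes \<phi> \<psi> :: "'x \<Rightarrow> 'x \<Rightarrow> 'r::comm_ring_1"
  assumes weight_diagonal: "\<phi> x x = 0"
    and weight_twist:
      "\<phi> x y + \<psi> y (right_inverse (\<bullet>\<^sub>o) (x \<triangleright>\<^sub>u y) y) =
         \<phi> (right_inverse (\<bullet>\<^sub>o) (y \<triangleright>\<^sub>o x) x) (right_inverse (\<bullet>\<^sub>o) (x \<triangleright>\<^sub>u y) y)
         + \<psi> x (right_inverse (\<bullet>\<^sub>o) (y \<triangleright>\<^sub>o x) x)"
    and weight_exchange:
      "\<phi> x y + \<phi> y z + \<phi> (x \<triangleright>\<^sub>u y) (z \<triangleright>\<^sub>o y) =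
         \<phi> (x \<triangleright>\<^sub>u z) (y \<triangleright>\<^sub>u z) + \<phi> x z + \<phi> (y \<triangleright>\<^sub>o x) (z \<triangleright>\<^sub>o x)"
      "\<psi> x y + \<phi> y z + \<phi> (x \<bullet>\<^sub>u y) (z \<triangleright>\<^sub>o y) =
         \<psi> (x \<triangleright>\<^sub>u z) (y \<triangleright>\<^sub>u z) + \<phi> x z + \<phi> (y \<bullet>\<^sub>o x) (z \<triangleright>\<^sub>o x)"
      "\<psi> z y - \<phi> x y - \<phi> (x \<triangleright>\<^sub>u y) (z \<bullet>\<^sub>u y) =
         \<psi> (z \<triangleright>\<^sub>o x) (y \<triangleright>\<^sub>o x) - \<phi> x z - \<phi> (x \<triangleright>\<^sub>u z) (y \<bullet>\<^sub>o z)"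

definition pI_adequate_weight :: "('x \<Rightarrow> 'x \<Rightarrow> 'r::comm_ring_1) \<Rightarrow> bool" where
  "pI_adequate_weight \<psi> \<longleftrightarrow> (\<forall>x. \<psi> x x = 0)"

section \<open>Oriented diagrams in the plane\<close>

text \<open>
  The plane is the type of complex numbers.  A diagram with \<open>n\<close> components consists of \<open>n\<close> closed
  curves defined on the unit circle, which is oriented counterclockwise; the values of \<open>curve\<close>
  outside the unit circle are irrelevant.  A pair \<open>(i, z)\<close> is a parameter: the point \<open>z\<close> of
  the circle that carries the \<open>i\<close>-th component.  The field \<open>special\<close> contains the points of the plane at
  which there is a singular crossing (in a singular link diagram) or a precrossing (in a pseudolink
  diagram), and \<open>over\<close> contains the parameters at which a strand passes over a classical crossing.
\<close>

record diagram =
  ncomp :: nat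
  curve :: "nat \<Rightarrow> complex \<Rightarrow> complex"
  over :: "(nat \<times> complex) set"
  special :: "complex set"

definition params :: "diagram \<Rightarrow> (nat \<times> complex) set" where
  "params L = {..<ncomp L} \<times> sphere 0 1"

definition pt :: "diagram \<Rightarrow> nat \<times> complex \<Rightarrow> complex" where
  "pt L = (\<lambda>(i, z). curve L i z)"

definition velocity :: "diagram \<Rightarrow> nat \<times> complex \<Rightarrow> complex" where
  "velocity L = (\<lambda>(i, z). vector_derivative (\<lambda>s. curve L i (z * cis s)) (at 0))"

text \<open>The determinant of two plane vectors; it is positive iff \<open>v\<close> points to the left of \<open>u\<close>.\<close>

definition det2 :: "complex \<Rightarrow> complex \<Rightarrow> real" where
  "det2 u v = Re u * Im v - Im u * Re v"

text \<open>
  Every double point is recorded once, as the ordered pair \<open>(a, b)\<close> in which \<open>a\<close> runs from the upper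
  left to the lower right and \<open>b\<close> from the upper right to the lower left when the crossing is drawn
  with both strands directed downward.  For the directions \<open>(1, -1)\<close> and \<open>(-1, -1)\<close> of these two
  strands the determinant is \<open>-2\<close>.
\<close>

definition crossings :: "diagram \<Rightarrow> ((nat \<times> complex) \<times> (nat \<times> complex)) set" where
  "crossings L = {(a, b). a \<in> params L \<and> b \<in> params L \<and> a \<noteq> b \<and> pt L a = pt L b \<and>
                          det2 (velocity L a) (velocity L b) < 0}"

definition passages :: "diagram \<Rightarrow> (nat \<times> complex) set" where
  "passages L = fst ` crossings L \<union> snd ` crossings L"

definition link_diagram :: "diagram \<Rightarrow> bool" where
  "link_diagram L \<longleftrightarrow>
     0 < ncomp L \<and>
     (\<forall>i < ncomp L. (\<lambda>t. curve L i (cis t)) C1_differentiable_on UNIV) \<and>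
     (\<forall>q \<in> params L. velocity L q \<noteq> 0) \<and>
     (\<forall>a \<in> params L. \<forall>b \<in> params L.
        a \<noteq> b \<and> pt L a = pt L b \<longrightarrow> det2 (velocity L a) (velocity L b) \<noteq> 0) \<and>
     (\<forall>a \<in> params L. \<forall>b \<in> params L. \<forall>c \<in> params L.
        pt L a = pt L b \<and> pt L b = pt L c \<longrightarrow> a = b \<or> b = c \<or> a = c) \<and>
     finite (crossings L) \<and>
     special L \<subseteq> pt L ` passages L \<and>
     over L \<subseteq> {q \<in> passages L. pt L q \<notin> special L} \<and>
     (\<forall>(a, b) \<in> crossings L. pt L a \<notin> special L \<longrightarrow> (a \<in> over L) \<noteq> (b \<in> over L))"

section \<open>Colorings and the polynomial\<close>

text \<open>A component without crossings is a single semiarc.\<close>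

definition semiarcs :: "diagram \<Rightarrow> (nat \<times> complex) set set" where
  "semiarcs L = components (params L - passages L)"

definition in_arc :: "diagram \<Rightarrow> nat \<times> complex \<Rightarrow> (nat \<times> complex) set" where
  "in_arc L = (\<lambda>(i, z). THE S. S \<in> semiarcs L \<and> (\<forall>\<^sub>F s in at_left 0. (i, z * cis s) \<in> S))"

definition out_arc :: "diagram \<Rightarrow> nat \<times> complex \<Rightarrow> (nat \<times> complex) set" where
  "out_arc L = (\<lambda>(i, z). THE S. S \<in> semiarcs L \<and> (\<forall>\<^sub>F s in at_right 0. (i, z * cis s) \<in> S))"

text \<open>
  At a crossing \<open>(a, b)\<close> the semiarcs at the upper left, lower right, upper right and lower left are
  \<open>in_arc L a\<close>, \<open>out_arc L a\<close>, \<open>in_arc L b\<close> and \<open>out_arc L b\<close>.  A classical crossing is positive iff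
  its over strand is \<open>b\<close>.  At a negative crossing the color \<open>x\<close> is at the lower left and \<open>y\<close> at the
  upper left.
\<close>

definition crossing_rule ::
  "('x \<Rightarrow> 'x \<Rightarrow> 'x) \<Rightarrow> ('x \<Rightarrow> 'x \<Rightarrow> 'x) \<Rightarrow> ('x \<Rightarrow> 'x \<Rightarrow> 'x) \<Rightarrow> ('x \<Rightarrow> 'x \<Rightarrow> 'x) \<Rightarrow>
   diagram \<Rightarrow> ((nat \<times> complex) set \<Rightarrow> 'x) \<Rightarrow> (nat \<times> complex) \<times> (nat \<times> complex) \<Rightarrow> bool" where
  "crossing_rule ut ot ub ob L c = (\<lambda>(a, b).
     let ul = c (in_arc L a); lr = c (out_arc L a); ur = c (in_arc L b); ll = c (out_arc L b) in
     if pt L a \<in> special L then ur = ob ll ul \<and> lr = ub ul ll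
     else if b \<in> over L then ur = ot ll ul \<and> lr = ut ul ll
     else ur = ut ll ul \<and> lr = ot ul ll)"

definition colorings ::
  "('x \<Rightarrow> 'x \<Rightarrow> 'x) \<Rightarrow> ('x \<Rightarrow> 'x \<Rightarrow> 'x) \<Rightarrow> ('x \<Rightarrow> 'x \<Rightarrow> 'x) \<Rightarrow> ('x \<Rightarrow> 'x \<Rightarrow> 'x) \<Rightarrow>
   diagram \<Rightarrow> ((nat \<times> complex) set \<Rightarrow> 'x) set" where
  "colorings ut ot ub ob L =
     {c \<in> semiarcs L \<rightarrow>\<^sub>E UNIV. \<forall>p \<in> crossings L. crossing_rule ut ot ub ob L c p}"

definition contribution ::
  "('x \<Rightarrow> 'x \<Rightarrow> 'r) \<Rightarrow> ('x \<Rightarrow> 'x \<Rightarrow> 'r) \<Rightarrow> diagram \<Rightarrow> ((nat \<times> complex) set \<Rightarrow> 'x) \<Rightarrow>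
   (nat \<times> complex) \<times> (nat \<times> complex) \<Rightarrow> 'r::comm_ring_1" where
  "contribution \<phi> \<psi> L c = (\<lambda>(a, b).
     let ul = c (in_arc L a); ll = c (out_arc L b) in
     if pt L a \<in> special L then \<psi> ul ll
     else if b \<in> over L then \<phi> ul ll
     else - \<phi> ll ul)"

definition BW ::
  "('x \<Rightarrow> 'x \<Rightarrow> 'r) \<Rightarrow> ('x \<Rightarrow> 'x \<Rightarrow> 'r) \<Rightarrow> diagram \<Rightarrow> ((nat \<times> complex) set \<Rightarrow> 'x) \<Rightarrow>
   'r::comm_ring_1" where
  "BW \<phi> \<psi> L c = (\<Sum>p \<in> crossings L. contribution \<phi> \<psi> L c p)"

text \<open>
  The type of finitely supported functions from \<open>'r\<close> to the integers, with convolution as product, is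
  the group ring of the additive group of \<open>'r\<close>; \<open>Poly_Mapping.single r 1\<close> is the monomial \<open>w\<^sup>r\<close>.
\<close>

definition Phi ::
  "('x \<Rightarrow> 'x \<Rightarrow> 'x) \<Rightarrow> ('x \<Rightarrow> 'x \<Rightarrow> 'x) \<Rightarrow> ('x \<Rightarrow> 'x \<Rightarrow> 'x) \<Rightarrow> ('x \<Rightarrow> 'x \<Rightarrow> 'x) \<Rightarrow>
   ('x \<Rightarrow> 'x \<Rightarrow> 'r) \<Rightarrow> ('x \<Rightarrow> 'x \<Rightarrow> 'r) \<Rightarrow> diagram \<Rightarrow> ('r::comm_ring_1 \<Rightarrow>\<^sub>0 int)" where
  "Phi ut ot ub ob \<phi> \<psi> L =
     (\<Sum>c \<in> colorings ut ot ub ob L. Poly_Mapping.single (BW \<phi> \<psi> L c) 1)"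

section \<open>Planar isotopy\<close>

definition ambient_isotopy :: "(real \<Rightarrow> complex \<Rightarrow> complex) \<Rightarrow> bool" where
  "ambient_isotopy H \<longleftrightarrow>
     H 0 = id \<and>
     (\<forall>t \<in> {0..1}. bij (H t)) \<and>
     continuous_on ({0..1} \<times> UNIV) (\<lambda>(t, z). H t z) \<and>
     (\<exists>D :: real \<Rightarrow> complex \<Rightarrow> complex \<Rightarrow>\<^sub>L complex.
        (\<forall>t \<in> {0..1}. \<forall>z. (H t has_derivative blinfun_apply (D t z)) (at z) \<and>
           det2 (blinfun_apply (D t z) 1) (blinfun_apply (D t z) \<i>) \<noteq> 0) \<and>
        continuous_on ({0..1} \<times> UNIV) (\<lambda>(t, z). D t z))"

text \<open>Orientation preserving diffeomorphisms of the unit circle, described by their lifts.\<close>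

definition circle_reparam :: "(complex \<Rightarrow> complex) \<Rightarrow> bool" where
  "circle_reparam g \<longleftrightarrow>
     (\<exists>\<rho> \<rho>'. (\<forall>t. g (cis t) = cis (\<rho> t)) \<and>
        (\<forall>t. \<rho> (t + 2 * pi) = \<rho> t + 2 * pi) \<and>
        (\<forall>t. (\<rho> has_real_derivative \<rho>' t) (at t) \<and> 0 < \<rho>' t) \<and>
        continuous_on UNIV \<rho>')"

text \<open>
  The components may be renumbered and reparametrized, because a diagram is an oriented picture in the
  plane.
\<close>

definition planar_isotopic :: "diagram \<Rightarrow> diagram \<Rightarrow> bool" where
  "planar_isotopic L L' \<longleftrightarrow> link_diagram L \<and> link_diagram L' \<and>
     (\<exists>H \<pi> g. ambient_isotopy H \<and>
        bij_betw \<pi> {..<ncomp L'} {..<ncomp L} \<and> (\<forall>i < ncomp L'. circle_reparam (g i)) \<and>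
        (\<forall>(i, z) \<in> params L'. pt L' (i, z) = H 1 (pt L (\<pi> i, g i z)) \<and>
           ((i, z) \<in> over L' \<longleftrightarrow> (\<pi> i, g i z) \<in> over L)) \<and>
        special L' = H 1 ` special L)"

section \<open>Local pictures and local moves\<close>

text \<open>
  A local picture is drawn in the square \<open>[-1, 1] \<times> [-1, 1]\<close>.  It consists of arcs parametrized
  by \<open>[-1, 1]\<close>, the set \<open>tover\<close> of the parameters \<open>(k, t)\<close> at which the \<open>k\<close>-th arc passes over a
  classical crossing, and the set \<open>tspecial\<close> of the singular crossings (or precrossings).
\<close>

record picture =
  arcs :: "(real \<Rightarrow> complex) list"
  tover :: "(nat \<times> real) set"
  tspecial :: "complex set"

definition square :: "complex set" where
  "square = {z. \<bar>Re z\<bar> \<le> 1 \<and> \<bar>Im z\<bar> \<le> 1}"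

definition tparams :: "picture \<Rightarrow> (nat \<times> real) set" where
  "tparams T = {..<length (arcs T)} \<times> {-1..1}"

definition plane_diffeo :: "(complex \<Rightarrow> complex) \<Rightarrow> bool" where
  "plane_diffeo h \<longleftrightarrow> bij h \<and>
     (\<exists>D :: complex \<Rightarrow> complex \<Rightarrow>\<^sub>L complex.
        (\<forall>z. (h has_derivative blinfun_apply (D z)) (at z) \<and>
             0 < det2 (blinfun_apply (D z) 1) (blinfun_apply (D z) \<i>)) \<and>
        continuous_on UNIV D)"

text \<open>
  A placement \<open>P\<close> assigns to the \<open>k\<close>-th arc of a picture a component \<open>i\<close> of the diagram and the affine
  map from \<open>[-1, 1]\<close> to angles on the \<open>i\<close>-th circle with centre \<open>m\<close> and slope \<open>w\<close>.  If \<open>w\<close> is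
  negative, the orientation of the diagram is opposite to the parametrization of the arc, so every
  picture stands for all choices of orientations of its arcs.
\<close>

definition place :: "(nat \<Rightarrow> nat \<times> real \<times> real) \<Rightarrow> nat \<times> real \<Rightarrow> nat \<times> complex" where
  "place P = (\<lambda>(k, t). case P k of (i, m, w) \<Rightarrow> (i, cis (m + w * t)))"

definition occurs ::
  "picture \<Rightarrow> (complex \<Rightarrow> complex) \<Rightarrow> (nat \<Rightarrow> nat \<times> real \<times> real) \<Rightarrow> diagram \<Rightarrow> bool" where
  "occurs T h P L \<longleftrightarrow>
     inj_on (place P) (tparams T) \<and>
     place P ` tparams T = {q \<in> params L. pt L q \<in> h ` square} \<and>
     (\<forall>(k, t) \<in> tparams T. pt L (place P (k, t)) = h ((arcs T ! k) t) \<and>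
        (place P (k, t) \<in> over L \<longleftrightarrow> (k, t) \<in> tover T)) \<and>
     special L \<inter> h ` square = h ` tspecial T"

definition agree_outside :: "complex set \<Rightarrow> diagram \<Rightarrow> diagram \<Rightarrow> bool" where
  "agree_outside A L L' \<longleftrightarrow>
     ncomp L = ncomp L' \<and>
     (\<forall>q \<in> params L. pt L q \<notin> A \<longrightarrow> pt L' q = pt L q \<and> (q \<in> over L' \<longleftrightarrow> q \<in> over L)) \<and>
     special L - A = special L' - A"

definition local_move :: "picture \<Rightarrow> picture \<Rightarrow> diagram \<Rightarrow> diagram \<Rightarrow> bool" where
  "local_move T T' L L' \<longleftrightarrow> link_diagram L \<and> link_diagram L' \<and>
     (\<exists>h P. plane_diffeo h \<and> occurs T h P L \<and> occurs T' h P L' \<and> agree_outside (h ` square) L L')"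

text \<open>
  In the pictures below, the factor \<open>(1 - t\<^sup>2)\<^sup>2\<close> makes the two sides of a move agree to first order at
  the end points of the arcs, so that replacing one side by the other yields continuously
  differentiable curves.  The numerical constants put all crossings at parameters in
  \<open>{-1/2, 0, 1/2}\<close>.
\<close>

definition bump :: "real \<Rightarrow> real" where
  "bump t = (1 - t\<^sup>2)\<^sup>2"

text \<open>An arc without crossings, and an arc with one self-crossing at \<open>\<i>/4\<close>.\<close>

definition plain_arc :: "real \<Rightarrow> complex" where
  "plain_arc t = Complex t (t\<^sup>2)"

definition kink_arc :: "real \<Rightarrow> complex" where
  "kink_arc t = Complex (t - 16/9 * t * bump t) (t\<^sup>2)"

text \<open>Two disjoint arcs, and two arcs with the same ends that cross at \<open>-1/2\<close> and at \<open>1/2\<close>.\<close>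

definition apart_arcs :: "(real \<Rightarrow> complex) list" where
  "apart_arcs = [\<lambda>t. Complex t (9/16), \<lambda>t. Complex t (- (9/16))]"

definition bigon_arcs :: "(real \<Rightarrow> complex) list" where
  "bigon_arcs = [\<lambda>t. Complex t (9/16 - bump t), \<lambda>t. Complex t (bump t - 9/16)]"

text \<open>
  Two diagonals that cross at the origin, and a third arc that crosses both of them above
  (\<open>e = 1\<close>) or below (\<open>e = -1\<close>) the origin.
\<close>

definition triangle_arcs :: "real \<Rightarrow> (real \<Rightarrow> complex) list" where
  "triangle_arcs e = [\<lambda>t. Complex t t, \<lambda>t. Complex t (- t), \<lambda>t. Complex t (e * (8/9) * bump t)]"

text \<open>
  The picture with the given arcs in which the \<open>k\<close>-th arc lies at height \<open>ht ! k\<close>, apart from the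
  special crossings in \<open>S\<close>.
\<close>

definition layered :: "(real \<Rightarrow> complex) list \<Rightarrow> nat list \<Rightarrow> complex set \<Rightarrow> picture" where
  "layered as ht S = \<lparr>arcs = as,
     tover = {(k, t). k < length as \<and> t \<in> {-1..1} \<and> (as ! k) t \<notin> S \<and>
       (\<exists>l < length as. \<exists>t' \<in> {-1..1}. (as ! l) t' = (as ! k) t \<and> ht ! l < ht ! k)},
     tspecial = S\<rparr>"

text \<open>In move I, \<open>t\<close> is the parameter at which the kink passes over itself.\<close>

definition move_I :: "diagram \<Rightarrow> diagram \<Rightarrow> bool" where
  "move_I L L' \<longleftrightarrow> (\<exists>t \<in> {-1/2, 1/2}.
     local_move \<lparr>arcs = [plain_arc], tover = {}, tspecial = {}\<rparr>
                \<lparr>arcs = [kink_arc], tover = {(0, t)}, tspecial = {}\<rparr> L L')"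

definition move_II :: "diagram \<Rightarrow> diagram \<Rightarrow> bool" where
  "move_II L L' \<longleftrightarrow> (\<exists>ht. length ht = 2 \<and> distinct ht \<and>
     local_move (layered apart_arcs ht {}) (layered bigon_arcs ht {}) L L')"

definition move_III :: "diagram \<Rightarrow> diagram \<Rightarrow> bool" where
  "move_III L L' \<longleftrightarrow> (\<exists>ht. length ht = 3 \<and> distinct ht \<and>
     local_move (layered (triangle_arcs 1) ht {}) (layered (triangle_arcs (-1)) ht {}) L L')"

text \<open>
  In move IV the two sides consist of the same arcs.  The directions of the arcs \<open>0\<close> and \<open>1\<close> at \<open>-1/2\<close>
  are those of the arcs \<open>1\<close> and \<open>0\<close> at \<open>1/2\<close>, hence the classical crossing keeps its sign iff the
  over arc changes.
\<close>

definition move_IV :: "diagram \<Rightarrow> diagram \<Rightarrow> bool" where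
  "move_IV L L' \<longleftrightarrow> (\<exists>k \<in> {0, 1}.
     local_move \<lparr>arcs = bigon_arcs, tover = {(k, 1/2)}, tspecial = {-1/2}\<rparr>
                \<lparr>arcs = bigon_arcs, tover = {(1 - k, -1/2)}, tspecial = {1/2}\<rparr> L L')"

text \<open>In move V the third arc lies entirely over or entirely under the special crossing at the origin.\<close>

definition move_V :: "diagram \<Rightarrow> diagram \<Rightarrow> bool" where
  "move_V L L' \<longleftrightarrow> (\<exists>ht \<in> {[1, 1, 2], [1, 1, 0]}.
     local_move (layered (triangle_arcs 1) ht {0}) (layered (triangle_arcs (-1)) ht {0}) L L')"

definition move_pI :: "diagram \<Rightarrow> diagram \<Rightarrow> bool" where
  "move_pI = local_move \<lparr>arcs = [plain_arc], tover = {}, tspecial = {}\<rparr>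
                        \<lparr>arcs = [kink_arc], tover = {}, tspecial = {\<i> / 4}\<rparr>"

definition singular_step :: "diagram \<Rightarrow> diagram \<Rightarrow> bool" where
  "singular_step L L' \<longleftrightarrow> planar_isotopic L L' \<or> move_I L L' \<or> move_II L L' \<or> move_III L L' \<or>
     move_IV L L' \<or> move_V L L'"

definition pseudo_step :: "diagram \<Rightarrow> diagram \<Rightarrow> bool" where
  "pseudo_step L L' \<longleftrightarrow> singular_step L L' \<or> move_pI L L'"

definition singular_equivalent :: "diagram \<Rightarrow> diagram \<Rightarrow> bool" where
  "singular_equivalent = equivclp singular_step"

definition pseudo_equivalent :: "diagram \<Rightarrow> diagram \<Rightarrow> bool" where
  "pseudo_equivalent = equivclp pseudo_step"

end

theory Submission
  imports Defs
begin

text \<open>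
  A coloring assigns colors to semiarcs, and each crossing is a condition on the four semiarcs at it and
  contributes a weight that depends on their colors.  The invariance of the polynomial has a geometric
  and an algebraic side.

  Geometry.  A coloring is the same as a function on the parameters of the diagram that is continuous
  from the left and jumps only at the passages (\<open>Phi_eq_sum_over_flows\<close>).  Such functions can be
  transported along a reparametrization, and they can be glued pointwise.  A planar isotopy ends in a
  diffeomorphism with positive Jacobian, so it transports crossings with their order of strands, and
  composition with it is a bijection of the colorings that preserves the weights
  (\<open>Phi_planar_isotopy\<close>).  In a local move the two diagrams agree outside a disc, and inside it a
  coloring is given by at most four labels on each arc.  It therefore suffices that the colorings of the
  two local pictures with the same labels at the ends correspond one to one, with equal weights
  (\<open>Phi_local_move\<close>).

  Algebra.  At a crossing each strand has one color to the right and one color to the left of the other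
  strand.  In these terms the conditions at a crossing do not mention the orientations: reversing a
  strand exchanges the names right and left and the sign of the crossing.  A kink closes up because of the
  diagonal axiom (\<open>kink_closes\<close>), and the two crossings of a bigon in move II impose the same
  condition with opposite weights.  In moves III and V three strands cross pairwise.  The semiarcs are
  edges and the crossings are faces of a cube whose vertices say on which side of each strand one is; one
  triangle shows the three faces at a vertex and the other triangle the three opposite faces.  The
  exchange axioms color the whole cube from one vertex; uniqueness and the finiteness of the set of colors
  allow any vertex instead (\<open>cube_extension\<close>), and this covers all orientations at once.  The weights of
  the six faces, with alternating signs, add up to zero.

  Move IV with parallel strands says that a singular and a classical crossing commute as permutations of
  pairs of colors, which is the twist axiom.  With antiparallel strands, moving strands over and under
  the singular crossing by move V and using one kink reduces the claim to the parallel case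
  (\<open>antiparallel_twist_positive\<close>).  Negative crossings are positive crossings of the mirror image, which
  satisfies the same axioms (\<open>mirror\<close>).
\<close>

section \<open>Crossing types and cubes of colors\<close>

text \<open>
  A crossing type, seen from an ordered pair of strands.  If \<open>x\<close> and \<open>y\<close> are the colors of the first
  and of the second strand to the right of the other one, then \<open>act1 x y\<close> and \<open>act2 y x\<close> are their
  colors to the left of the other one, and \<open>wgt x y\<close> is the weight of the crossing.
\<close>

datatype ('x, 'r) kind =
  Kind (act1: "'x \<Rightarrow> 'x \<Rightarrow> 'x") (act2: "'x \<Rightarrow> 'x \<Rightarrow> 'x") (wgt: "'x \<Rightarrow> 'x \<Rightarrow> 'r")

text \<open>
  The crossing seen from the pair of strands in the other order.  The sign of the weight makes the
  flipped positive crossing the negative crossing.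
\<close>

definition flip :: "('x, 'r::comm_ring_1) kind \<Rightarrow> ('x, 'r) kind" where
  "flip K = Kind (act2 K) (act1 K) (\<lambda>x y. - wgt K y x)"

lemma flip_simps [simp]:
  "act1 (flip K) = act2 K" "act2 (flip K) = act1 K" "wgt (flip K) x y = - wgt K y x"
  "flip (flip K) = K"
  by (auto simp: flip_def)

text \<open>
  The arguments are the colors at the upper left, lower right, upper right and lower left when both
  strands are directed downward; the first strand goes from the upper left to the lower right.
\<close>

definition fits :: "('x, 'r) kind \<Rightarrow> 'x \<Rightarrow> 'x \<Rightarrow> 'x \<Rightarrow> 'x \<Rightarrow> bool" where
  "fits K ul lr ur ll \<longleftrightarrow> lr = act1 K ul ll \<and> ur = act2 K ll ul"

text \<open>
  Here \<open>p\<close> and \<open>q\<close> give the color of a strand on the right (\<open>True\<close>) and on the left (\<open>False\<close>) of the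
  other strand.
\<close>

definition face :: "('x, 'r) kind \<Rightarrow> (bool \<Rightarrow> 'x) \<Rightarrow> (bool \<Rightarrow> 'x) \<Rightarrow> bool" where
  "face K p q \<longleftrightarrow> fits K (p True) (p False) (q False) (q True)"

lemma face_flip [simp]: "face (flip K) q p = face K p q"
  by (auto simp: face_def fits_def)

text \<open>
  Any two adjacent semiarcs at the crossing determine the other two; the four choices of \<open>s\<close> and \<open>t\<close>
  are the four pairs of adjacent semiarcs.
\<close>

definition rigid :: "('x, 'r) kind \<Rightarrow> bool" where
  "rigid K \<longleftrightarrow> (\<forall>p q p' q' s t. face K p q \<longrightarrow> face K p' q' \<longrightarrow> p s = p' s \<longrightarrow> q t = q' t \<longrightarrow> p = p' \<and> q = q')"

lemma rigidD:
  assumes "rigid K" "face K p q" "face K p' q'" "p s = p' s" "q t = q' t"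
  shows "p = p'" "q = q'"
  using assms unfolding rigid_def by blast+

lemma rigid_flip: "rigid K \<Longrightarrow> rigid (flip K)"
  unfolding rigid_def by (metis face_flip)

lemma rigidI:
  assumes "\<exists>h. is_right_inverse (act1 K) h" "\<exists>h. is_right_inverse (act2 K) h"
    and "inj (\<lambda>(x, y). (act2 K y x, act1 K x y))"
  shows "rigid K"
  unfolding rigid_def
proof (intro allI impI)
  fix p q p' q' :: "bool \<Rightarrow> 'a" and s t
  assume f: "face K p q" "face K p' q'" and e: "p s = p' s" "q t = q' t"
  obtain h1 h2 where h: "is_right_inverse (act1 K) h1" "is_right_inverse (act2 K) h2"
    using assms by blast
  have "p True = p' True \<and> q True = q' True"
  proof (cases s; cases t)
    assume "\<not> s" "\<not> t"
    then show ?thesis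
      using e f injD[OF assms(3), of "(p True, q True)" "(p' True, q' True)"]
      by (auto simp: face_def fits_def)
  qed (use e f h in \<open>auto simp: face_def fits_def is_right_inverse_def, metis+\<close>)
  then show "p = p' \<and> q = q'"
    using f by (auto simp: face_def fits_def fun_eq_iff all_bool_eq)
qed

text \<open>
  The colors of two adjacent semiarcs determine the colors to the right of both strands, so the map from the
  latter pair to the former is injective; on a finite set of colors it is onto.
\<close>

lemma face_exists:
  fixes K :: "('x::finite, 'r) kind"
  assumes "rigid K"
  obtains p q where "face K p q" "p s = x" "q t = y"
proof -
  define P where "P = (\<lambda>(a, b) u. if u then a else act1 K a b)"
  define Q where "Q = (\<lambda>(a, b) u. if u then b else act2 K b a)"
  have F: "face K (P c) (Q c)" for c
    by (auto simp: P_def Q_def face_def fits_def split: prod.splits)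
  have "inj (\<lambda>c. (P c s, Q c t))"
  proof (rule injI)
    fix c c' assume "(P c s, Q c t) = (P c' s, Q c' t)"
    then have e: "P c s = P c' s" "Q c t = Q c' t" by auto
    have "P c = P c'" "Q c = Q c'"
      by (fact rigidD[of K "P c" "Q c" "P c'" "Q c'" s t, OF assms F F e])+
    then have "P c True = P c' True" "Q c True = Q c' True" by simp_all
    then show "c = c'" by (simp add: P_def Q_def prod_eq_iff split: prod.splits)
  qed
  then have "surj (\<lambda>c. (P c s, Q c t))"
    by (rule finite_UNIV_inj_surj[OF finite])
  from surjD[OF this, of "(x, y)"] obtain c where "(x, y) = (P c s, Q c t)" by blast
  then show ?thesis using that[OF F] by auto
qed

text \<open>
  Three strands 0, 1 and 2 that cross pairwise.  The vertices of the cube are the triples of sides of the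
  strands, its edges in the three directions are semiarcs of the three strands, and its faces are
  crossings.  The functions \<open>X\<close>, \<open>Y\<close> and \<open>Z\<close> give the colors of the edges of the strands 0, 1 and 2; their
  arguments are the sides of the two other strands in increasing order.
\<close>

definition cube_coloring where
  "cube_coloring K01 K02 K12 X Y Z \<longleftrightarrow>
     (\<forall>s. face K01 (\<lambda>t. X t s) (\<lambda>t. Y t s) \<and> face K02 (\<lambda>t. X s t) (\<lambda>t. Z t s) \<and>
          face K12 (\<lambda>t. Y s t) (\<lambda>t. Z s t))"

text \<open>
  This is what the exchange axioms say: the colors of the three edges at one vertex extend to the cube, and
  the alternating sum of the weights of the faces is zero.
\<close>

definition compatible :: "('x, 'r::comm_ring_1) kind \<Rightarrow> ('x, 'r) kind \<Rightarrow> ('x, 'r) kind \<Rightarrow> bool" where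
  "compatible K01 K02 K12 \<longleftrightarrow>
     (\<forall>x y z. \<exists>X Y Z. cube_coloring K01 K02 K12 X Y Z \<and>
        X True True = x \<and> Y True True = y \<and> Z True True = z) \<and>
     (\<forall>X Y Z. cube_coloring K01 K02 K12 X Y Z \<longrightarrow>
        wgt K01 (X True True) (Y True True) - wgt K01 (X True False) (Y True False) +
        (wgt K12 (Y True True) (Z True True) - wgt K12 (Y False True) (Z False True)) =
        wgt K02 (X True True) (Z True True) - wgt K02 (X False True) (Z True False))"

lemma cube_coloring_swaps:
  "cube_coloring (flip K01) K12 K02 Y X (\<lambda>s t. Z t s) \<longleftrightarrow> cube_coloring K01 K02 K12 X Y Z"
  "cube_coloring K02 K01 (flip K12) (\<lambda>s t. X t s) Z Y \<longleftrightarrow> cube_coloring K01 K02 K12 X Y Z"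
  unfolding cube_coloring_def by auto

text \<open>
  Renaming the strands permutes the axes of the cube.  Together with the next lemma this reduces all
  orders of the heights of three strands to a single one.
\<close>

lemma compatible_swap01:
  assumes "compatible K01 K02 K12"
  shows "compatible (flip K01) K12 K02"
proof -
  have *: "cube_coloring (flip K01) K12 K02 X Y Z \<longleftrightarrow> cube_coloring K01 K02 K12 Y X (\<lambda>s t. Z t s)" for X Y Z
    using cube_coloring_swaps(1)[of K01 K12 K02 X Y "\<lambda>s t. Z t s"] by simp
  show ?thesis
    unfolding compatible_def *
  proof (intro conjI allI impI)
    fix x y z
    obtain X Y Z where "cube_coloring K01 K02 K12 X Y Z" "X True True = y" "Y True True = x" "Z True True = z"
      using assms unfolding compatible_def by meson
    then show "\<exists>X Y Z. cube_coloring K01 K02 K12 Y X (\<lambda>s t. Z t s) \<and>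
        X True True = x \<and> Y True True = y \<and> Z True True = z"
      by (intro exI[of _ Y] exI[of _ X] exI[of _ "\<lambda>s t. Z t s"]) simp
  next
    fix X Y Z
    assume "cube_coloring K01 K02 K12 Y X (\<lambda>s t. Z t s)"
    then have "wgt K01 (Y True True) (X True True) - wgt K01 (Y True False) (X True False) +
        (wgt K12 (X True True) (Z True True) - wgt K12 (X False True) (Z True False)) =
        wgt K02 (Y True True) (Z True True) - wgt K02 (Y False True) (Z False True)"
      using assms unfolding compatible_def by blast
    then show "wgt (flip K01) (X True True) (Y True True) - wgt (flip K01) (X True False) (Y True False) +
       (wgt K02 (Y True True) (Z True True) - wgt K02 (Y False True) (Z False True)) =
       wgt K12 (X True True) (Z True True) - wgt K12 (X False True) (Z True False)"
      by (simp add: algebra_simps)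
  qed
qed

lemma compatible_swap12:
  assumes "compatible K01 K02 K12"
  shows "compatible K02 K01 (flip K12)"
proof -
  have *: "cube_coloring K02 K01 (flip K12) X Y Z \<longleftrightarrow> cube_coloring K01 K02 K12 (\<lambda>s t. X t s) Z Y" for X Y Z
    unfolding cube_coloring_def by auto
  show ?thesis
    unfolding compatible_def *
  proof (intro conjI allI impI)
    fix x y z
    obtain X Y Z where "cube_coloring K01 K02 K12 X Y Z" "X True True = x" "Y True True = z" "Z True True = y"
      using assms unfolding compatible_def by meson
    then show "\<exists>X Y Z. cube_coloring K01 K02 K12 (\<lambda>s t. X t s) Z Y \<and>
        X True True = x \<and> Y True True = y \<and> Z True True = z"
      by (intro exI[of _ "\<lambda>s t. X t s"] exI[of _ Z] exI[of _ Y]) simp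
  next
    fix X Y Z
    assume "cube_coloring K01 K02 K12 (\<lambda>s t. X t s) Z Y"
    then have "wgt K01 (X True True) (Z True True) - wgt K01 (X False True) (Z True False) +
        (wgt K12 (Z True True) (Y True True) - wgt K12 (Z False True) (Y False True)) =
        wgt K02 (X True True) (Y True True) - wgt K02 (X True False) (Y True False)"
      using assms unfolding compatible_def by blast
    then show "wgt K02 (X True True) (Y True True) - wgt K02 (X True False) (Y True False) +
       (wgt (flip K12) (Y True True) (Z True True) - wgt (flip K12) (Y False True) (Z False True)) =
       wgt K01 (X True True) (Z True True) - wgt K01 (X False True) (Z True False)"
      by (simp add: algebra_simps)
  qed
qed

lemma compatibleI:
  assumes law0: "\<And>x y z. act1 K02 (act1 K01 x y) (act2 K12 z y) = act1 K01 (act1 K02 x z) (act1 K12 y z)"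
    and law1: "\<And>x y z. act1 K12 (act2 K01 y x) (act2 K02 z x) = act2 K01 (act1 K12 y z) (act1 K02 x z)"
    and law2: "\<And>x y z. act2 K02 (act2 K12 z y) (act1 K01 x y) = act2 K12 (act2 K02 z x) (act2 K01 y x)"
    and weights: "\<And>x y z. wgt K01 x y - wgt K01 (act1 K02 x z) (act1 K12 y z) +
        (wgt K12 y z - wgt K12 (act2 K01 y x) (act2 K02 z x)) =
        wgt K02 x z - wgt K02 (act1 K01 x y) (act2 K12 z y)"
  shows "compatible K01 K02 (K12 :: ('x, 'r::comm_ring_1) kind)"
  unfolding compatible_def
proof (intro conjI allI impI)
  fix x y z
  let ?X = "\<lambda>s t. if s then (if t then x else act1 K02 x z)
                  else if t then act1 K01 x y else act1 K02 (act1 K01 x y) (act2 K12 z y)"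
  let ?Y = "\<lambda>s t. if s then (if t then y else act1 K12 y z)
                  else if t then act2 K01 y x else act1 K12 (act2 K01 y x) (act2 K02 z x)"
  let ?Z = "\<lambda>s t. if s then (if t then z else act2 K12 z y)
                  else if t then act2 K02 z x else act2 K12 (act2 K02 z x) (act2 K01 y x)"
  show "\<exists>X Y Z. cube_coloring K01 K02 K12 X Y Z \<and> X True True = x \<and> Y True True = y \<and> Z True True = z"
    by (rule exI[of _ ?X], rule exI[of _ ?Y], rule exI[of _ ?Z])
       (auto simp: cube_coloring_def all_bool_eq face_def fits_def law0 law1 law2)
next
  fix X Y Z
  assume "cube_coloring K01 K02 K12 X Y Z"
  then show "wgt K01 (X True True) (Y True True) - wgt K01 (X True False) (Y True False) +
      (wgt K12 (Y True True) (Z True True) - wgt K12 (Y False True) (Z False True)) =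
      wgt K02 (X True True) (Z True True) - wgt K02 (X False True) (Z True False)"
    using weights[of "X True True" "Y True True" "Z True True"]
    by (simp add: cube_coloring_def all_bool_eq face_def fits_def)
qed

text \<open>
  Two neighbouring vertices lie on two common faces, so the colors at one vertex determine those at its
  neighbours and hence the whole cube.  The map from the colors at the vertex on the right of all strands
  to those at \<open>(v0, v1, v2)\<close> is therefore injective, and by finiteness it is onto.  A preimage of the
  given colors yields a cube coloring which agrees with the given faces because they are determined by
  the edges at the vertex.
\<close>

lemma cube_extension:
  fixes K01 K02 K12 :: "('x::finite, 'r::comm_ring_1) kind"
  assumes comp: "compatible K01 K02 K12" and rig: "rigid K01" "rigid K02" "rigid K12"
    and faces: "face K01 (\<lambda>t. X t v2) (\<lambda>t. Y t v2)" "face K02 (\<lambda>t. X v1 t) (\<lambda>t. Z t v1)"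
      "face K12 (\<lambda>t. Y v0 t) (\<lambda>t. Z v0 t)"
  obtains X' Y' Z' where "cube_coloring K01 K02 K12 X' Y' Z'"
    "(\<lambda>t. X' t v2) = (\<lambda>t. X t v2)" "(\<lambda>t. Y' t v2) = (\<lambda>t. Y t v2)" "X' v1 = X v1"
    "(\<lambda>t. Z' t v1) = (\<lambda>t. Z t v1)" "Y' v0 = Y v0" "Z' v0 = Z v0"
proof -
  define cc where "cc = cube_coloring K01 K02 K12"
  have uniq: "X1 v1 = X2 v1" "(\<lambda>t. X1 t v2) = (\<lambda>t. X2 t v2)"
     "Y1 v0 = Y2 v0" "(\<lambda>t. Y1 t v2) = (\<lambda>t. Y2 t v2)" "Z1 v0 = Z2 v0" "(\<lambda>t. Z1 t v1) = (\<lambda>t. Z2 t v1)"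
    if "face K01 (\<lambda>t. X1 t v2) (\<lambda>t. Y1 t v2)" "face K02 (\<lambda>t. X1 v1 t) (\<lambda>t. Z1 t v1)"
      "face K12 (\<lambda>t. Y1 v0 t) (\<lambda>t. Z1 v0 t)"
      "face K01 (\<lambda>t. X2 t v2) (\<lambda>t. Y2 t v2)" "face K02 (\<lambda>t. X2 v1 t) (\<lambda>t. Z2 t v1)"
      "face K12 (\<lambda>t. Y2 v0 t) (\<lambda>t. Z2 v0 t)"
      "X1 v1 v2 = X2 v1 v2" "Y1 v0 v2 = Y2 v0 v2" "Z1 v0 v1 = Z2 v0 v1" for X1 X2 Y1 Y2 Z1 Z2 v0 v1 v2
  proof -
    have a: "(\<lambda>t. X1 t v2) = (\<lambda>t. X2 t v2) \<and> (\<lambda>t. Y1 t v2) = (\<lambda>t. Y2 t v2)"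
      using rigidD[of K01 "\<lambda>t. X1 t v2" "\<lambda>t. Y1 t v2" "\<lambda>t. X2 t v2" "\<lambda>t. Y2 t v2" v1 v0] rig(1) that(1,4,7,8)
      by blast
    have b: "X1 v1 = X2 v1 \<and> (\<lambda>t. Z1 t v1) = (\<lambda>t. Z2 t v1)"
      using rigidD[of K02 "X1 v1" "\<lambda>t. Z1 t v1" "X2 v1" "\<lambda>t. Z2 t v1" v2 v0] rig(2) that(2,5,7,9)
      by blast
    have c: "Y1 v0 = Y2 v0 \<and> Z1 v0 = Z2 v0"
      using rigidD[of K12 "Y1 v0" "Z1 v0" "Y2 v0" "Z2 v0" v2 v1] rig(3) that(3,6,8,9)
      by blast
    show "X1 v1 = X2 v1" "(\<lambda>t. X1 t v2) = (\<lambda>t. X2 t v2)"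
     "Y1 v0 = Y2 v0" "(\<lambda>t. Y1 t v2) = (\<lambda>t. Y2 t v2)" "Z1 v0 = Z2 v0" "(\<lambda>t. Z1 t v1) = (\<lambda>t. Z2 t v1)"
      using a b c by blast+
  qed
  have ccface: "face K01 (\<lambda>t. X1 t v2) (\<lambda>t. Y1 t v2)" "face K02 (\<lambda>t. X1 v1 t) (\<lambda>t. Z1 t v1)"
      "face K12 (\<lambda>t. Y1 v0 t) (\<lambda>t. Z1 v0 t)" if "cc X1 Y1 Z1" for X1 Y1 Z1 v0 v1 v2
    using that unfolding cc_def cube_coloring_def by auto
  have step: "X1 u1 u2 = X2 u1 u2 \<and> Y1 u0 u2 = Y2 u0 u2 \<and> Z1 u0 u1 = Z2 u0 u1"
    if c: "cc X1 Y1 Z1" "cc X2 Y2 Z2"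
      and e: "X1 v1 v2 = X2 v1 v2" "Y1 v0 v2 = Y2 v0 v2" "Z1 v0 v1 = Z2 v0 v1"
    for X1 X2 Y1 Y2 Z1 Z2 v0 v1 v2 u0 u1 u2
  proof -
    note f1 = ccface[OF c(1)] and f2 = ccface[OF c(2)]
    \<comment> \<open>walk from the vertex \<open>(v0, v1, v2)\<close> to \<open>(u0, u1, u2)\<close>, changing one side at a time\<close>
    have a: "X1 u1 v2 = X2 u1 v2" "Z1 v0 u1 = Z2 v0 u1"
      using uniq(2)[of X1 v2 Y1 v1 Z1 v0 X2 Y2 Z2] uniq(5)[of X1 v2 Y1 v1 Z1 v0 X2 Y2 Z2] f1 f2 e
      by (metis, metis)
    have b: "Y1 u0 v2 = Y2 u0 v2" "Z1 u0 u1 = Z2 u0 u1"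
      using uniq(4)[of X1 v2 Y1 u1 Z1 v0 X2 Y2 Z2] uniq(6)[of X1 v2 Y1 u1 Z1 v0 X2 Y2 Z2] f1 f2 e(2) a
      by (metis, metis)
    show ?thesis
      using uniq(1)[of X1 v2 Y1 u1 Z1 u0 X2 Y2 Z2] uniq(3)[of X1 v2 Y1 u1 Z1 u0 X2 Y2 Z2] f1 f2 a(1) b
      by metis
  qed
  define R where "R = (\<lambda>c r. cc (fst r) (fst (snd r)) (snd (snd r)) \<and>
     fst r True True = fst c \<and> fst (snd r) True True = fst (snd c) \<and> snd (snd r) True True = snd (snd c))"
  have "\<exists>r. R c r" for c
  proof -
    obtain X Y Z where "cc X Y Z" "X True True = fst c" "Y True True = fst (snd c)" "Z True True = snd (snd c)"
      using comp unfolding compatible_def cc_def by meson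
    then show ?thesis by (intro exI[of _ "(X, Y, Z)"]) (simp add: R_def)
  qed
  then obtain r where "\<And>c. R c (r c)" by metis
  then have r: "\<And>c. cc (fst (r c)) (fst (snd (r c))) (snd (snd (r c)))"
     "\<And>c. fst (r c) True True = fst c \<and> fst (snd (r c)) True True = fst (snd c) \<and> snd (snd (r c)) True True = snd (snd c)"
    by (auto simp: R_def)
  define F where "F = (\<lambda>c. (fst (r c) v1 v2, fst (snd (r c)) v0 v2, snd (snd (r c)) v0 v1))"
  have "inj F"
  proof (rule injI)
    fix c c' assume "F c = F c'"
    then have e: "fst (r c) v1 v2 = fst (r c') v1 v2" "fst (snd (r c)) v0 v2 = fst (snd (r c')) v0 v2"
       "snd (snd (r c)) v0 v1 = snd (snd (r c')) v0 v1"
      by (auto simp: F_def)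
    have "fst c = fst c' \<and> fst (snd c) = fst (snd c') \<and> snd (snd c) = snd (snd c')"
      using step[OF r(1)[of c] r(1)[of c'] e, of True True True] r(2) by metis
    then show "c = c'" by (auto simp: prod_eq_iff)
  qed
  then have "surj F" by (rule finite_UNIV_inj_surj[OF finite])
  from surjD[OF this, of "(X v1 v2, Y v0 v2, Z v0 v1)"]
  obtain c where c: "(X v1 v2, Y v0 v2, Z v0 v1) = F c" by blast
  then have e: "fst (r c) v1 v2 = X v1 v2" "fst (snd (r c)) v0 v2 = Y v0 v2" "snd (snd (r c)) v0 v1 = Z v0 v1"
    unfolding F_def by auto
  note U = uniq[of "fst (r c)" v2 "fst (snd (r c))" v1 "snd (snd (r c))" v0 X Y Z,
    OF ccface(1)[OF r(1)] ccface(2)[OF r(1)] ccface(3)[OF r(1)] faces e]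
  show ?thesis
    using that[OF r(1)[of c, unfolded cc_def]] U by blast
qed

section \<open>Crossings of a weighted psyquandle\<close>

lemma fits_flip [simp]: "fits (flip K) ul lr ur ll \<longleftrightarrow> fits K ll ur lr ul"
  by (auto simp: fits_def)

lemma fits_existence:
  fixes K :: "('x::finite, 'r) kind"
  assumes "rigid K"
  shows "\<exists>lr ll. fits K ul lr ur ll" "\<exists>ul ur. fits K ul lr ur ll" "\<exists>ul ll. fits K ul lr ur ll"
  using face_exists[OF assms, of True ul False ur] face_exists[OF assms, of False lr True ll]
     face_exists[OF assms, of False lr False ur]
  unfolding face_def by metis+

lemma fits_unique:
  assumes "rigid K" "fits K ul lr ur ll" "fits K ul' lr' ur' ll'"
  shows "ul = ul' \<Longrightarrow> ll = ll' \<Longrightarrow> lr = lr' \<and> ur = ur'"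
    and "ul = ul' \<Longrightarrow> ur = ur' \<Longrightarrow> lr = lr' \<and> ll = ll'"
    and "lr = lr' \<Longrightarrow> ll = ll' \<Longrightarrow> ul = ul' \<and> ur = ur'"
    and "lr = lr' \<Longrightarrow> ur = ur' \<Longrightarrow> ul = ul' \<and> ll = ll'"
proof -
  let ?f = "\<lambda>x y t. if t then x else y :: 'a"
  have "face K (?f ul lr) (?f ll ur)" "face K (?f ul' lr') (?f ll' ur')"
    using assms by (auto simp: face_def)
  note r = rigidD[OF assms(1) this]
  show "ul = ul' \<Longrightarrow> ll = ll' \<Longrightarrow> lr = lr' \<and> ur = ur'"
    using r[of True True] by (auto simp: fun_eq_iff all_bool_eq)
  show "ul = ul' \<Longrightarrow> ur = ur' \<Longrightarrow> lr = lr' \<and> ll = ll'"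
    using r[of True False] by (auto simp: fun_eq_iff all_bool_eq)
  show "lr = lr' \<Longrightarrow> ll = ll' \<Longrightarrow> ul = ul' \<and> ur = ur'"
    using r[of False True] by (auto simp: fun_eq_iff all_bool_eq)
  show "lr = lr' \<Longrightarrow> ur = ur' \<Longrightarrow> ul = ul' \<and> ll = ll'"
    using r[of False False] by (auto simp: fun_eq_iff all_bool_eq)
qed

text \<open>
  The ends of a kink whose loop has color \<open>a\<close> are colored \<open>act1 K a a\<close>.  This function of \<open>a\<close> is
  injective, hence onto, so every color \<open>m\<close> of the loop on the other side comes from equal colors; these
  are the only ones.
\<close>

lemma kink_closes:
  fixes K :: "('x::finite, 'r) kind"
  assumes rig: "rigid K" and diag: "\<And>x. act1 K x x = act2 K x x" and "fits K x m m y"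
  shows "x = y"
proof -
  have diag_fits: "fits K a (act1 K a a) (act1 K a a) a" for a
    by (simp add: fits_def diag)
  have "inj (\<lambda>a. act1 K a a)"
  proof (rule injI)
    fix a b assume "act1 K a a = act1 K b b"
    then show "a = b"
      using fits_unique(4)[OF rig diag_fits[of a] diag_fits[of b]] by simp
  qed
  then have "surj (\<lambda>a. act1 K a a)" by (rule finite_UNIV_inj_surj[OF finite])
  from surjD[OF this, of m] obtain a where "m = act1 K a a" by blast
  then have "a = x \<and> a = y"
    by (intro fits_unique(4)[OF rig diag_fits[of a] assms(3)]) simp_all
  then show ?thesis by metis
qed

locale finite_boltzmann_weight = boltzmann_weight ut ot ub ob \<phi> \<psi>
  for ut :: "'x::finite \<Rightarrow> 'x \<Rightarrow> 'x"  (infixl "\<triangleright>\<^sub>u" 70)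
    and ot :: "'x \<Rightarrow> 'x \<Rightarrow> 'x"  (infixl "\<triangleright>\<^sub>o" 70)
    and ub :: "'x \<Rightarrow> 'x \<Rightarrow> 'x"  (infixl "\<bullet>\<^sub>u" 70)
    and ob :: "'x \<Rightarrow> 'x \<Rightarrow> 'x"  (infixl "\<bullet>\<^sub>o" 70)
    and \<phi> \<psi> :: "'x \<Rightarrow> 'x \<Rightarrow> 'r::comm_ring_1"
begin

definition classical :: "('x, 'r) kind" where "classical = Kind (\<triangleright>\<^sub>u) (\<triangleright>\<^sub>o) \<phi>"

definition singular :: "('x, 'r) kind" where "singular = Kind (\<bullet>\<^sub>u) (\<bullet>\<^sub>o) \<psi>"

lemma kind_simps [simp]:
  "act1 classical = (\<triangleright>\<^sub>u)" "act2 classical = (\<triangleright>\<^sub>o)" "wgt classical = \<phi>"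
  "act1 singular = (\<bullet>\<^sub>u)" "act2 singular = (\<bullet>\<^sub>o)" "wgt singular = \<psi>"
  by (auto simp: classical_def singular_def)

lemma rigid_classical: "rigid classical"
  using right_invertible bij_S by (intro rigidI) (auto simp: bij_def)

lemma rigid_singular: "rigid singular"
  using right_invertible bij_S' by (intro rigidI) (auto simp: bij_def)

lemma compatible_classical: "compatible classical classical classical"
proof (rule compatibleI, simp_all add: exchange)
  fix x y z
  show "\<phi> x y - \<phi> (x \<triangleright>\<^sub>u z) (y \<triangleright>\<^sub>u z) + (\<phi> y z - \<phi> (y \<triangleright>\<^sub>o x) (z \<triangleright>\<^sub>o x)) =
       \<phi> x z - \<phi> (x \<triangleright>\<^sub>u y) (z \<triangleright>\<^sub>o y)"
    using weight_exchange(1)[of x y z] by (simp add: algebra_simps)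
qed

lemma compatible_strand_over: "compatible singular classical classical"
proof (rule compatibleI, simp_all add: mixed_exchange)
  fix x y z
  show "\<psi> x y - \<psi> (x \<triangleright>\<^sub>u z) (y \<triangleright>\<^sub>u z) + (\<phi> y z - \<phi> (y \<bullet>\<^sub>o x) (z \<triangleright>\<^sub>o x)) =
       \<phi> x z - \<phi> (x \<bullet>\<^sub>u y) (z \<triangleright>\<^sub>o y)"
    using weight_exchange(2)[of x y z] by (simp add: algebra_simps)
qed

lemma compatible_strand_under: "compatible classical classical singular"
proof (rule compatibleI, simp_all add: mixed_exchange)
  fix x y z
  show "\<phi> x y - \<phi> (x \<triangleright>\<^sub>u z) (y \<bullet>\<^sub>u z) + (\<psi> y z - \<psi> (y \<triangleright>\<^sub>o x) (z \<triangleright>\<^sub>o x)) =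
       \<phi> x z - \<phi> (x \<triangleright>\<^sub>u y) (z \<bullet>\<^sub>o y)"
    using weight_exchange(3)[of y z x] by (simp add: algebra_simps)
qed

lemma ob_inverse: "right_inverse (\<bullet>\<^sub>o) (a \<bullet>\<^sub>o x) x = a"
proof -
  obtain g where g: "is_right_inverse (\<bullet>\<^sub>o) g" using right_invertible by blast
  then show ?thesis by (simp add: right_inverse_unique[OF g]) (simp add: is_right_inverse_def)
qed

lemma twist_rule:
  assumes "y \<triangleright>\<^sub>o x = a \<bullet>\<^sub>o x" "x \<triangleright>\<^sub>u y = b \<bullet>\<^sub>o y"
  shows "x \<bullet>\<^sub>u a = b \<triangleright>\<^sub>o a" "y \<bullet>\<^sub>u b = a \<triangleright>\<^sub>u b" "\<phi> x y + \<psi> y b = \<phi> a b + \<psi> x a"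
  using twist(1)[of x y] twist(2)[of y x] weight_twist[of x y] by (simp_all add: assms ob_inverse)

lemma surj_ops: "\<exists>y. y \<triangleright>\<^sub>u x = z" "\<exists>y. y \<triangleright>\<^sub>o x = z" "\<exists>y. y \<bullet>\<^sub>o x = z"
  using right_invertible unfolding is_right_inverse_def by blast+

lemma inj_ops: "y \<triangleright>\<^sub>u x = y' \<triangleright>\<^sub>u x \<longleftrightarrow> y = y'" "y \<triangleright>\<^sub>o x = y' \<triangleright>\<^sub>o x \<longleftrightarrow> y = y'"
  using right_invertible unfolding is_right_inverse_def by metis+

text \<open>
  Two strands directed downward.  Each crossing is a permutation of the pairs of colors at the top, and
  the twist axiom says that the singular and the positive crossing commute.
\<close>

lemma parallel_twist_positive:
  "(\<exists>l r. fits singular ul r ur l \<and> fits classical l lr r ll \<and> w = \<psi> ul l + \<phi> l ll) \<longleftrightarrow>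
   (\<exists>l r. fits classical ul r ur l \<and> fits singular l lr r ll \<and> w = \<phi> ul l + \<psi> l ll)"
proof
  assume "\<exists>l r. fits singular ul r ur l \<and> fits classical l lr r ll \<and> w = \<psi> ul l + \<phi> l ll"
  then obtain a r where "fits singular ul r ur a" "fits classical a lr r ll" "w = \<psi> ul a + \<phi> a ll"
    by blast
  then have h: "r = ul \<bullet>\<^sub>u a" "ur = a \<bullet>\<^sub>o ul" "lr = a \<triangleright>\<^sub>u ll" "r = ll \<triangleright>\<^sub>o a" "w = \<psi> ul a + \<phi> a ll"
    by (auto simp: fits_def)
  obtain y where y: "y \<triangleright>\<^sub>o ul = ur" using surj_ops by blast
  obtain b where b: "b \<bullet>\<^sub>o y = ul \<triangleright>\<^sub>u y" using surj_ops by blast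
  note t = twist_rule[of y ul a b]
  have "ll = b" using t(1) y b h by (simp add: inj_ops)
  then show "\<exists>l r. fits classical ul r ur l \<and> fits singular l lr r ll \<and> w = \<phi> ul l + \<psi> l ll"
    using t y b h by - (rule exI[of _ y], rule exI[of _ "ul \<triangleright>\<^sub>u y"], auto simp: fits_def)
next
  assume "\<exists>l r. fits classical ul r ur l \<and> fits singular l lr r ll \<and> w = \<phi> ul l + \<psi> l ll"
  then obtain y r where "fits classical ul r ur y" "fits singular y lr r ll" "w = \<phi> ul y + \<psi> y ll"
    by blast
  then have h: "r = ul \<triangleright>\<^sub>u y" "ur = y \<triangleright>\<^sub>o ul" "lr = y \<bullet>\<^sub>u ll" "r = ll \<bullet>\<^sub>o y" "w = \<phi> ul y + \<psi> y ll"
    by (auto simp: fits_def)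
  obtain a where a: "a \<bullet>\<^sub>o ul = ur" using surj_ops by blast
  note t = twist_rule[of y ul a ll]
  show "\<exists>l r. fits singular ul r ur l \<and> fits classical l lr r ll \<and> w = \<psi> ul l + \<phi> l ll"
    using t a h by - (rule exI[of _ a], rule exI[of _ "ul \<bullet>\<^sub>u a"], auto simp: fits_def)
qed

text \<open>
  The negative crossing is the inverse permutation of the positive one, so it commutes with the singular
  crossing as well.
\<close>

lemma parallel_twist_negative:
  "(\<exists>l r. fits singular ul r ur l \<and> fits (flip classical) l lr r ll \<and> w = \<psi> ul l + - \<phi> ll l) \<longleftrightarrow>
   (\<exists>l r. fits (flip classical) ul r ur l \<and> fits singular l lr r ll \<and> w = - \<phi> l ul + \<psi> l ll)"
proof
  assume "\<exists>l r. fits singular ul r ur l \<and> fits (flip classical) l lr r ll \<and> w = \<psi> ul l + - \<phi> ll l"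
  then obtain l r where h: "fits singular ul r ur l" "fits classical ll r lr l" "w = \<psi> ul l + - \<phi> ll l"
    by auto
  obtain l' r' where n: "fits classical l' ur r' ul"
    using fits_existence(2)[OF rigid_classical] by blast
  have "\<exists>l'' r''. fits singular l' r'' r' l'' \<and> fits classical l'' r r'' l \<and>
      \<phi> l' ul + \<psi> ul l = \<psi> l' l'' + \<phi> l'' l"
    using parallel_twist_positive[of l' r' r l] n h(1) by blast
  then obtain l'' r'' where k: "fits singular l' r'' r' l''" "fits classical l'' r r'' l"
      "\<phi> l' ul + \<psi> ul l = \<psi> l' l'' + \<phi> l'' l" by blast
  have "ll = l'' \<and> lr = r''"
    using fits_unique(3)[OF rigid_classical h(2) k(2)] by simp
  then show "\<exists>l r. fits (flip classical) ul r ur l \<and> fits singular l lr r ll \<and> w = - \<phi> l ul + \<psi> l ll"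
  proof -
    have "\<psi> ul l = \<psi> l' l'' + \<phi> l'' l - \<phi> l' ul" using k(3) by (simp add: algebra_simps)
    then have "w = - \<phi> l' ul + \<psi> l' l''" using h(3) \<open>ll = l'' \<and> lr = r''\<close> by simp
    then show ?thesis
      using n k \<open>ll = l'' \<and> lr = r''\<close> by - (rule exI[of _ l'], rule exI[of _ r'], simp)
  qed
next
  assume "\<exists>l r. fits (flip classical) ul r ur l \<and> fits singular l lr r ll \<and> w = - \<phi> l ul + \<psi> l ll"
  then obtain l r where h: "fits classical l ur r ul" "fits singular l lr r ll" "w = - \<phi> l ul + \<psi> l ll"
    by auto
  obtain l' r' where n: "fits classical ll r' lr l'"
    using fits_existence(1)[OF rigid_classical] by blast
  have "\<exists>l'' r''. fits classical l r'' r l'' \<and> fits singular l'' r' r'' l' \<and>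
      \<psi> l ll + \<phi> ll l' = \<phi> l l'' + \<psi> l'' l'"
    using parallel_twist_positive[of l r r' l'] n h(2) by blast
  then obtain l'' r'' where k: "fits classical l r'' r l''" "fits singular l'' r' r'' l'"
      "\<psi> l ll + \<phi> ll l' = \<phi> l l'' + \<psi> l'' l'" by blast
  have "ur = r'' \<and> ul = l''"
    using fits_unique(2)[OF rigid_classical h(1) k(1)] by simp
  then show "\<exists>l r. fits singular ul r ur l \<and> fits (flip classical) l lr r ll \<and> w = \<psi> ul l + - \<phi> ll l"
  proof -
    have "\<psi> l ll = \<phi> l l'' + \<psi> l'' l' - \<phi> ll l'" using k(3) by (simp add: algebra_simps)
    then have "w = \<psi> l'' l' + - \<phi> ll l'" using h(3) \<open>ur = r'' \<and> ul = l''\<close> by simp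
    then show ?thesis
      using n k \<open>ur = r'' \<and> ul = l''\<close> by - (rule exI[of _ l'], rule exI[of _ r'], simp)
  qed
qed

text \<open>
  The bigon lies to the right of both crossings, and the strand that leaves the singular crossing with
  color \<open>v\<close> passes over the classical crossing.  Moving this strand over the singular crossing (the cube
  on \<open>a'\<close>, \<open>b'\<close>, \<open>f\<close>) makes it leave through a kink with loop color \<open>e\<close> and cross the lower left strand
  instead; there the strands are parallel and the twist axiom moves the crossing above the singular one.
  Then the strand that enters with color \<open>a\<close> lies under everything and is moved under the singular crossing
  (the cube on \<open>a'\<close>, \<open>y\<close>, \<open>f\<close>), through a kink with loop color \<open>q\<close>.
\<close>

lemma antiparallel_twist_positive:
  assumes "fits singular a v u b" "fits classical c u v d"
  shows "\<exists>p q. fits classical a q p b \<and> fits singular c p q d \<and> \<psi> a b + \<phi> c d = \<phi> a b + \<psi> c d"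
proof -
  have h: "u = b \<bullet>\<^sub>o a" "v = a \<bullet>\<^sub>u b" "u = c \<triangleright>\<^sub>u d" "v = d \<triangleright>\<^sub>o c"
    using assms by (auto simp: fits_def)
  \<comment> \<open>the color of a loop whose ends have color \<open>v\<close>\<close>
  obtain e where e: "v = e \<triangleright>\<^sub>u e"
  proof -
    obtain e e' where f: "fits classical e v v e'" using fits_existence(3)[OF rigid_classical] by blast
    have "e = e'" by (rule kink_closes[OF rigid_classical _ f]) (simp add: diagonal)
    then show ?thesis using f that by (auto simp: fits_def)
  qed
  obtain b' f where bf: "e = f \<triangleright>\<^sub>o b'" "b = b' \<triangleright>\<^sub>u f"
    using fits_existence(3)[OF rigid_classical, of b e] by (auto simp: fits_def)
  obtain a' where a': "a = a' \<triangleright>\<^sub>u f" using surj_ops by metis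
  have "(a' \<bullet>\<^sub>u b') \<triangleright>\<^sub>u e = e \<triangleright>\<^sub>u e"
    using mixed_exchange(4)[of a' f b'] a' bf h e by simp
  then have e': "a' \<bullet>\<^sub>u b' = e" by (simp add: inj_ops)
  define c' where "c' = b' \<bullet>\<^sub>o a'"
  define d' where "d' = f \<triangleright>\<^sub>o a'"
  have u: "u = c' \<triangleright>\<^sub>u d'"
    using mixed_exchange(6)[of b' f a'] a' bf h by (simp add: c'_def d'_def)
  have v: "v = d' \<triangleright>\<^sub>o c'"
    using mixed_exchange(1)[of f a' b'] a' bf h e e' by (simp add: c'_def d'_def diagonal)
  have cd: "c = c'" "d = d'"
    using fits_unique(4)[OF rigid_classical assms(2), of c' u v d'] u v by (auto simp: fits_def)
  \<comment> \<open>the colors of the picture in which the classical crossing is above the singular one\<close>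
  obtain y where y: "y \<triangleright>\<^sub>o a' = c" using surj_ops by blast
  obtain f' where f': "f' \<bullet>\<^sub>o y = a' \<triangleright>\<^sub>u y" using surj_ops by blast
  have t: "a' \<bullet>\<^sub>u b' = f' \<triangleright>\<^sub>o b'" "y \<bullet>\<^sub>u f' = b' \<triangleright>\<^sub>u f'" "\<phi> a' y + \<psi> y f' = \<phi> b' f' + \<psi> a' b'"
    using twist_rule[of y a' b' f'] y f' cd by (auto simp: c'_def)
  have "f' = f" using t(1) e' bf by (simp add: inj_ops)
  note t = t[unfolded this] and f' = f'[unfolded this]
  define q where "q = a' \<triangleright>\<^sub>u y"
  have "q \<triangleright>\<^sub>u q = a \<triangleright>\<^sub>u b"
    using mixed_exchange(2)[of a' y f] a' f' t bf by (simp add: q_def)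
  moreover have "q \<triangleright>\<^sub>u q = d \<bullet>\<^sub>o c"
    using mixed_exchange(3)[of f a' y] f' cd y by (simp add: q_def d'_def diagonal)
  moreover have "b \<triangleright>\<^sub>o a = c \<bullet>\<^sub>u d"
    using mixed_exchange(5)[of y a' f] a' t bf y cd by (simp add: d'_def)
  moreover have "\<psi> a b + \<phi> c d = \<phi> a b + \<psi> c d"
    using weight_exchange(2)[of a' b' f] weight_exchange(3)[of y f a'] t(3) weight_diagonal[of e] weight_diagonal[of q]
      a' bf e' f' y cd t(2)
    by (simp add: c'_def d'_def q_def algebra_simps)
  ultimately show ?thesis by (auto simp: fits_def)
qed

text \<open>
  Exchanging over and under permutes the exchange axioms.  The twist axiom of the mirror image is the
  commutation of the singular with the negative crossing.
\<close>

lemma mirror: "finite_boltzmann_weight (\<triangleright>\<^sub>o) (\<triangleright>\<^sub>u) (\<bullet>\<^sub>u) (\<bullet>\<^sub>o) (\<lambda>x y. - \<phi> y x) \<psi>"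
proof -
  \<comment> \<open>the map \<open>S\<close> of the mirror image is conjugate to \<open>S\<close> by the exchange of coordinates\<close>
  have sw: "bij (\<lambda>(x, y). (y \<triangleright>\<^sub>u x, x \<triangleright>\<^sub>o y))"
  proof -
    have "(\<lambda>(x, y). (y \<triangleright>\<^sub>u x, x \<triangleright>\<^sub>o y)) = prod.swap \<circ> (\<lambda>(x, y). (y \<triangleright>\<^sub>o x, x \<triangleright>\<^sub>u y)) \<circ> prod.swap"
      by auto
    then show ?thesis using bij_S by (simp only:) (intro bij_comp bij_swap)
  qed
  have tw: "x \<bullet>\<^sub>u a = b \<triangleright>\<^sub>u a \<and> y \<bullet>\<^sub>u b = a \<triangleright>\<^sub>o b \<and> - \<phi> y x + \<psi> y b = - \<phi> b a + \<psi> x a"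
    if "y \<triangleright>\<^sub>u x = a \<bullet>\<^sub>o x" "x \<triangleright>\<^sub>o y = b \<bullet>\<^sub>o y" for x y a b
  proof -
    have "fits (flip classical) x (x \<triangleright>\<^sub>o y) (y \<triangleright>\<^sub>u x) y" "fits singular y (y \<bullet>\<^sub>u b) (x \<triangleright>\<^sub>o y) b"
      using that by (auto simp: fits_def)
    then have "\<exists>l r. fits singular x r (y \<triangleright>\<^sub>u x) l \<and> fits (flip classical) l (y \<bullet>\<^sub>u b) r b \<and>
       - \<phi> y x + \<psi> y b = \<psi> x l + - \<phi> b l"
      using parallel_twist_negative[of x "y \<triangleright>\<^sub>u x" "y \<bullet>\<^sub>u b" b "- \<phi> y x + \<psi> y b"] by blast
    then obtain l r where k: "fits singular x r (y \<triangleright>\<^sub>u x) l" "fits (flip classical) l (y \<bullet>\<^sub>u b) r b"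
       "- \<phi> y x + \<psi> y b = \<psi> x l + - \<phi> b l" by blast
    have "l = a"
      using fits_unique(2)[OF rigid_singular k(1), of x "x \<bullet>\<^sub>u a" "y \<triangleright>\<^sub>u x" a] that by (auto simp: fits_def)
    then show ?thesis using k by (auto simp: fits_def)
  qed
  have ex: "\<exists>a. z = a \<bullet>\<^sub>o x" for z x using surj_ops(3) by metis
  have tw': "x \<bullet>\<^sub>u right_inverse (\<bullet>\<^sub>o) (y \<triangleright>\<^sub>u x) x =
         right_inverse (\<bullet>\<^sub>o) (x \<triangleright>\<^sub>o y) y \<triangleright>\<^sub>u right_inverse (\<bullet>\<^sub>o) (y \<triangleright>\<^sub>u x) x \<and>
      y \<bullet>\<^sub>u right_inverse (\<bullet>\<^sub>o) (x \<triangleright>\<^sub>o y) y =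
         right_inverse (\<bullet>\<^sub>o) (y \<triangleright>\<^sub>u x) x \<triangleright>\<^sub>o right_inverse (\<bullet>\<^sub>o) (x \<triangleright>\<^sub>o y) y \<and>
      - \<phi> y x + \<psi> y (right_inverse (\<bullet>\<^sub>o) (x \<triangleright>\<^sub>o y) y) =
         - \<phi> (right_inverse (\<bullet>\<^sub>o) (x \<triangleright>\<^sub>o y) y) (right_inverse (\<bullet>\<^sub>o) (y \<triangleright>\<^sub>u x) x)
         + \<psi> x (right_inverse (\<bullet>\<^sub>o) (y \<triangleright>\<^sub>u x) x)" for x y
  proof -
    obtain a b where "y \<triangleright>\<^sub>u x = a \<bullet>\<^sub>o x" "x \<triangleright>\<^sub>o y = b \<bullet>\<^sub>o y" using ex by meson
    then show ?thesis using tw[of y x a b] by (simp add: ob_inverse)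
  qed
  show ?thesis
  proof unfold_locales
    fix x y z
    show "- \<phi> y x + - \<phi> z y + - \<phi> (z \<triangleright>\<^sub>u y) (x \<triangleright>\<^sub>o y) =
          - \<phi> (y \<triangleright>\<^sub>o z) (x \<triangleright>\<^sub>o z) + - \<phi> z x + - \<phi> (z \<triangleright>\<^sub>u x) (y \<triangleright>\<^sub>u x)"
      using weight_exchange(1)[of z y x] by (simp add: algebra_simps)
    show "\<psi> x y + - \<phi> z y + - \<phi> (z \<triangleright>\<^sub>u y) (x \<bullet>\<^sub>u y) =
          \<psi> (x \<triangleright>\<^sub>o z) (y \<triangleright>\<^sub>o z) + - \<phi> z x + - \<phi> (z \<triangleright>\<^sub>u x) (y \<bullet>\<^sub>o x)"
      using weight_exchange(3)[of x y z] by (simp add: algebra_simps)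
    show "\<psi> z y - - \<phi> y x - - \<phi> (z \<bullet>\<^sub>u y) (x \<triangleright>\<^sub>o y) =
          \<psi> (z \<triangleright>\<^sub>u x) (y \<triangleright>\<^sub>u x) - - \<phi> z x - - \<phi> (y \<bullet>\<^sub>o z) (x \<triangleright>\<^sub>o z)"
      using weight_exchange(2)[of z y x] by (simp add: algebra_simps)
  qed (use right_invertible diagonal exchange mixed_exchange tw' sw bij_S' weight_diagonal in \<open>simp_all\<close>)
qed

lemma antiparallel_twist_negative:
  assumes "fits singular a v u b" "fits (flip classical) c u v d"
  shows "\<exists>p q. fits (flip classical) a q p b \<and> fits singular c p q d \<and> \<psi> a b - \<phi> d c = - \<phi> b a + \<psi> c d"
proof -
  interpret m: finite_boltzmann_weight "(\<triangleright>\<^sub>o)" "(\<triangleright>\<^sub>u)" "(\<bullet>\<^sub>u)" "(\<bullet>\<^sub>o)" "\<lambda>x y. - \<phi> y x" \<psi>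
    by (rule mirror)
  have "m.classical = flip classical" "m.singular = singular"
    by (simp_all add: m.classical_def m.singular_def flip_def singular_def)
  then show ?thesis using m.antiparallel_twist_positive[of a v u b c d] assms by simp
qed

definition is_classical where "is_classical K \<longleftrightarrow> K = classical \<or> K = flip classical"

lemma rigid_is_classical: "is_classical K \<Longrightarrow> rigid K"
  using rigid_classical rigid_flip is_classical_def by auto

lemma parallel_twist:
  assumes "is_classical K"
  shows "(\<exists>l r. fits singular ul r ur l \<and> fits K l lr r ll \<and> w = \<psi> ul l + wgt K l ll) \<longleftrightarrow>
   (\<exists>l r. fits K ul r ur l \<and> fits singular l lr r ll \<and> w = wgt K ul l + \<psi> l ll)"
proof (cases "K = classical")
  case True
  show ?thesis unfolding True kind_simps by (rule parallel_twist_positive)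
next
  case False
  then have K: "K = flip classical" using assms by (simp add: is_classical_def)
  show ?thesis unfolding K kind_simps flip_simps by (rule parallel_twist_negative)
qed

lemma antiparallel_twist_right:
  assumes "is_classical K" "fits singular a v u b" "fits K c u v d"
  shows "\<exists>p q. fits K a q p b \<and> fits singular c p q d \<and> \<psi> a b + wgt K c d = wgt K a b + \<psi> c d"
proof (cases "K = classical")
  case True
  show ?thesis using antiparallel_twist_positive[OF assms(2)] assms(3) unfolding True kind_simps by blast
next
  case False
  then have K: "K = flip classical" using assms(1) by (simp add: is_classical_def)
  show ?thesis using antiparallel_twist_negative[OF assms(2)] assms(3) unfolding K kind_simps flip_simps
    by simp
qed

text \<open>
  If the bigon lies to the left of both crossings, the inner colors of one side of the move and the inner
  colors of the other side form a configuration in which the bigon lies to the right, with the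
  classical crossing flipped.
\<close>

lemma antiparallel_twist_left:
  assumes "is_classical K"
  shows "(\<exists>a b. fits singular a v u b \<and> fits K b r l a \<and> w = \<psi> a b + wgt K b a) \<longleftrightarrow>
         (\<exists>a b. fits K a v u b \<and> fits singular b r l a \<and> w = wgt K a b + \<psi> b a)"
proof
  have K: "is_classical (flip K)" using assms by (auto simp: is_classical_def)
  note rig = rigid_is_classical[OF assms]
  {
    assume "\<exists>a b. fits singular a v u b \<and> fits K b r l a \<and> w = \<psi> a b + wgt K b a"
    then obtain a b where h: "fits singular a v u b" "fits K b r l a" "w = \<psi> a b + wgt K b a" by blast
    obtain a' b' where n: "fits K a' v u b'" using fits_existence(3)[OF rig] by blast
    obtain p q where k: "fits (flip K) a q p b" "fits singular b' p q a'" "\<psi> a b - wgt K a' b' = - wgt K b a + \<psi> b' a'"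
      using antiparallel_twist_right[OF K h(1), of b' a'] n by auto
    then have "p = r \<and> q = l" using fits_unique(1)[OF rig h(2), of b p q a] by auto
    then show "\<exists>a b. fits K a v u b \<and> fits singular b r l a \<and> w = wgt K a b + \<psi> b a"
      using k n h(3) by - (rule exI[of _ a'], rule exI[of _ b'], auto simp: algebra_simps)
  }
  {
    assume "\<exists>a b. fits K a v u b \<and> fits singular b r l a \<and> w = wgt K a b + \<psi> b a"
    then obtain a b where h: "fits K a v u b" "fits singular b r l a" "w = wgt K a b + \<psi> b a" by blast
    obtain a' b' where n: "fits K b' r l a'" using fits_existence(3)[OF rig] by blast
    obtain p q where k: "fits (flip K) b q p a" "fits singular a' p q b'" "\<psi> b a - wgt K b' a' = - wgt K a b + \<psi> a' b'"
      using antiparallel_twist_right[OF K h(2), of a' b'] n by auto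
    then have "p = v \<and> q = u" using fits_unique(1)[OF rig h(1), of a p q b] by auto
    then show "\<exists>a b. fits singular a v u b \<and> fits K b r l a \<and> w = \<psi> a b + wgt K b a"
      using k n h(3) by - (rule exI[of _ a'], rule exI[of _ b'], auto simp: algebra_simps)
  }
qed

end

section \<open>Colorings as one-sided continuous functions\<close>

text \<open>
  The parameter that is reached from \<open>q\<close> by the angle \<open>s\<close> in the direction of the orientation.
\<close>

definition rot :: "nat \<times> complex \<Rightarrow> real \<Rightarrow> nat \<times> complex" where
  "rot q s = (fst q, snd q * cis s)"

lemma rot_0 [simp]: "rot q 0 = q"
  by (simp add: rot_def)

lemma rot_rot [simp]: "rot (rot q s) t = rot q (s + t)"
  by (simp add: rot_def cis_mult mult.assoc)

lemma rot_in_params [simp]: "rot q s \<in> params L \<longleftrightarrow> q \<in> params L"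
  by (cases q) (auto simp: rot_def params_def norm_mult)

lemma cis_eq_imp_eq:
  assumes "cis s = cis t" "\<bar>s - t\<bar> < 2 * pi"
  shows "s = t"
proof -
  have "cis (s - t) = 1" using assms(1) by (simp add: cis_divide [symmetric])
  then have "cos (s - t) = 1" by (simp add: complex_eq_iff)
  then obtain n :: int where n: "s - t = of_int n * 2 * pi" by (auto simp: cos_one_2pi_int)
  then have "\<bar>of_int n :: real\<bar> < 1" using assms(2) by (simp add: abs_mult)
  then have "n = 0" by linarith
  then show ?thesis using n by simp
qed

lemma rot_eq_iff:
  assumes "q \<in> params L" "\<bar>s - t\<bar> < 2 * pi"
  shows "rot q s = rot q t \<longleftrightarrow> s = t"
  using assms by (auto simp: rot_def params_def dest: cis_eq_imp_eq)

lemma continuous_on_rot: "continuous_on S (rot q)"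
  unfolding rot_def by (intro continuous_intros)

lemma isCont_rot: "isCont (rot q) s"
  using continuous_on_rot[of UNIV q] by (simp add: continuous_on_eq_continuous_at)

text \<open>
  The angle is a local coordinate on the circle, and the number of the component is locally constant.
\<close>

lemma eventually_at_rot:
  assumes q: "q \<in> params L" and P: "\<forall>\<^sub>F s in at 0. P (rot q s)"
  shows "\<forall>\<^sub>F p in at q within params L. P p"
proof -
  obtain i z where qi: "q = (i, z)" "norm z = 1" using q by (auto simp: params_def)
  define F where "F = at q within params L"
  have id: "filterlim (\<lambda>p. p) (nhds q) F" by (simp add: F_def filterlim_def at_within_def)
  have "filterlim fst (nhds i) F" "filterlim snd (nhds z) F"
    using tendsto_fst[OF id] tendsto_snd[OF id] qi by simp_all
  then have 1: "\<forall>\<^sub>F p in F. fst p = i" by (simp add: tendsto_discrete)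
  have z0: "z \<noteq> 0" using qi by auto
  have "filterlim (\<lambda>p. snd p / z) (nhds (z / z)) F"
    using z0 by (intro tendsto_divide \<open>filterlim snd (nhds z) F\<close>) auto
  then have "filterlim (\<lambda>p. Arg (snd p / z)) (nhds (Arg 1)) F"
    using z0 by (intro isCont_tendsto_compose[OF continuous_at_Arg]) auto
  then have 2: "filterlim (\<lambda>p. Arg (snd p / z)) (nhds 0) F" by (simp add: Arg_of_real)
  have mem: "\<forall>\<^sub>F p in F. p \<in> params L \<and> p \<noteq> q" by (auto simp: F_def eventually_at_filter)
  have eq: "p = rot q (Arg (snd p / z))" if "fst p = i" "p \<in> params L" for p
  proof -
    have "norm (snd p) = 1" using that by (auto simp: params_def)
    then have "cis (Arg (snd p / z)) = snd p / z"
      using qi by (subst cis_Arg) (auto simp: sgn_eq norm_divide)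
    then show ?thesis using that qi by (auto simp: rot_def prod_eq_iff)
  qed
  have "\<forall>\<^sub>F p in F. Arg (snd p / z) \<noteq> 0"
    using 1 mem
  proof eventually_elim
    case (elim p)
    then show ?case using eq[of p] by (metis rot_0)
  qed
  then have "filterlim (\<lambda>p. Arg (snd p / z)) (at 0) F" using 2 by (simp add: filterlim_at)
  then have "\<forall>\<^sub>F p in F. P (rot q (Arg (snd p / z)))"
    using P unfolding filterlim_iff by blast
  then show ?thesis
    using 1 mem unfolding F_def[symmetric]
  proof eventually_elim
    case (elim p)
    then show ?case using eq[of p] by metis
  qed
qed

lemma eventually_at_not_in_finite:
  fixes a :: "'a::t1_space"
  assumes "finite F"
  shows "\<forall>\<^sub>F x in at a. x \<notin> F"
proof -
  have "open (- (F - {a}))" using assms by (intro open_Compl finite_imp_closed) auto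
  then have "\<forall>\<^sub>F x in nhds a. x \<in> - (F - {a})" by (rule eventually_nhds_in_open) simp
  then show ?thesis unfolding eventually_at_filter by eventually_elim auto
qed

lemma eventually_not_passage:
  assumes "link_diagram L" "q \<in> params L"
  shows "\<forall>\<^sub>F s in at 0. rot q s \<notin> passages L"
proof -
  have fin: "finite (passages L)" using assms by (simp add: link_diagram_def passages_def)
  have "finite (rot q -` passages L \<inter> {-1<..<1})"
    using fin
  proof (rule finite_vimage_IntI)
    show "inj_on (rot q) {-1<..<1}"
      using rot_eq_iff[OF assms(2)] pi_gt3 by (intro inj_onI) (auto)
  qed
  then have "\<forall>\<^sub>F s in at 0. s \<notin> rot q -` passages L \<inter> {-1<..<1}" by (rule eventually_at_not_in_finite)
  moreover have "\<forall>\<^sub>F s in at (0::real). s \<in> {-1<..<1}"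
    by (rule eventually_at_in_open') auto
  ultimately show ?thesis by eventually_elim auto
qed

lemma passages_subset: "passages L \<subseteq> params L"
  by (auto simp: passages_def crossings_def)

lemma component_unique:
  assumes "S \<in> components A" "S' \<in> components A" "x \<in> S" "x \<in> S'"
  shows "S = S'"
  using assms components_nonoverlap by blast

text \<open>
  There are finitely many passages, so a short open interval on one side of \<open>q\<close> avoids them; being
  connected, it lies in a single semiarc.
\<close>

lemma semiarc_near:
  assumes "link_diagram L" "q \<in> params L" and F: "F = at_left 0 \<or> F = at_right 0"
  shows "\<exists>!S. S \<in> semiarcs L \<and> (\<forall>\<^sub>F s in F. rot q s \<in> S)"
proof -
  let ?D = "params L - passages L"
  have "\<forall>\<^sub>F s in at 0. rot q s \<in> ?D"
    using eventually_not_passage[OF assms(1,2)] by eventually_elim (simp add: assms)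
  then obtain d where d: "d > 0" "\<And>s. s \<noteq> 0 \<Longrightarrow> dist s 0 < d \<Longrightarrow> rot q s \<in> ?D"
    unfolding eventually_at by auto
  obtain I where I: "connected I" "I \<noteq> {}" "I \<subseteq> {-d<..<d} - {0}" "\<forall>\<^sub>F s in F. s \<in> I"
  proof (cases "F = at_left 0")
    case True
    have "\<forall>\<^sub>F s in at_left 0. s \<in> {-d<..<0}"
      using d by (intro eventually_at_leftI[of "-d"]) auto
    then show ?thesis using True d by (intro that[of "{-d<..<0}"]) auto
  next
    case False
    have "\<forall>\<^sub>F s in at_right 0. s \<in> {0<..<d}"
      using d by (intro eventually_at_rightI[of _ d]) auto
    then show ?thesis using False F d by (intro that[of "{0<..<d}"]) auto
  qed
  have "connected (rot q ` I)" by (intro connected_continuous_image continuous_on_rot I)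
  moreover have "rot q ` I \<subseteq> ?D"
  proof
    fix p assume "p \<in> rot q ` I"
    then obtain s where s: "s \<in> I" "p = rot q s" by blast
    then have "s \<noteq> 0" "dist s 0 < d" using subsetD[OF I(3), of s] by (auto simp: dist_real_def)
    then show "p \<in> ?D" using d(2) s(2) by blast
  qed
  moreover have ne: "?D \<noteq> {}" using \<open>rot q ` I \<subseteq> ?D\<close> I(2) by auto
  ultimately obtain S where S: "S \<in> components ?D" "rot q ` I \<subseteq> S"
    using exists_component_superset by blast
  have nb: "F \<noteq> bot" using F trivial_limit_at_left_real trivial_limit_at_right_real by metis
  have near: "\<forall>\<^sub>F s in F. rot q s \<in> S"
    using I(4) by eventually_elim (use S(2) in blast)
  show ?thesis
  proof (rule ex1I[of _ S])
    show "S \<in> semiarcs L \<and> (\<forall>\<^sub>F s in F. rot q s \<in> S)"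
      using S near by (simp add: semiarcs_def)
    fix S' assume S': "S' \<in> semiarcs L \<and> (\<forall>\<^sub>F s in F. rot q s \<in> S')"
    have "\<forall>\<^sub>F s in F. rot q s \<in> S \<and> rot q s \<in> S'"
      using near S' eventually_conj by blast
    then obtain s where "rot q s \<in> S \<and> rot q s \<in> S'"
      using eventually_happens'[OF nb] by blast
    then show "S' = S" using component_unique S S' unfolding semiarcs_def by metis
  qed
qed

lemma in_arc:
  assumes "link_diagram L" "q \<in> params L"
  shows "in_arc L q \<in> semiarcs L" "\<forall>\<^sub>F s in at_left 0. rot q s \<in> in_arc L q"
proof -
  have "in_arc L q = (THE S. S \<in> semiarcs L \<and> (\<forall>\<^sub>F s in at_left 0. rot q s \<in> S))"
    by (cases q) (simp add: in_arc_def rot_def)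
  then show "in_arc L q \<in> semiarcs L" "\<forall>\<^sub>F s in at_left 0. rot q s \<in> in_arc L q"
    using theI'[OF semiarc_near[OF assms, of "at_left 0"]] by simp_all
qed

lemma out_arc:
  assumes "link_diagram L" "q \<in> params L"
  shows "out_arc L q \<in> semiarcs L" "\<forall>\<^sub>F s in at_right 0. rot q s \<in> out_arc L q"
proof -
  have "out_arc L q = (THE S. S \<in> semiarcs L \<and> (\<forall>\<^sub>F s in at_right 0. rot q s \<in> S))"
    by (cases q) (simp add: out_arc_def rot_def)
  then show "out_arc L q \<in> semiarcs L" "\<forall>\<^sub>F s in at_right 0. rot q s \<in> out_arc L q"
    using theI'[OF semiarc_near[OF assms, of "at_right 0"]] by simp_all
qed

lemma arcs_of_interior_point:
  assumes L: "link_diagram L" and S: "S \<in> semiarcs L" "q \<in> S"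
  shows "in_arc L q = S" "out_arc L q = S" "\<forall>\<^sub>F s in at 0. rot q s \<in> S"
proof -
  let ?D = "params L - passages L"
  have qD: "q \<in> ?D" using S in_components_subset unfolding semiarcs_def by blast
  have "\<forall>\<^sub>F s in at 0. rot q s \<in> ?D"
    using eventually_not_passage[OF L] qD by (auto elim: eventually_mono)
  then obtain d where d: "d > 0" "\<And>s. s \<noteq> 0 \<Longrightarrow> dist s 0 < d \<Longrightarrow> rot q s \<in> ?D"
    unfolding eventually_at by auto
  have sub: "rot q ` {-d<..<d} \<subseteq> ?D"
  proof
    fix p assume "p \<in> rot q ` {-d<..<d}"
    then obtain s where s: "p = rot q s" "dist s 0 < d" by (auto simp: dist_real_def)
    show "p \<in> ?D" using d(2)[of s] s qD by (cases "s = 0") auto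
  qed
  have "rot q ` {-d<..<d} \<subseteq> S"
  proof (rule components_maximal[OF S(1)[unfolded semiarcs_def] _ sub])
    show "connected (rot q ` {-d<..<d})"
      by (intro connected_continuous_image continuous_on_rot) auto
    have "q = rot q 0" "0 \<in> {-d<..<d}" using d by auto
    then have "q \<in> rot q ` {-d<..<d}" by (rule image_eqI)
    then show "S \<inter> rot q ` {-d<..<d} \<noteq> {}" using S(2) by auto
  qed
  moreover have "\<forall>\<^sub>F s in at 0. s \<in> {-d<..<d}" using d by (intro eventually_at_in_open') auto
  ultimately show ev: "\<forall>\<^sub>F s in at 0. rot q s \<in> S" by (blast intro: eventually_mono)
  have qp: "q \<in> params L" using qD by simp
  note evs = ev[unfolded eventually_at_split]
  show "in_arc L q = S" "out_arc L q = S"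
    using semiarc_near[OF L qp, of "at_left 0"] in_arc[OF L qp] evs S(1)
      semiarc_near[OF L qp, of "at_right 0"] out_arc[OF L qp] by blast+
qed

definition exit_value :: "(nat \<times> complex \<Rightarrow> 'x) \<Rightarrow> nat \<times> complex \<Rightarrow> 'x" where
  "exit_value g q = (THE v. \<forall>\<^sub>F s in at_right 0. g (rot q s) = v)"

lemma exit_value_eq:
  assumes "\<forall>\<^sub>F s in at_right 0. g (rot q s) = v"
  shows "exit_value g q = v"
  unfolding exit_value_def
proof (rule the_equality[of "\<lambda>v. \<forall>\<^sub>F s in at_right 0. g (rot q s) = v", OF assms])
  fix v' assume "\<forall>\<^sub>F s in at_right 0. g (rot q s) = v'"
  with assms have "\<forall>\<^sub>F s in at_right (0::real). v' = v" by eventually_elim simp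
  then show "v' = v" by simp
qed

text \<open>
  The value at a parameter is the color with which the strand arrives there, so a passage has the color of
  the incoming semiarc.  All parameters carry a value, which makes functions on the parameters of different
  diagrams comparable, whereas their semiarcs are not.
\<close>

definition flow :: "diagram \<Rightarrow> (nat \<times> complex \<Rightarrow> 'x) \<Rightarrow> bool" where
  "flow L g \<longleftrightarrow> g \<in> extensional (params L) \<and>
     (\<forall>q \<in> params L. (\<forall>\<^sub>F s in at_left 0. g (rot q s) = g q) \<and>
        (\<exists>v. \<forall>\<^sub>F s in at_right 0. g (rot q s) = v) \<and>
        (q \<notin> passages L \<longrightarrow> (\<forall>\<^sub>F s in at_right 0. g (rot q s) = g q)))"

lemma flow_out:
  assumes "flow L g" "q \<in> params L"
  shows "\<forall>\<^sub>F s in at_right 0. g (rot q s) = exit_value g q"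
  using assms unfolding flow_def by (metis exit_value_eq)

context finite_boltzmann_weight
begin

abbreviation polynomial :: "diagram \<Rightarrow> ('r \<Rightarrow>\<^sub>0 int)" where
  "polynomial \<equiv> Phi (\<triangleright>\<^sub>u) (\<triangleright>\<^sub>o) (\<bullet>\<^sub>u) (\<bullet>\<^sub>o) \<phi> \<psi>"

definition kind_at :: "diagram \<Rightarrow> (nat \<times> complex) \<times> (nat \<times> complex) \<Rightarrow> ('x, 'r) kind" where
  "kind_at L = (\<lambda>(a, b). if pt L a \<in> special L then singular
      else if b \<in> over L then classical else flip classical)"

definition flow_coloring :: "diagram \<Rightarrow> (nat \<times> complex \<Rightarrow> 'x) \<Rightarrow> bool" where
  "flow_coloring L g \<longleftrightarrow> flow L g \<and>
     (\<forall>(a, b) \<in> crossings L. fits (kind_at L (a, b)) (g a) (exit_value g a) (g b) (exit_value g b))"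

definition flow_weight :: "diagram \<Rightarrow> (nat \<times> complex \<Rightarrow> 'x) \<Rightarrow> 'r" where
  "flow_weight L g = (\<Sum>(a, b) \<in> crossings L. wgt (kind_at L (a, b)) (g a) (exit_value g b))"

lemma crossing_rule_iff:
  "crossing_rule (\<triangleright>\<^sub>u) (\<triangleright>\<^sub>o) (\<bullet>\<^sub>u) (\<bullet>\<^sub>o) L c (a, b) \<longleftrightarrow>
     fits (kind_at L (a, b)) (c (in_arc L a)) (c (out_arc L a)) (c (in_arc L b)) (c (out_arc L b))"
  by (auto simp: crossing_rule_def kind_at_def fits_def Let_def)

lemma contribution_eq:
  "contribution \<phi> \<psi> L c (a, b) = wgt (kind_at L (a, b)) (c (in_arc L a)) (c (out_arc L b))"
  by (auto simp: contribution_def kind_at_def Let_def)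

definition to_flow :: "diagram \<Rightarrow> ((nat \<times> complex) set \<Rightarrow> 'x) \<Rightarrow> nat \<times> complex \<Rightarrow> 'x" where
  "to_flow L c = (\<lambda>q \<in> params L. c (in_arc L q))"

lemma to_flow_limits:
  assumes L: "link_diagram L" and q: "q \<in> params L"
  shows "\<forall>\<^sub>F s in at_left 0. to_flow L c (rot q s) = c (in_arc L q)"
    and "\<forall>\<^sub>F s in at_right 0. to_flow L c (rot q s) = c (out_arc L q)"
proof -
  show "\<forall>\<^sub>F s in at_left 0. to_flow L c (rot q s) = c (in_arc L q)"
    using in_arc(2)[OF L q]
    by eventually_elim (simp add: to_flow_def q arcs_of_interior_point[OF L in_arc(1)[OF L q]])
  show "\<forall>\<^sub>F s in at_right 0. to_flow L c (rot q s) = c (out_arc L q)"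
    using out_arc(2)[OF L q]
    by eventually_elim (simp add: to_flow_def q arcs_of_interior_point[OF L out_arc(1)[OF L q]])
qed

lemma to_flow_out:
  assumes L: "link_diagram L" and q: "q \<in> params L"
  shows "exit_value (to_flow L c) q = c (out_arc L q)"
  using to_flow_limits(2)[OF assms] by (rule exit_value_eq)

lemma flow_to_flow:
  assumes L: "link_diagram L"
  shows "flow L (to_flow L c)"
  unfolding flow_def
proof (intro conjI ballI impI)
  show "to_flow L c \<in> extensional (params L)" by (simp add: to_flow_def)
  fix q assume q: "q \<in> params L"
  show "\<forall>\<^sub>F s in at_left 0. to_flow L c (rot q s) = to_flow L c q"
    using to_flow_limits(1)[OF L q] q by (simp add: to_flow_def)
  show "\<exists>v. \<forall>\<^sub>F s in at_right 0. to_flow L c (rot q s) = v"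
    using to_flow_limits(2)[OF L q] by blast
  assume "q \<notin> passages L"
  then have "q \<in> \<Union>(semiarcs L)" using q by (simp add: semiarcs_def)
  then obtain S where "S \<in> semiarcs L" "q \<in> S" by blast
  then have "out_arc L q = in_arc L q" using arcs_of_interior_point[OF L] by simp
  then show "\<forall>\<^sub>F s in at_right 0. to_flow L c (rot q s) = to_flow L c q"
    using to_flow_limits(2)[OF L q, of c] q by (simp add: to_flow_def)
qed

lemma to_flow_coloring_iff:
  assumes L: "link_diagram L" and c: "c \<in> semiarcs L \<rightarrow>\<^sub>E UNIV"
  shows "flow_coloring L (to_flow L c) \<longleftrightarrow> c \<in> colorings (\<triangleright>\<^sub>u) (\<triangleright>\<^sub>o) (\<bullet>\<^sub>u) (\<bullet>\<^sub>o) L"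
proof -
  have "fits (kind_at L (a, b)) (to_flow L c a) (exit_value (to_flow L c) a) (to_flow L c b) (exit_value (to_flow L c) b)
     \<longleftrightarrow> crossing_rule (\<triangleright>\<^sub>u) (\<triangleright>\<^sub>o) (\<bullet>\<^sub>u) (\<bullet>\<^sub>o) L c (a, b)" if "(a, b) \<in> crossings L" for a b
  proof -
    have "a \<in> params L" "b \<in> params L" using that by (auto simp: crossings_def)
    then show ?thesis by (simp add: crossing_rule_iff to_flow_out[OF L]) (simp add: to_flow_def)
  qed
  then show ?thesis
    using c flow_to_flow[OF L] unfolding flow_coloring_def colorings_def by auto
qed

lemma to_flow_weight:
  assumes L: "link_diagram L"
  shows "flow_weight L (to_flow L c) = BW \<phi> \<psi> L c"
  unfolding flow_weight_def BW_def
proof (rule sum.cong[OF refl], clarify)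
  fix i z j w assume "((i, z), (j, w)) \<in> crossings L"
  then have "(i, z) \<in> params L" "(j, w) \<in> params L" by (auto simp: crossings_def)
  then show "wgt (kind_at L ((i, z), (j, w))) (to_flow L c (i, z)) (exit_value (to_flow L c) (j, w)) =
     contribution \<phi> \<psi> L c ((i, z), (j, w))"
    by (simp add: contribution_eq to_flow_out[OF L]) (simp add: to_flow_def)
qed

lemma flow_constant_on_semiarc:
  assumes L: "link_diagram L" and g: "flow L g" and S: "S \<in> semiarcs L" "p \<in> S" "q \<in> S"
  shows "g p = g q"
proof (rule connected_local_const)
  show "connected S" using S in_components_connected unfolding semiarcs_def by blast
  show "\<forall>a\<in>S. \<forall>\<^sub>F b in at a within S. g a = g b"
  proof
    fix a assume "a \<in> S"
    then have a: "a \<in> params L - passages L"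
      using S in_components_subset unfolding semiarcs_def by blast
    then have "\<forall>\<^sub>F s in at 0. g (rot a s) = g a"
      using g unfolding flow_def eventually_at_split by simp
    then have "\<forall>\<^sub>F b in at a within params L. g b = g a"
      using a by (intro eventually_at_rot) auto
    moreover have "S \<subseteq> params L" using S in_components_subset unfolding semiarcs_def by blast
    ultimately have "\<forall>\<^sub>F b in at a within S. g b = g a"
      using at_le[of S "params L" a] by (simp add: filter_leD)
    then show "\<forall>\<^sub>F b in at a within S. g a = g b" by eventually_elim simp
  qed
qed (use S in auto)

text \<open>
  A flow is constant on each semiarc, because a semiarc is connected and the flow is locally constant on
  it; conversely the color of the incoming semiarc is a flow.
\<close>

theorem Phi_eq_sum_over_flows:
  assumes L: "link_diagram L"
  shows "polynomial L =
     (\<Sum>g | flow_coloring L g. Poly_Mapping.single (flow_weight L g) 1)"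
proof -
  let ?C = "colorings (\<triangleright>\<^sub>u) (\<triangleright>\<^sub>o) (\<bullet>\<^sub>u) (\<bullet>\<^sub>o) L"
  have C: "c \<in> semiarcs L \<rightarrow>\<^sub>E UNIV" if "c \<in> ?C" for c using that by (simp add: colorings_def)
  have "bij_betw (to_flow L) ?C {g. flow_coloring L g}"
    unfolding bij_betw_def
  proof
    show "inj_on (to_flow L) ?C"
    proof (rule inj_onI)
      fix c c' assume c: "c \<in> ?C" "c' \<in> ?C" and eq: "to_flow L c = to_flow L c'"
      have "c S = c' S" if S: "S \<in> semiarcs L" for S
      proof -
        obtain q where q: "q \<in> S" using S in_components_nonempty unfolding semiarcs_def by blast
        then have "q \<in> params L" using S in_components_subset unfolding semiarcs_def by blast
        then show ?thesis
          using fun_cong[OF eq, of q] arcs_of_interior_point(1)[OF L S q] by (simp add: to_flow_def)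
      qed
      then show "c = c'" using C[OF c(1)] C[OF c(2)] by (intro PiE_ext)
    qed
    show "to_flow L ` ?C = {g. flow_coloring L g}"
    proof (intro equalityI subsetI)
      fix g assume "g \<in> to_flow L ` ?C"
      then show "g \<in> {g. flow_coloring L g}" using to_flow_coloring_iff[OF L C] by auto
    next
      fix g assume "g \<in> {g. flow_coloring L g}"
      then have g: "flow_coloring L g" "flow L g" by (auto simp: flow_coloring_def)
      define c where "c = (\<lambda>S \<in> semiarcs L. g (SOME q. q \<in> S))"
      have "to_flow L c = g"
      proof
        fix q show "to_flow L c q = g q"
        proof (cases "q \<in> params L")
          case True
          have "\<forall>\<^sub>F s in at_left 0. g (rot q s) = g q" using g(2) True by (simp add: flow_def)
          then have "\<forall>\<^sub>F s in at_left 0. g (rot q s) = g q \<and> rot q s \<in> in_arc L q"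
            using in_arc(2)[OF L True] by eventually_elim simp
          then obtain s where s: "g (rot q s) = g q" "rot q s \<in> in_arc L q"
            using eventually_happens'[of "at_left (0::real)"] by auto
          have "(SOME q'. q' \<in> in_arc L q) \<in> in_arc L q" using s(2) by (rule someI)
          then have "g (SOME q'. q' \<in> in_arc L q) = g (rot q s)"
            using flow_constant_on_semiarc[OF L g(2) in_arc(1)[OF L True]] s(2) by blast
          then show ?thesis using True s(1) in_arc(1)[OF L True] by (simp add: to_flow_def c_def)
        next
          case False
          then show ?thesis
            using g(2) extensional_arb[of g "params L" q] by (simp add: to_flow_def flow_def)
        qed
      qed
      moreover have "c \<in> semiarcs L \<rightarrow>\<^sub>E UNIV" by (simp add: c_def)
      ultimately show "g \<in> to_flow L ` ?C" using to_flow_coloring_iff[OF L] g(1) by blast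
    qed
  qed
  then have "(\<Sum>g | flow_coloring L g. Poly_Mapping.single (flow_weight L g) (1::int)) =
     (\<Sum>c \<in> ?C. Poly_Mapping.single (flow_weight L (to_flow L c)) 1)"
    by (subst sum.reindex_bij_betw[symmetric, where h = "to_flow L"]) auto
  then show ?thesis by (simp add: Phi_def to_flow_weight[OF L])
qed

end

section \<open>Planar isotopy\<close>

lemma det2_linear:
  assumes "linear f"
  shows "det2 (f u) (f v) = det2 (f 1) (f \<i>) * det2 u v"
proof -
  have *: "f u = Re u *\<^sub>R f 1 + Im u *\<^sub>R f \<i>" for u
  proof -
    have "u = Re u *\<^sub>R 1 + Im u *\<^sub>R \<i>" by (simp add: complex_eq_iff)
    then have "f u = f (Re u *\<^sub>R 1 + Im u *\<^sub>R \<i>)" by simp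
    then show ?thesis using assms by (simp add: linear_add linear_scale)
  qed
  show ?thesis unfolding det2_def *[of u] *[of v] by (simp add: algebra_simps)
qed

lemma det2_scale: "det2 (r *\<^sub>R u) (s *\<^sub>R v) = r * s * det2 u v"
  by (simp add: det2_def algebra_simps)

lemma unit_circle_cis:
  assumes "norm z = 1"
  obtains t where "z = cis t"
proof -
  have "cis (Arg z) = z" using assms cis_Arg[of z] by (cases "z = 0") (auto simp: sgn_eq)
  then show ?thesis using that by metis
qed

lemma has_velocity:
  assumes "link_diagram L" "q \<in> params L"
  shows "((\<lambda>s. pt L (rot q s)) has_vector_derivative velocity L q) (at 0)"
proof -
  obtain i z where q: "q = (i, z)" "i < ncomp L" "norm z = 1" using assms(2) by (auto simp: params_def)
  obtain t where t: "z = cis t" using unit_circle_cis[OF q(3)] .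
  have "(\<lambda>t. curve L i (cis t)) C1_differentiable_on UNIV"
    using assms(1) q(2) by (simp add: link_diagram_def)
  then obtain D where "\<forall>t \<in> UNIV. ((\<lambda>t. curve L i (cis t)) has_vector_derivative D t) (at t)"
    unfolding C1_differentiable_on_def by meson
  then have "((\<lambda>t. curve L i (cis t)) has_vector_derivative D t) (at (t + 0))" by simp
  moreover have "((\<lambda>s. t + s) has_vector_derivative 1) (at 0)"
    by (auto intro!: derivative_eq_intros)
  ultimately have "((\<lambda>s. curve L i (cis (t + s))) has_vector_derivative D t) (at 0)"
    using vector_diff_chain_at[of "\<lambda>s. t + s" 1 0 "\<lambda>t. curve L i (cis t)" "D t"] by (simp add: o_def)
  then have "((\<lambda>s. pt L (rot q s)) has_vector_derivative D t) (at 0)"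
    by (simp add: q t rot_def pt_def cis_mult)
  moreover from this have "velocity L q = D t"
    by (simp add: velocity_def q rot_def pt_def vector_derivative_at)
  ultimately show ?thesis by simp
qed

lemma velocity_eqI:
  "((\<lambda>s. pt L (rot q s)) has_vector_derivative v) (at 0) \<Longrightarrow> velocity L q = v"
  by (cases q) (simp add: velocity_def rot_def pt_def vector_derivative_at)

lemma eventually_reparam:
  fixes \<sigma> :: "real \<Rightarrow> real"
  assumes mono: "strict_mono \<sigma>" and cont: "continuous_on UNIV \<sigma>" and zero: "\<sigma> 0 = 0"
  shows "(\<forall>\<^sub>F s in at_left 0. P (\<sigma> s)) \<longleftrightarrow> (\<forall>\<^sub>F s in at_left 0. P s)"
    and "(\<forall>\<^sub>F s in at_right 0. P (\<sigma> s)) \<longleftrightarrow> (\<forall>\<^sub>F s in at_right 0. P s)"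
proof -
  have sgn: "\<sigma> s < 0 \<longleftrightarrow> s < 0" "0 < \<sigma> s \<longleftrightarrow> 0 < s" for s
    using strict_mono_less[OF mono, of s 0] strict_mono_less[OF mono, of 0 s] zero by auto
  have c: "isCont \<sigma> s" for s using cont by (simp add: continuous_on_eq_continuous_at)
  have lim: "(\<sigma> \<longlongrightarrow> 0) (at 0)" using c[of 0] zero by (simp add: isCont_def)
  show "(\<forall>\<^sub>F s in at_left 0. P (\<sigma> s)) \<longleftrightarrow> (\<forall>\<^sub>F s in at_left 0. P s)"
  proof
    assume "\<forall>\<^sub>F s in at_left 0. P (\<sigma> s)"
    then obtain d where d: "d < 0" "\<And>s. d < s \<Longrightarrow> s < 0 \<Longrightarrow> P (\<sigma> s)"
      unfolding eventually_at_left_field by blast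
    show "\<forall>\<^sub>F s in at_left 0. P s"
    proof (rule eventually_at_leftI[of "\<sigma> d"])
      fix u assume u: "u \<in> {\<sigma> d<..<0}"
      then obtain s where s: "d \<le> s" "s \<le> 0" "\<sigma> s = u"
        using IVT[of \<sigma> d u 0] c d(1) zero by auto
      then have "d \<noteq> s" "s \<noteq> 0" using u zero by auto
      then show "P u" using d(2)[of s] s by auto
    qed (use d sgn in auto)
  next
    assume "\<forall>\<^sub>F s in at_left 0. P s"
    then obtain d where d: "d < 0" "\<And>s. d < s \<Longrightarrow> s < 0 \<Longrightarrow> P s"
      unfolding eventually_at_left_field by blast
    have "\<forall>\<^sub>F s in at_left 0. \<sigma> s > d"
      using order_tendstoD(1)[OF lim d(1)] by (simp add: eventually_at_split)
    moreover have "\<forall>\<^sub>F s in at_left 0. s < (0::real)" by (auto simp: eventually_at_filter)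
    ultimately show "\<forall>\<^sub>F s in at_left 0. P (\<sigma> s)"
      by eventually_elim (use d(2) sgn in auto)
  qed
  show "(\<forall>\<^sub>F s in at_right 0. P (\<sigma> s)) \<longleftrightarrow> (\<forall>\<^sub>F s in at_right 0. P s)"
  proof
    assume "\<forall>\<^sub>F s in at_right 0. P (\<sigma> s)"
    then obtain d where d: "0 < d" "\<And>s. 0 < s \<Longrightarrow> s < d \<Longrightarrow> P (\<sigma> s)"
      unfolding eventually_at_right_field by blast
    show "\<forall>\<^sub>F s in at_right 0. P s"
    proof (rule eventually_at_rightI[of _ "\<sigma> d"])
      fix u assume u: "u \<in> {0<..<\<sigma> d}"
      then obtain s where s: "0 \<le> s" "s \<le> d" "\<sigma> s = u"
        using IVT[of \<sigma> 0 u d] c d(1) zero by auto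
      then have "d \<noteq> s" "s \<noteq> 0" using u zero by auto
      then show "P u" using d(2)[of s] s by auto
    qed (use d sgn in auto)
  next
    assume "\<forall>\<^sub>F s in at_right 0. P s"
    then obtain d where d: "0 < d" "\<And>s. 0 < s \<Longrightarrow> s < d \<Longrightarrow> P s"
      unfolding eventually_at_right_field by blast
    have "\<forall>\<^sub>F s in at_right 0. \<sigma> s < d"
      using order_tendstoD(2)[OF lim d(1)] by (simp add: eventually_at_split)
    moreover have "\<forall>\<^sub>F s in at_right 0. (0::real) < s" by (auto simp: eventually_at_filter)
    ultimately show "\<forall>\<^sub>F s in at_right 0. P (\<sigma> s)"
      by eventually_elim (use d(2) sgn in auto)
  qed
qed

lemma circle_reparam_rotation:
  assumes "circle_reparam g" "norm z = 1"
  obtains \<sigma> c where "\<And>s. g (z * cis s) = g z * cis (\<sigma> s)" "strict_mono \<sigma>" "continuous_on UNIV \<sigma>"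
    "\<sigma> 0 = 0" "(\<sigma> has_real_derivative c) (at 0)" "0 < c"
proof -
  obtain t where t: "z = cis t" using unit_circle_cis[OF assms(2)] .
  obtain \<rho> \<rho>' where \<rho>: "\<And>t. g (cis t) = cis (\<rho> t)" "\<And>t. (\<rho> has_real_derivative \<rho>' t) (at t)" "\<And>t. 0 < \<rho>' t"
    using assms(1) unfolding circle_reparam_def by blast
  define \<sigma> where "\<sigma> s = \<rho> (t + s) - \<rho> t" for s
  have der: "(\<sigma> has_real_derivative \<rho>' (t + s)) (at s)" for s
  proof -
    have "((\<lambda>s. \<rho> (t + s)) has_real_derivative \<rho>' (t + s) * 1) (at s)"
      by (rule DERIV_chain2[where f = \<rho> and g = "\<lambda>s. t + s"]) (auto intro!: \<rho>(2) derivative_eq_intros)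
    then show ?thesis unfolding \<sigma>_def by (auto intro!: derivative_eq_intros)
  qed
  have "strict_mono \<sigma>"
  proof (rule strict_monoI)
    fix x y :: real assume "x < y"
    then show "\<sigma> x < \<sigma> y" using DERIV_pos_imp_increasing[of x y \<sigma>] der \<rho>(3) by blast
  qed
  moreover have "continuous_on UNIV \<sigma>"
    using der by (meson DERIV_isCont continuous_at_imp_continuous_on)
  moreover have "g (z * cis s) = g z * cis (\<sigma> s)" for s
    by (simp add: t cis_mult \<rho>(1) \<sigma>_def)
  ultimately show ?thesis
    using that[of \<sigma> "\<rho>' t"] der[of 0] \<rho>(3) by (simp add: \<sigma>_def)
qed

text \<open>
  The lift is strictly increasing and commutes with the translation by a full turn.
\<close>

lemma circle_reparam_bij:
  assumes "circle_reparam g"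
  shows "bij_betw g (sphere 0 1) (sphere 0 1)"
proof -
  obtain \<rho> \<rho>' where \<rho>: "\<And>t. g (cis t) = cis (\<rho> t)" "\<And>t. \<rho> (t + 2 * pi) = \<rho> t + 2 * pi"
      "\<And>t. (\<rho> has_real_derivative \<rho>' t) (at t)" "\<And>t. 0 < \<rho>' t"
    using assms unfolding circle_reparam_def by blast
  have cis_ex: "\<exists>t. z = cis t" if "z \<in> sphere 0 1" for z
    using that unit_circle_cis[of z] by (metis mem_sphere_0)
  have nat_period: "\<rho> (t + of_nat n * (2 * pi)) = \<rho> t + of_nat n * (2 * pi)" for t n
  proof (induction n)
    case (Suc n)
    have "\<rho> (t + of_nat (Suc n) * (2 * pi)) = \<rho> ((t + of_nat n * (2 * pi)) + 2 * pi)"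
      by (simp add: algebra_simps)
    then show ?case using \<rho>(2)[of "t + of_nat n * (2 * pi)"] Suc by (simp add: algebra_simps)
  qed simp
  have period: "\<rho> (t + of_int n * (2 * pi)) = \<rho> t + of_int n * (2 * pi)" for t n
  proof (cases "0 \<le> n")
    case True
    then show ?thesis using nat_period[of t "nat n"] by simp
  next
    case False
    then show ?thesis using nat_period[of "t + of_int n * (2 * pi)" "nat (- n)"] by simp
  qed
  have mono: "strict_mono \<rho>"
  proof (rule strict_monoI)
    fix x y :: real assume "x < y"
    then show "\<rho> x < \<rho> y" using DERIV_pos_imp_increasing[of x y \<rho>] \<rho>(3,4) by blast
  qed
  have cont: "isCont \<rho> t" for t using \<rho>(3) DERIV_isCont by blast
  have "inj_on g (sphere 0 1)"
  proof (rule inj_onI)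
    fix z z' assume z: "z \<in> sphere 0 1" "z' \<in> sphere 0 1" and eq: "g z = g z'"
    obtain t t' where t: "z = cis t" "z' = cis t'" using z cis_ex by meson
    then have "cis (\<rho> t - \<rho> t') = 1" using eq by (simp add: \<rho>(1) cis_divide [symmetric])
    then have "cos (\<rho> t - \<rho> t') = 1" by (simp add: complex_eq_iff)
    then obtain n :: int where n: "\<rho> t - \<rho> t' = of_int n * 2 * pi" by (auto simp: cos_one_2pi_int)
    then have "\<rho> t = \<rho> (t' + of_int n * (2 * pi))" by (simp add: period)
    then have "t = t' + of_int n * (2 * pi)" using mono strict_mono_eq by blast
    then have "cis t = cis t' * cis (of_int n * (2 * pi))" by (simp add: cis_mult)
    moreover have "cis (of_int n * (2 * pi)) = 1"
      using cis_multiple_2pi[of "of_int n"] by (simp add: mult.commute)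
    ultimately show "z = z'" using t by simp
  qed
  moreover have "g ` sphere 0 1 = sphere 0 1"
  proof (intro equalityI subsetI)
    fix y assume "y \<in> g ` sphere 0 1"
    then obtain z where "z \<in> sphere 0 1" "y = g z" by blast
    then show "y \<in> sphere 0 1" using cis_ex[of z] by (auto simp: \<rho>(1))
  next
    fix y :: complex assume "y \<in> sphere 0 1"
    then obtain u where u: "y = cis u" using cis_ex by blast
    define n where "n = \<lfloor>(u - \<rho> 0) / (2 * pi)\<rfloor>"
    have "of_int n \<le> (u - \<rho> 0) / (2 * pi)" "(u - \<rho> 0) / (2 * pi) < of_int (n + 1)"
      unfolding n_def by linarith+
    then have "\<rho> 0 + of_int n * (2 * pi) \<le> u" "u \<le> \<rho> 0 + of_int (n + 1) * (2 * pi)"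
      by (simp_all add: field_simps)
    then have "\<rho> (of_int n * (2 * pi)) \<le> u" "u \<le> \<rho> (of_int (n + 1) * (2 * pi))"
      using period[of 0 n] period[of 0 "n + 1"] by simp_all
    then obtain t where "\<rho> t = u"
      using IVT[of \<rho> "of_int n * (2 * pi)" u "of_int (n + 1) * (2 * pi)"] cont by (auto simp: algebra_simps)
    then have "y = g (cis t)" using u by (simp add: \<rho>(1))
    then show "y \<in> g ` sphere 0 1" by simp
  qed
  ultimately show ?thesis by (simp add: bij_betw_def)
qed

text \<open>
  The Jacobian determinant is 1 at time 0 and has no zeros, so it is positive at time 1.
\<close>

lemma ambient_isotopy_end:
  assumes "ambient_isotopy H"
  obtains D where "\<And>z. (H 1 has_derivative D z) (at z)" "\<And>z. 0 < det2 (D z 1) (D z \<i>)" "inj (H 1)"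
proof -
  have H: "H 0 = id" "bij (H 1)" using assms unfolding ambient_isotopy_def by auto
  obtain D :: "real \<Rightarrow> complex \<Rightarrow> complex \<Rightarrow>\<^sub>L complex" where
    D': "\<forall>t \<in> {0..1}. \<forall>z. (H t has_derivative blinfun_apply (D t z)) (at z) \<and>
           det2 (blinfun_apply (D t z) 1) (blinfun_apply (D t z) \<i>) \<noteq> 0"
        "continuous_on ({0..1} \<times> UNIV) (\<lambda>(t, z). D t z)"
    using assms unfolding ambient_isotopy_def by blast
  then have
    D: "\<And>t z. t \<in> {0..1} \<Longrightarrow> (H t has_derivative blinfun_apply (D t z)) (at z)"
      "\<And>t z. t \<in> {0..1} \<Longrightarrow> det2 (blinfun_apply (D t z) 1) (blinfun_apply (D t z) \<i>) \<noteq> 0"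
      "continuous_on ({0..1} \<times> UNIV) (\<lambda>(t, z). D t z)"
    by blast+
  have "0 < det2 (D 1 z 1) (D 1 z \<i>)" for z
  proof (rule ccontr)
    assume neg: "\<not> 0 < det2 (D 1 z 1) (D 1 z \<i>)"
    define d where "d t = det2 (D t z 1) (D t z \<i>)" for t
    have "continuous_on {0..1} (\<lambda>t. (\<lambda>(t, z). D t z) (t, z))"
      by (rule continuous_on_compose2[OF D(3)]) (auto intro!: continuous_intros)
    then have "continuous_on {0..1} (\<lambda>t. D t z)" by simp
    then have "continuous_on {0..1} d"
      unfolding d_def det2_def by (intro continuous_intros)
    moreover have "d 0 = 1"
    proof -
      have "(H 0 has_derivative id) (at z)" using H(1) by (simp add: id_def)
      then have "blinfun_apply (D 0 z) = id" using has_derivative_unique D(1)[of 0 z] by auto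
      then show ?thesis by (simp add: d_def det2_def)
    qed
    ultimately obtain t where "0 \<le> t" "t \<le> 1" "d t = 0"
      using IVT2'[of d 1 0 0] neg by (auto simp: d_def)
    then show False using D(2)[of t z] by (simp add: d_def)
  qed
  then show ?thesis using that[of "\<lambda>z. blinfun_apply (D 1 z)"] D(1)[of 1] H(2) by (simp add: bij_is_inj)
qed

context finite_boltzmann_weight
begin

text \<open>
  The map \<open>\<Theta>\<close> on parameters is a bijection that preserves directions.  The final diffeomorphism preserves
  the sign of the determinant of two velocities, so \<open>\<Theta>\<close> maps crossings to crossings, and composing with it
  maps colorings to colorings.
\<close>

theorem Phi_planar_isotopy:
  assumes "planar_isotopic L L'"
  shows "polynomial L = polynomial L'"
proof -
  obtain H \<pi> \<gamma> where L: "link_diagram L" "link_diagram L'" and H: "ambient_isotopy H"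
    and \<pi>: "bij_betw \<pi> {..<ncomp L'} {..<ncomp L}" and \<gamma>: "\<And>i. i < ncomp L' \<Longrightarrow> circle_reparam (\<gamma> i)"
    and all: "\<forall>(i, z) \<in> params L'. pt L' (i, z) = H 1 (pt L (\<pi> i, \<gamma> i z)) \<and>
           ((i, z) \<in> over L' \<longleftrightarrow> (\<pi> i, \<gamma> i z) \<in> over L)"
    and sp: "special L' = H 1 ` special L"
    using assms unfolding planar_isotopic_def by auto
  define \<Theta> where "\<Theta> = (\<lambda>(i, z). (\<pi> i, \<gamma> i z))"
  have pt: "pt L' q = H 1 (pt L (\<Theta> q))" and ov: "q \<in> over L' \<longleftrightarrow> \<Theta> q \<in> over L" if "q \<in> params L'" for q
    using all that by (auto simp: \<Theta>_def split: prod.splits)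
  obtain D where D: "\<And>z. (H 1 has_derivative D z) (at z)" "\<And>z. 0 < det2 (D z 1) (D z \<i>)" and inj: "inj (H 1)"
    using ambient_isotopy_end[OF H] by blast
  have bij: "bij_betw \<Theta> (params L') (params L)"
  proof -
    have "\<Theta> ` params L' = params L"
    proof (intro equalityI subsetI)
      fix p assume "p \<in> \<Theta> ` params L'"
      then obtain i z where "i < ncomp L'" "z \<in> sphere 0 1" "p = (\<pi> i, \<gamma> i z)"
        by (auto simp: params_def \<Theta>_def)
      then show "p \<in> params L"
        using bij_betwE[OF \<pi>] bij_betwE[OF circle_reparam_bij[OF \<gamma>]] by (auto simp: params_def)
    next
      fix p assume "p \<in> params L"
      then obtain j y where p: "p = (j, y)" "j < ncomp L" "y \<in> sphere 0 1" by (auto simp: params_def)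
      then obtain i where i: "i < ncomp L'" "j = \<pi> i" using bij_betw_imp_surj_on[OF \<pi>] by blast
      obtain z where z: "z \<in> sphere 0 1" "y = \<gamma> i z"
        using bij_betw_imp_surj_on[OF circle_reparam_bij[OF \<gamma>[OF i(1)]]] p(3) by blast
      have "p = \<Theta> (i, z)" using p i z by (simp add: \<Theta>_def)
      moreover have "(i, z) \<in> params L'" using i z by (simp add: params_def)
      ultimately show "p \<in> \<Theta> ` params L'" by blast
    qed
    moreover have "inj_on \<Theta> (params L')"
    proof (rule inj_onI)
      fix p p' assume p: "p \<in> params L'" "p' \<in> params L'" and eq: "\<Theta> p = \<Theta> p'"
      obtain i z i' z' where d: "p = (i, z)" "p' = (i', z')" by (cases p, cases p')
      then have m: "i < ncomp L'" "i' < ncomp L'" "z \<in> sphere 0 1" "z' \<in> sphere 0 1"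
        and e: "\<pi> i = \<pi> i'" "\<gamma> i z = \<gamma> i' z'"
        using p eq by (auto simp: params_def \<Theta>_def)
      then have "i = i'" using inj_onD[OF bij_betw_imp_inj_on[OF \<pi>], of i i'] by auto
      then show "p = p'"
        using d e m inj_onD[OF bij_betw_imp_inj_on[OF circle_reparam_bij[OF \<gamma>[OF m(1)]]], of z z'] by auto
    qed
    ultimately show ?thesis by (simp add: bij_betw_def)
  qed
  note \<Theta>_in = bij_betwE[OF bij, rule_format]
  have rotation: "\<exists>\<sigma> c. (\<forall>s. \<Theta> (rot q s) = rot (\<Theta> q) (\<sigma> s)) \<and> strict_mono \<sigma> \<and> continuous_on UNIV \<sigma> \<and>
     \<sigma> 0 = 0 \<and> (\<sigma> has_real_derivative c) (at 0) \<and> 0 < c" if q: "q \<in> params L'" for q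
  proof -
    have "fst q < ncomp L'" "norm (snd q) = 1" using q by (auto simp: params_def)
    from circle_reparam_rotation[OF \<gamma>[OF this(1)] this(2)]
    show ?thesis unfolding \<Theta>_def rot_def by (auto split: prod.splits) metis
  qed
  have vel: "\<exists>c > 0. velocity L' q = D (pt L (\<Theta> q)) (c *\<^sub>R velocity L (\<Theta> q))" if q: "q \<in> params L'" for q
  proof -
    obtain \<sigma> c where \<sigma>: "\<And>s. \<Theta> (rot q s) = rot (\<Theta> q) (\<sigma> s)" "\<sigma> 0 = 0" "(\<sigma> has_real_derivative c) (at 0)" "0 < c"
      using rotation[OF q] by blast
    have "(\<sigma> has_vector_derivative c) (at 0)" using \<sigma>(3) by (simp add: has_real_derivative_iff_has_vector_derivative)
    moreover have "((\<lambda>s. pt L (rot (\<Theta> q) s)) has_vector_derivative velocity L (\<Theta> q)) (at (\<sigma> 0))"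
      using has_velocity[OF L(1) \<Theta>_in[OF q]] \<sigma>(2) by simp
    ultimately have "((\<lambda>s. pt L (rot (\<Theta> q) (\<sigma> s))) has_vector_derivative c *\<^sub>R velocity L (\<Theta> q)) (at 0)"
      using vector_diff_chain_at[of \<sigma> c 0 "\<lambda>s. pt L (rot (\<Theta> q) s)"] by (simp add: o_def)
    then have "((\<lambda>s. H 1 (pt L (rot (\<Theta> q) (\<sigma> s)))) has_derivative
        (\<lambda>x. D (pt L (\<Theta> q)) (x *\<^sub>R (c *\<^sub>R velocity L (\<Theta> q))))) (at 0)"
      unfolding has_vector_derivative_def
      using diff_chain_at[of "\<lambda>s. pt L (rot (\<Theta> q) (\<sigma> s))" _ 0 "H 1" "D (pt L (\<Theta> q))"] D(1) \<sigma>(2)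
      by (simp add: o_def)
    then have "((\<lambda>s. pt L' (rot q s)) has_vector_derivative D (pt L (\<Theta> q)) (c *\<^sub>R velocity L (\<Theta> q))) (at 0)"
      using q has_derivative_linear[OF D(1)] unfolding has_vector_derivative_def
      by (simp add: pt \<sigma>(1) linear_scale)
    then show ?thesis using velocity_eqI \<sigma>(4) by blast
  qed
  have cross: "(a, b) \<in> crossings L' \<longleftrightarrow> (\<Theta> a, \<Theta> b) \<in> crossings L" if ab: "a \<in> params L'" "b \<in> params L'" for a b
  proof -
    have "pt L' a = pt L' b \<longleftrightarrow> pt L (\<Theta> a) = pt L (\<Theta> b)" using ab pt inj by (simp add: inj_eq)
    moreover have "det2 (velocity L' a) (velocity L' b) < 0 \<longleftrightarrow> det2 (velocity L (\<Theta> a)) (velocity L (\<Theta> b)) < 0"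
      if e: "pt L (\<Theta> a) = pt L (\<Theta> b)"
    proof -
      obtain c c' where c: "c > 0" "c' > 0" "velocity L' a = D (pt L (\<Theta> a)) (c *\<^sub>R velocity L (\<Theta> a))"
        "velocity L' b = D (pt L (\<Theta> b)) (c' *\<^sub>R velocity L (\<Theta> b))"
        using vel ab by meson
      have "det2 (velocity L' a) (velocity L' b) = det2 (D (pt L (\<Theta> a)) 1) (D (pt L (\<Theta> a)) \<i>) *
         (c * c' * det2 (velocity L (\<Theta> a)) (velocity L (\<Theta> b)))"
        unfolding c e by (subst det2_linear[OF has_derivative_linear[OF D(1)]]) (simp add: det2_scale)
      then show ?thesis using c(1,2) D(2) by (simp add: mult_less_0_iff zero_less_mult_iff not_less[symmetric]) (smt (verit) mult_pos_pos)
    qed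
    moreover have "a = b \<longleftrightarrow> \<Theta> a = \<Theta> b" using bij ab by (metis bij_betw_imp_inj_on inj_on_eq_iff)
    ultimately show ?thesis using ab \<Theta>_in by (auto simp: crossings_def)
  qed
  have bij_cross: "bij_betw (map_prod \<Theta> \<Theta>) (crossings L') (crossings L)"
  proof -
    have "map_prod \<Theta> \<Theta> ` crossings L' = crossings L"
    proof (intro equalityI subsetI)
      fix p assume "p \<in> map_prod \<Theta> \<Theta> ` crossings L'"
      then show "p \<in> crossings L" using cross by (auto simp: crossings_def)
    next
      fix p assume p: "p \<in> crossings L"
      then obtain a b where ab: "p = (a, b)" "a \<in> params L" "b \<in> params L" by (auto simp: crossings_def)
      then obtain a' b' where "a' \<in> params L'" "b' \<in> params L'" "a = \<Theta> a'" "b = \<Theta> b'"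
        using bij_betw_imp_surj_on[OF bij] by (metis imageE)
      then have "(a', b') \<in> crossings L'" "p = map_prod \<Theta> \<Theta> (a', b')" using cross p ab by auto
      then show "p \<in> map_prod \<Theta> \<Theta> ` crossings L'" by blast
    qed
    moreover have "inj_on (map_prod \<Theta> \<Theta>) (crossings L')"
    proof (rule inj_on_subset)
      show "inj_on (map_prod \<Theta> \<Theta>) (params L' \<times> params L')"
        using bij_betw_imp_inj_on[OF bij] by (intro map_prod_inj_on)
    qed (auto simp: crossings_def)
    ultimately show ?thesis by (simp add: bij_betw_def)
  qed
  have pass: "q \<in> passages L' \<longleftrightarrow> \<Theta> q \<in> passages L" if q: "q \<in> params L'" for q
  proof -
    have "passages L = \<Theta> ` passages L'"
      unfolding passages_def using bij_betw_imp_surj_on[OF bij_cross] by (auto simp: image_iff) force+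
    then show ?thesis using q passages_subset[of L'] bij_betw_imp_inj_on[OF bij]
      by (simp add: inj_on_image_mem_iff)
  qed
  have kind: "kind_at L' (a, b) = kind_at L (\<Theta> a, \<Theta> b)" if "(a, b) \<in> crossings L'" for a b
  proof -
    have "a \<in> params L'" "b \<in> params L'" using that by (auto simp: crossings_def)
    then show ?thesis using pt ov inj by (simp add: kind_at_def sp inj_image_mem_iff)
  qed
  define pull where "pull g = (\<lambda>q \<in> params L'. g (\<Theta> q))" for g :: "nat \<times> complex \<Rightarrow> 'x"
  have pull_ev: "(\<forall>\<^sub>F s in at_left 0. pull g (rot q s) = v) \<longleftrightarrow> (\<forall>\<^sub>F s in at_left 0. g (rot (\<Theta> q) s) = v)"
     "(\<forall>\<^sub>F s in at_right 0. pull g (rot q s) = v) \<longleftrightarrow> (\<forall>\<^sub>F s in at_right 0. g (rot (\<Theta> q) s) = v)"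
     if q: "q \<in> params L'" for q g v
  proof -
    obtain \<sigma> where \<sigma>: "\<And>s. \<Theta> (rot q s) = rot (\<Theta> q) (\<sigma> s)" "strict_mono \<sigma>" "continuous_on UNIV \<sigma>" "\<sigma> 0 = 0"
      using rotation[OF q] by blast
    show "(\<forall>\<^sub>F s in at_left 0. pull g (rot q s) = v) \<longleftrightarrow> (\<forall>\<^sub>F s in at_left 0. g (rot (\<Theta> q) s) = v)"
     "(\<forall>\<^sub>F s in at_right 0. pull g (rot q s) = v) \<longleftrightarrow> (\<forall>\<^sub>F s in at_right 0. g (rot (\<Theta> q) s) = v)"
      using eventually_reparam[OF \<sigma>(2-4), of "\<lambda>s. g (rot (\<Theta> q) s) = v"] q
      by (simp_all add: pull_def \<sigma>(1))
  qed
  have pull_out: "exit_value (pull g) q = exit_value g (\<Theta> q)" if q: "q \<in> params L'" for q g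
    unfolding exit_value_def pull_ev[OF q] ..
  have flow: "flow L' (pull g) \<longleftrightarrow> flow L g" if "g \<in> extensional (params L)" for g
  proof -
    have "flow L' (pull g) \<longleftrightarrow> (\<forall>q \<in> params L'. (\<forall>\<^sub>F s in at_left 0. g (rot (\<Theta> q) s) = g (\<Theta> q)) \<and>
        (\<exists>v. \<forall>\<^sub>F s in at_right 0. g (rot (\<Theta> q) s) = v) \<and>
        (\<Theta> q \<notin> passages L \<longrightarrow> (\<forall>\<^sub>F s in at_right 0. g (rot (\<Theta> q) s) = g (\<Theta> q))))"
      unfolding flow_def by (auto simp: pull_ev pass) (simp_all add: pull_def)
    also have "\<dots> \<longleftrightarrow> flow L g"
      unfolding flow_def bij_betw_imp_surj_on[OF bij, symmetric] ball_simps using that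
      by (simp add: bij_betw_imp_surj_on[OF bij])
    finally show ?thesis .
  qed
  have coloring: "flow_coloring L' (pull g) \<longleftrightarrow> flow_coloring L g" if "g \<in> extensional (params L)" for g
  proof -
    have "(\<forall>(a, b) \<in> crossings L'. fits (kind_at L' (a, b)) (pull g a) (exit_value (pull g) a) (pull g b) (exit_value (pull g) b))
      \<longleftrightarrow> (\<forall>p \<in> crossings L'. case map_prod \<Theta> \<Theta> p of (a, b) \<Rightarrow>
            fits (kind_at L (a, b)) (g a) (exit_value g a) (g b) (exit_value g b))"
    proof (rule ball_cong[OF refl], clarify)
      fix i z j w assume ab: "((i, z), (j, w)) \<in> crossings L'"
      then have "(i, z) \<in> params L'" "(j, w) \<in> params L'" by (auto simp: crossings_def)
      then show "fits (kind_at L' ((i, z), (j, w))) (pull g (i, z)) (exit_value (pull g) (i, z)) (pull g (j, w)) (exit_value (pull g) (j, w))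
        = (case map_prod \<Theta> \<Theta> ((i, z), (j, w)) of (a, b) \<Rightarrow> fits (kind_at L (a, b)) (g a) (exit_value g a) (g b) (exit_value g b))"
        by (simp add: kind[OF ab] pull_out) (simp add: pull_def)
    qed
    also have "\<dots> \<longleftrightarrow> (\<forall>(a, b) \<in> crossings L. fits (kind_at L (a, b)) (g a) (exit_value g a) (g b) (exit_value g b))"
      unfolding bij_betw_imp_surj_on[OF bij_cross, symmetric] by (simp only: ball_simps)
    finally show ?thesis unfolding flow_coloring_def using flow[OF that] by blast
  qed
  have weight: "flow_weight L' (pull g) = flow_weight L g" for g
  proof -
    have "flow_weight L g = (\<Sum>p \<in> crossings L'. case map_prod \<Theta> \<Theta> p of (a, b) \<Rightarrow> wgt (kind_at L (a, b)) (g a) (exit_value g b))"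
      unfolding flow_weight_def by (rule sum.reindex_bij_betw[OF bij_cross, symmetric])
    also have "\<dots> = flow_weight L' (pull g)"
      unfolding flow_weight_def
    proof (rule sum.cong[OF refl], clarify)
      fix i z j w assume ab: "((i, z), (j, w)) \<in> crossings L'"
      then have "(i, z) \<in> params L'" "(j, w) \<in> params L'" by (auto simp: crossings_def)
      then show "(case map_prod \<Theta> \<Theta> ((i, z), (j, w)) of (a, b) \<Rightarrow> wgt (kind_at L (a, b)) (g a) (exit_value g b)) =
          wgt (kind_at L' ((i, z), (j, w))) (pull g (i, z)) (exit_value (pull g) (j, w))"
        by (simp add: kind[OF ab] pull_out) (simp add: pull_def)
    qed
    finally show ?thesis by simp
  qed
  have "bij_betw pull {g. flow_coloring L g} {g. flow_coloring L' g}"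
    unfolding bij_betw_def
  proof
    have ext: "g \<in> extensional (params L)" if "flow_coloring L g" for g
      using that by (auto simp: flow_coloring_def flow_def)
    show "inj_on pull {g. flow_coloring L g}"
    proof (rule inj_onI)
      fix g g' assume g: "g \<in> {g. flow_coloring L g}" "g' \<in> {g. flow_coloring L g}" and eq: "pull g = pull g'"
      show "g = g'"
      proof (rule extensionalityI[of _ "params L"])
        fix p assume "p \<in> params L"
        then obtain q where "q \<in> params L'" "p = \<Theta> q" using bij_betw_imp_surj_on[OF bij] by blast
        then show "g p = g' p" using fun_cong[OF eq, of q] by (simp add: pull_def)
      qed (use g ext in auto)
    qed
    show "pull ` {g. flow_coloring L g} = {g. flow_coloring L' g}"
    proof (intro equalityI subsetI)
      fix g' assume "g' \<in> pull ` {g. flow_coloring L g}"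
      then show "g' \<in> {g. flow_coloring L' g}" using coloring ext by auto
    next
      fix g' assume g': "g' \<in> {g. flow_coloring L' g}"
      define g where "g = (\<lambda>p \<in> params L. g' (inv_into (params L') \<Theta> p))"
      have "pull g = g'"
      proof (rule extensionalityI[of _ "params L'"])
        fix q assume q: "q \<in> params L'"
        then show "pull g q = g' q"
          using \<Theta>_in[OF q] bij_betw_inv_into_left[OF bij q] by (simp add: pull_def g_def)
      qed (use g' in \<open>auto simp: pull_def flow_coloring_def flow_def\<close>)
      moreover have "g \<in> extensional (params L)" by (simp add: g_def)
      ultimately show "g' \<in> pull ` {g. flow_coloring L g}" using coloring g' by (metis imageI mem_Collect_eq)
    qed
  qed
  then have "(\<Sum>g | flow_coloring L' g. Poly_Mapping.single (flow_weight L' g) (1::int)) =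
      (\<Sum>g | flow_coloring L g. Poly_Mapping.single (flow_weight L' (pull g)) 1)"
    by (rule sum.reindex_bij_betw[symmetric])
  then show ?thesis by (simp add: Phi_eq_sum_over_flows L weight)
qed

end

section \<open>Occurrences of a local picture\<close>

lemma eventually_affine:
  fixes t w :: real
  assumes "w \<noteq> 0"
  shows "(\<forall>\<^sub>F s in at_left 0. Q (t + s / w)) \<longleftrightarrow> (\<forall>\<^sub>F u in if 0 < w then at_left t else at_right t. Q u)"
    and "(\<forall>\<^sub>F s in at_right 0. Q (t + s / w)) \<longleftrightarrow> (\<forall>\<^sub>F u in if 0 < w then at_right t else at_left t. Q u)"
proof -
  have F: "((\<lambda>s. t + s / w) \<longlongrightarrow> t) (at 0 within S)" for S
    using assms by (auto intro!: tendsto_eq_intros)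
  have G: "((\<lambda>u. (u - t) * w) \<longlongrightarrow> 0) (at t within S)" for S
    by (auto intro!: tendsto_eq_intros)
  have F1: "filterlim (\<lambda>s. t + s / w) (if 0 < w then at_left t else at_right t) (at_left 0)"
    and F2: "filterlim (\<lambda>s. t + s / w) (if 0 < w then at_right t else at_left t) (at_right 0)"
    using assms F by (auto simp: filterlim_at eventually_at_filter divide_neg_pos divide_pos_neg
        divide_pos_pos divide_neg_neg)
  have G1: "filterlim (\<lambda>u. (u - t) * w) (at_left 0) (if 0 < w then at_left t else at_right t)"
    and G2: "filterlim (\<lambda>u. (u - t) * w) (at_right 0) (if 0 < w then at_right t else at_left t)"
    using assms G by (auto simp: filterlim_at eventually_at_filter mult_neg_pos mult_pos_neg
        mult_pos_pos mult_neg_neg)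
  have inv: "t + (u - t) * w / w = u" for u using assms by simp
  show "(\<forall>\<^sub>F s in at_left 0. Q (t + s / w)) \<longleftrightarrow> (\<forall>\<^sub>F u in if 0 < w then at_left t else at_right t. Q u)"
  proof
    assume "\<forall>\<^sub>F s in at_left 0. Q (t + s / w)"
    from eventually_compose_filterlim[OF this G1]
    show "\<forall>\<^sub>F u in if 0 < w then at_left t else at_right t. Q u" by (simp only: inv)
  next
    assume "\<forall>\<^sub>F u in if 0 < w then at_left t else at_right t. Q u"
    from eventually_compose_filterlim[OF this F1] show "\<forall>\<^sub>F s in at_left 0. Q (t + s / w)" .
  qed
  show "(\<forall>\<^sub>F s in at_right 0. Q (t + s / w)) \<longleftrightarrow> (\<forall>\<^sub>F u in if 0 < w then at_right t else at_left t. Q u)"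
  proof
    assume "\<forall>\<^sub>F s in at_right 0. Q (t + s / w)"
    from eventually_compose_filterlim[OF this G2]
    show "\<forall>\<^sub>F u in if 0 < w then at_right t else at_left t. Q u" by (simp only: inv)
  next
    assume "\<forall>\<^sub>F u in if 0 < w then at_right t else at_left t. Q u"
    from eventually_compose_filterlim[OF this F2] show "\<forall>\<^sub>F s in at_right 0. Q (t + s / w)" .
  qed
qed

definition breaks :: "real set" where
  "breaks = {-1/2, 0, 1/2}"

text \<open>
  The breaks cut an arc into the pieces 0, 1, 2, 3.  A break belongs to the piece that is traversed before
  it, where \<open>\<sigma>\<close> says whether the arc is traversed in the direction of increasing parameters.  This matches
  the convention that a flow has the color of the incoming semiarc at a passage.
\<close>

definition piece :: "bool \<Rightarrow> real \<Rightarrow> nat" where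
  "piece \<sigma> t = (if t < -1/2 \<or> \<sigma> \<and> t = -1/2 then 0 else if t < 0 \<or> \<sigma> \<and> t = 0 then 1
     else if t < 1/2 \<or> \<sigma> \<and> t = 1/2 then 2 else 3)"

lemma piece_mono: "s \<le> t \<Longrightarrow> piece \<sigma> s \<le> piece \<sigma> t"
  by (auto simp: piece_def)

lemma piece_flip_iff: "piece \<sigma> t = piece (\<not> \<sigma>) t \<longleftrightarrow> t \<notin> breaks"
  by (auto simp: piece_def breaks_def)

lemma piece_le: "piece \<sigma> t \<le> 3"
  by (auto simp: piece_def)

lemma eventually_piece:
  "\<forall>\<^sub>F u in at_left t. piece \<sigma> u = piece True t" "\<forall>\<^sub>F u in at_right t. piece \<sigma> u = piece False t"
proof -
  have "piece \<sigma> u = piece True t"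
    if "u \<in> {if t \<le> -1/2 then t - 1 else if t \<le> 0 then -1/2 else if t \<le> 1/2 then 0 else 1/2<..<t}" for u
    using that by (auto simp: piece_def split: if_splits)
  then show "\<forall>\<^sub>F u in at_left t. piece \<sigma> u = piece True t"
    by (intro eventually_at_leftI) auto
  have "piece \<sigma> u = piece False t"
    if "u \<in> {t<..<if 1/2 \<le> t then t + 1 else if 0 \<le> t then 1/2 else if -1/2 \<le> t then 0 else -1/2}" for u
    using that by (auto simp: piece_def split: if_splits)
  then show "\<forall>\<^sub>F u in at_right t. piece \<sigma> u = piece False t"
    by (intro eventually_at_rightI) auto
qed

text \<open>
  The points of the pieces 0 and 3 are the ends of the arc, because the labels there must not be affected by
  a move.
\<close>

definition sample :: "nat \<Rightarrow> real" where
  "sample j = (if j = 0 then -1 else if j = 1 then -1/4 else if j = 2 then 1/4 else 1)"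

lemma piece_sample: "j \<le> 3 \<Longrightarrow> piece \<sigma> (sample j) = j"
  by (auto simp: piece_def sample_def)

lemma tparams_mem [simp]: "(k, t) \<in> tparams T \<longleftrightarrow> k < length (arcs T) \<and> -1 \<le> t \<and> t \<le> 1"
  by (auto simp: tparams_def)

definition picture_pt :: "picture \<Rightarrow> nat \<times> real \<Rightarrow> complex" where
  "picture_pt T = (\<lambda>(k, t). (arcs T ! k) t)"

text \<open>
  The set \<open>dc\<close> contains each double point of the picture once, as the pair of parameters in the order for
  which the determinant of the directions is positive.
\<close>

definition double_points :: "picture \<Rightarrow> ((nat \<times> real) \<times> (nat \<times> real)) set \<Rightarrow> bool" where
  "double_points T dc \<longleftrightarrow> finite dc \<and>
     (\<forall>p \<in> tparams T. \<forall>q \<in> tparams T. p \<noteq> q \<and> picture_pt T p = picture_pt T q \<longleftrightarrow> (p, q) \<in> dc \<or> (q, p) \<in> dc) \<and>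
     (\<forall>(p, q) \<in> dc. p \<in> tparams T \<and> q \<in> tparams T \<and> snd p \<in> breaks \<and> snd q \<in> breaks \<and>
        (\<exists>u v. (arcs T ! fst p has_vector_derivative u) (at (snd p)) \<and>
               (arcs T ! fst q has_vector_derivative v) (at (snd q)) \<and> 0 < det2 u v))"

text \<open>
  The order of the two passages in \<open>crossings\<close> is that of a negative determinant.  Traversing one of the
  two arcs backward changes the sign of the determinant.
\<close>

definition orient :: "(nat \<Rightarrow> bool) \<Rightarrow> (nat \<times> real) \<times> (nat \<times> real) \<Rightarrow> (nat \<times> real) \<times> (nat \<times> real)" where
  "orient \<sigma> = (\<lambda>(p, q). if \<sigma> (fst p) = \<sigma> (fst q) then (q, p) else (p, q))"

definition val_in :: "(nat \<Rightarrow> bool) \<Rightarrow> (nat \<Rightarrow> nat \<Rightarrow> 'x) \<Rightarrow> nat \<times> real \<Rightarrow> 'x" where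
  "val_in \<sigma> v = (\<lambda>(k, t). v k (piece (\<sigma> k) t))"

definition val_out :: "(nat \<Rightarrow> bool) \<Rightarrow> (nat \<Rightarrow> nat \<Rightarrow> 'x) \<Rightarrow> nat \<times> real \<Rightarrow> 'x" where
  "val_out \<sigma> v = (\<lambda>(k, t). v k (piece (\<not> \<sigma> k) t))"

context finite_boltzmann_weight
begin

definition picture_kind :: "picture \<Rightarrow> (nat \<times> real) \<times> (nat \<times> real) \<Rightarrow> ('x, 'r) kind" where
  "picture_kind T = (\<lambda>(p, q). if picture_pt T p \<in> tspecial T then singular
      else if q \<in> tover T then classical else flip classical)"

definition local_coloring ::
  "picture \<Rightarrow> ((nat \<times> real) \<times> (nat \<times> real)) set \<Rightarrow> (nat \<Rightarrow> bool) \<Rightarrow> (nat \<Rightarrow> nat \<Rightarrow> 'x) \<Rightarrow> bool" where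
  "local_coloring T dc \<sigma> v \<longleftrightarrow>
     (\<forall>k < length (arcs T). \<forall>t \<in> breaks. (k, t) \<notin> fst ` dc \<union> snd ` dc \<longrightarrow> v k (piece True t) = v k (piece False t)) \<and>
     (\<forall>(p, q) \<in> orient \<sigma> ` dc.
        fits (picture_kind T (p, q)) (val_in \<sigma> v p) (val_out \<sigma> v p) (val_in \<sigma> v q) (val_out \<sigma> v q))"

definition local_weight ::
  "picture \<Rightarrow> ((nat \<times> real) \<times> (nat \<times> real)) set \<Rightarrow> (nat \<Rightarrow> bool) \<Rightarrow> (nat \<Rightarrow> nat \<Rightarrow> 'x) \<Rightarrow> 'r" where
  "local_weight T dc \<sigma> v =
     (\<Sum>(p, q) \<in> orient \<sigma> ` dc. wgt (picture_kind T (p, q)) (val_in \<sigma> v p) (val_out \<sigma> v q))"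

end

text \<open>
  One side of a local move: the diffeomorphism \<open>h\<close> moves the picture \<open>T\<close> into the plane of \<open>L\<close>, and \<open>P\<close> says
  which parameters of \<open>L\<close> trace its arcs.
\<close>

locale occurrence = finite_boltzmann_weight ut ot ub ob \<phi> \<psi>
  for ut :: "'x::finite \<Rightarrow> 'x \<Rightarrow> 'x"  (infixl "\<triangleright>\<^sub>u" 70)
    and ot :: "'x \<Rightarrow> 'x \<Rightarrow> 'x"  (infixl "\<triangleright>\<^sub>o" 70)
    and ub :: "'x \<Rightarrow> 'x \<Rightarrow> 'x"  (infixl "\<bullet>\<^sub>u" 70)
    and ob :: "'x \<Rightarrow> 'x \<Rightarrow> 'x"  (infixl "\<bullet>\<^sub>o" 70)
    and \<phi> \<psi> :: "'x \<Rightarrow> 'x \<Rightarrow> 'r::comm_ring_1" +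
  fixes L :: diagram and T :: picture and dc :: "((nat \<times> real) \<times> (nat \<times> real)) set"
    and h :: "complex \<Rightarrow> complex" and P :: "nat \<Rightarrow> nat \<times> real \<times> real"
  assumes L: "link_diagram L" and h: "plane_diffeo h" and occ: "occurs T h P L"
    and dc: "double_points T dc"
begin

definition A :: "complex set" where "A = h ` square"

definition slope :: "nat \<Rightarrow> real" where "slope k = snd (snd (P k))"

definition \<sigma> :: "nat \<Rightarrow> bool" where "\<sigma> k \<longleftrightarrow> 0 < slope k"

text \<open>
  The middle halves of the placed arcs contain all passages inside the square.  A move changes a coloring
  only there, and the ends of the arcs stay away from this set.
\<close>

definition M :: "(nat \<times> complex) set" where
  "M = place P ` ({..<length (arcs T)} \<times> {-1/2..1/2})"

lemma place_inj: "p \<in> tparams T \<Longrightarrow> q \<in> tparams T \<Longrightarrow> place P p = place P q \<longleftrightarrow> p = q"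
  using occ by (auto simp: occurs_def inj_on_eq_iff)

lemma place_image: "place P ` tparams T = {q \<in> params L. pt L q \<in> A}"
  using occ by (simp add: occurs_def A_def)

lemma place_in: "p \<in> tparams T \<Longrightarrow> place P p \<in> params L"
  using place_image by blast

lemma pt_place: "p \<in> tparams T \<Longrightarrow> pt L (place P p) = h (picture_pt T p)"
  using occ by (cases p) (auto simp: occurs_def picture_pt_def)

lemma over_place: "p \<in> tparams T \<Longrightarrow> place P p \<in> over L \<longleftrightarrow> p \<in> tover T"
  using occ by (cases p) (auto simp: occurs_def)

lemma inj_h: "inj h"
  using h by (simp add: plane_diffeo_def bij_is_inj)

lemma special_place:
  assumes "p \<in> tparams T"
  shows "pt L (place P p) \<in> special L \<longleftrightarrow> picture_pt T p \<in> tspecial T"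
proof -
  have "pt L (place P p) \<in> h ` square" using place_image assms unfolding A_def by blast
  then have "pt L (place P p) \<in> special L \<longleftrightarrow> pt L (place P p) \<in> special L \<inter> h ` square" by blast
  also have "\<dots> \<longleftrightarrow> h (picture_pt T p) \<in> h ` tspecial T"
    using occ pt_place[OF assms] by (simp add: occurs_def)
  also have "\<dots> \<longleftrightarrow> picture_pt T p \<in> tspecial T" using inj_h by (simp add: inj_image_mem_iff)
  finally show ?thesis .
qed

lemma slope_nonzero:
  assumes "k < length (arcs T)"
  shows "slope k \<noteq> 0"
proof
  assume "slope k = 0"
  then have "place P (k, 0) = place P (k, 1)" by (cases "P k") (simp add: place_def slope_def)
  then show False using place_inj[of "(k, 0)" "(k, 1)"] assms by simp
qed

lemma rot_place:
  assumes "k < length (arcs T)"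
  shows "rot (place P (k, t)) s = place P (k, t + s / slope k)"
  using slope_nonzero[OF assms]
  by (auto simp: place_def rot_def slope_def cis_mult algebra_simps split: prod.splits)

lemma derivative_h:
  obtains D where "\<And>z. (h has_derivative D z) (at z)" "\<And>z. 0 < det2 (D z 1) (D z \<i>)"
proof -
  obtain D :: "complex \<Rightarrow> complex \<Rightarrow>\<^sub>L complex" where
    "\<forall>z. (h has_derivative blinfun_apply (D z)) (at z) \<and>
       0 < det2 (blinfun_apply (D z) 1) (blinfun_apply (D z) \<i>)"
    using h unfolding plane_diffeo_def by blast
  then show ?thesis by (intro that[of "\<lambda>z. blinfun_apply (D z)"]) auto
qed

lemma continuous_h: "continuous_on S h"
  using derivative_h by (metis has_derivative_continuous continuous_at_imp_continuous_on)

lemma compact_square: "compact square"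
proof -
  have eq: "square = cbox (Complex (-1) (-1)) (Complex 1 1)"
    by (auto simp: square_def in_cbox_complex_iff abs_le_iff)
  show ?thesis unfolding eq by (rule compact_cbox)
qed

lemma closed_A: "closed A"
  unfolding A_def by (intro compact_imp_closed compact_continuous_image continuous_h compact_square)

lemma isCont_pt_rot:
  assumes "q \<in> params L"
  shows "isCont (\<lambda>s. pt L (rot q s)) 0"
  using has_velocity[OF L assms] has_vector_derivative_continuous by blast

lemma eventually_outside:
  assumes "q \<in> params L" "pt L q \<notin> A"
  shows "\<forall>\<^sub>F s in nhds 0. pt L (rot q s) \<notin> A"
proof -
  have "((\<lambda>s. pt L (rot q s)) \<longlongrightarrow> pt L (rot q 0)) (nhds 0)"
    using isCont_pt_rot[OF assms(1)] unfolding isCont_def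
    by (subst (asm) tendsto_at_iff_tendsto_nhds)
  moreover have "\<forall>\<^sub>F z in nhds (pt L q). z \<in> - A"
    using assms(2) closed_A by (intro eventually_nhds_in_open) auto
  ultimately show ?thesis
    using eventually_compose_filterlim[of "\<lambda>z. z \<in> - A" "nhds (pt L q)" "\<lambda>s. pt L (rot q s)" "nhds 0"]
    by simp
qed

lemma compact_M: "compact M"
proof -
  have "M = (\<Union>k<length (arcs T). (\<lambda>t. place P (k, t)) ` {-1/2..1/2})"
    by (auto simp: M_def)
  moreover have "compact ((\<lambda>t. place P (k, t)) ` {-1/2..1/2})" for k
    by (cases "P k", intro compact_continuous_image)
       (auto simp: place_def intro!: continuous_intros)
  ultimately show ?thesis by auto
qed

lemma eventually_not_M:
  assumes "q \<notin> M"
  shows "\<forall>\<^sub>F s in nhds 0. rot q s \<notin> M"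
proof -
  have "((\<lambda>s. rot q s) \<longlongrightarrow> rot q 0) (nhds 0)"
    using isCont_rot[of 0 q] unfolding isCont_def by (subst (asm) tendsto_at_iff_tendsto_nhds)
  moreover have "\<forall>\<^sub>F p in nhds q. p \<in> - M"
    using assms compact_M by (intro eventually_nhds_in_open) (auto simp: compact_imp_closed)
  ultimately show ?thesis
    using eventually_compose_filterlim[of "\<lambda>p. p \<in> - M" "nhds q" "\<lambda>s. rot q s" "nhds 0"] by simp
qed

lemma velocity_place:
  assumes k: "k < length (arcs T)" and t: "\<bar>t\<bar> < 1"
    and u: "(arcs T ! k has_vector_derivative u) (at t)" and D: "(h has_derivative D) (at (picture_pt T (k, t)))"
  shows "velocity L (place P (k, t)) = D ((1 / slope k) *\<^sub>R u)"
proof (rule velocity_eqI)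
  let ?w = "slope k"
  have "((\<lambda>s. t + s / ?w) has_vector_derivative 1 / ?w) (at 0)"
    using slope_nonzero[OF k] by (auto intro!: derivative_eq_intros simp: has_real_derivative_iff_has_vector_derivative[symmetric])
  moreover have "(arcs T ! k has_vector_derivative u) (at (t + 0 / ?w))" using u by simp
  ultimately have "((\<lambda>s. (arcs T ! k) (t + s / ?w)) has_vector_derivative (1 / ?w) *\<^sub>R u) (at 0)"
    using vector_diff_chain_at[of "\<lambda>s. t + s / ?w" "1 / ?w" 0 "arcs T ! k" u] by (simp add: o_def)
  then have "((\<lambda>s. h ((arcs T ! k) (t + s / ?w))) has_derivative (\<lambda>x. D (x *\<^sub>R ((1 / ?w) *\<^sub>R u)))) (at 0)"
    using diff_chain_at[of "\<lambda>s. (arcs T ! k) (t + s / ?w)" _ 0 h D] D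
    unfolding has_vector_derivative_def by (simp add: o_def picture_pt_def)
  then have der: "((\<lambda>s. h ((arcs T ! k) (t + s / ?w))) has_vector_derivative D ((1 / ?w) *\<^sub>R u)) (at 0)"
    using has_derivative_linear[OF D] unfolding has_vector_derivative_def by (simp add: linear_scale)
  have "((\<lambda>s. t + s / ?w) \<longlongrightarrow> t) (nhds 0)"
    using slope_nonzero[OF k] by (auto intro!: tendsto_eq_intros filterlim_ident)
  moreover have "\<forall>\<^sub>F x in nhds t. x \<in> {-1<..<1}"
    using t by (intro eventually_nhds_in_open) auto
  ultimately have "\<forall>\<^sub>F s in nhds 0. t + s / ?w \<in> {-1<..<1}"
    using eventually_compose_filterlim[of "\<lambda>x. x \<in> {-1<..<1}" "nhds t" "\<lambda>s. t + s / ?w" "nhds 0"] by blast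
  then have "\<forall>\<^sub>F s in nhds 0. h ((arcs T ! k) (t + s / ?w)) = pt L (rot (place P (k, t)) s)"
    by eventually_elim (use k in \<open>simp add: rot_place pt_place picture_pt_def\<close>)
  note ev = this
  have "((\<lambda>s. h ((arcs T ! k) (t + s / ?w))) has_vector_derivative D ((1 / ?w) *\<^sub>R u)) (at 0) =
    ((\<lambda>s. pt L (rot (place P (k, t)) s)) has_vector_derivative D ((1 / ?w) *\<^sub>R u)) (at 0)"
    using eventually_mono[OF ev] eventually_nhds_x_imp_x[OF ev]
    by (intro has_vector_derivative_cong_ev) auto
  then show "((\<lambda>s. pt L (rot (place P (k, t)) s)) has_vector_derivative D ((1 / ?w) *\<^sub>R u)) (at 0)"
    using der by simp
qed

lemma dc_points:
  assumes "(p, q) \<in> dc"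
  shows "p \<in> tparams T" "q \<in> tparams T" "p \<noteq> q" "picture_pt T p = picture_pt T q" "snd p \<in> breaks" "snd q \<in> breaks"
  using dc assms unfolding double_points_def by fast+

text \<open>
  The velocities are the directions in the picture, divided by the slopes and mapped by the derivative of
  \<open>h\<close>, which has positive determinant.
\<close>

lemma det_place:
  assumes "(p, q) \<in> dc"
  shows "0 < det2 (velocity L (place P p)) (velocity L (place P q)) \<longleftrightarrow> \<sigma> (fst p) = \<sigma> (fst q)"
    and "det2 (velocity L (place P p)) (velocity L (place P q)) \<noteq> 0"
proof -
  obtain u v where uv: "(arcs T ! fst p has_vector_derivative u) (at (snd p))"
      "(arcs T ! fst q has_vector_derivative v) (at (snd q))" "0 < det2 u v"
    using dc assms unfolding double_points_def by fast
  note pq = dc_points[OF assms]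
  obtain D where D: "\<And>z. (h has_derivative D z) (at z)" "\<And>z. 0 < det2 (D z 1) (D z \<i>)"
    using derivative_h by blast
  have k: "fst p < length (arcs T)" "fst q < length (arcs T)" and t: "\<bar>snd p\<bar> < 1" "\<bar>snd q\<bar> < 1"
    using pq by (auto simp: breaks_def tparams_def)
  define d where "d = det2 (D (picture_pt T p) 1) (D (picture_pt T p) \<i>)"
  have "velocity L (place P p) = D (picture_pt T p) ((1 / slope (fst p)) *\<^sub>R u)"
       "velocity L (place P q) = D (picture_pt T p) ((1 / slope (fst q)) *\<^sub>R v)"
    using velocity_place[OF k(1) t(1) uv(1) D(1)] velocity_place[OF k(2) t(2) uv(2) D(1)] pq(4) by simp_all
  then have eq: "det2 (velocity L (place P p)) (velocity L (place P q)) =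
      d * ((1 / slope (fst p)) * (1 / slope (fst q)) * det2 u v)"
    unfolding d_def
    by (simp only: det2_linear[OF has_derivative_linear[OF D(1)],
          of "picture_pt T p" "(1 / slope (fst p)) *\<^sub>R u" "(1 / slope (fst q)) *\<^sub>R v"] det2_scale)
  have "d > 0" using D(2) by (simp add: d_def)
  then show "det2 (velocity L (place P p)) (velocity L (place P q)) \<noteq> 0"
    using uv(3) slope_nonzero[OF k(1)] slope_nonzero[OF k(2)] by (simp add: eq)
  show "0 < det2 (velocity L (place P p)) (velocity L (place P q)) \<longleftrightarrow> \<sigma> (fst p) = \<sigma> (fst q)"
  proof -
    have "0 < d * det2 u v" using uv(3) \<open>d > 0\<close> by simp
    then have "0 < d * det2 u v / (slope (fst p) * slope (fst q)) \<longleftrightarrow> 0 < slope (fst p) * slope (fst q)"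
      by (metis less_asym zero_less_divide_iff)
    moreover have "0 < slope (fst p) * slope (fst q) \<longleftrightarrow> (0 < slope (fst p)) = (0 < slope (fst q))"
      using slope_nonzero[OF k(1)] slope_nonzero[OF k(2)] by (auto simp: zero_less_mult_iff)
    moreover have "d * ((1 / slope (fst p)) * (1 / slope (fst q)) * det2 u v) =
        d * det2 u v / (slope (fst p) * slope (fst q))" by simp
    ultimately show ?thesis
      unfolding eq \<sigma>_def by simp
  qed
qed

definition outer :: "((nat \<times> complex) \<times> (nat \<times> complex)) set" where
  "outer = {(a, b) \<in> crossings L. pt L a \<notin> A}"

definition inner :: "((nat \<times> complex) \<times> (nat \<times> complex)) set" where
  "inner = map_prod (place P) (place P) ` orient \<sigma> ` dc"

lemma det2_swap: "det2 u v = - det2 v u"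
  by (simp add: det2_def)

lemma inner_crossings: "inner = {(a, b) \<in> crossings L. pt L a \<in> A}"
proof (intro equalityI subsetI)
  fix c assume "c \<in> inner"
  then obtain e where "c = map_prod (place P) (place P) (orient \<sigma> e)" "e \<in> dc"
    unfolding inner_def image_image by (rule imageE)
  then obtain p q where pq: "(p, q) \<in> dc" and c: "c = map_prod (place P) (place P) (orient \<sigma> (p, q))"
    by (metis surj_pair)
  note d = dc_points[OF pq]
  have "pt L (place P p) \<in> A" using d(1) place_image by blast
  then have e: "pt L (place P p) = pt L (place P q)" "pt L (place P p) \<in> A"
    using d by (simp_all add: pt_place)
  show "c \<in> {(a, b) \<in> crossings L. pt L a \<in> A}"
    using det_place[OF pq] c d e place_in det2_swap[of "velocity L (place P p)" "velocity L (place P q)"]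
    by (cases "\<sigma> (fst p) = \<sigma> (fst q)") (auto simp: orient_def crossings_def place_inj)
next
  fix c assume "c \<in> {(a, b) \<in> crossings L. pt L a \<in> A}"
  then obtain a b where c: "c = (a, b)" "(a, b) \<in> crossings L" "pt L a \<in> A" by auto
  then have ab: "a \<in> params L" "b \<in> params L" "a \<noteq> b" "pt L a = pt L b" "det2 (velocity L a) (velocity L b) < 0"
    by (auto simp: crossings_def)
  then obtain p q where pq: "p \<in> tparams T" "q \<in> tparams T" "a = place P p" "b = place P q"
    using place_image c(3) by (smt (verit, del_insts) imageE mem_Collect_eq)
  then have "p \<noteq> q" "picture_pt T p = picture_pt T q"
    using ab pt_place inj_h by (auto simp: inj_eq)
  then have "(p, q) \<in> dc \<or> (q, p) \<in> dc" using dc pq unfolding double_points_def by blast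
  then have "\<exists>e \<in> dc. orient \<sigma> e = (p, q)"
  proof
    assume m: "(p, q) \<in> dc"
    then have "\<sigma> (fst p) \<noteq> \<sigma> (fst q)" using det_place(1)[OF m] ab(5) pq by auto
    then show ?thesis using m by (intro bexI[of _ "(p, q)"]) (auto simp: orient_def)
  next
    assume m: "(q, p) \<in> dc"
    then have "\<sigma> (fst q) = \<sigma> (fst p)"
      using det_place(1)[OF m] ab(5) pq det2_swap[of "velocity L a" "velocity L b"] by auto
    then show ?thesis using m by (intro bexI[of _ "(q, p)"]) (auto simp: orient_def)
  qed
  then show "c \<in> inner" unfolding inner_def using c pq by force
qed

lemma crossings_split: "crossings L = outer \<union> inner" "outer \<inter> inner = {}"
  unfolding inner_crossings outer_def by auto

lemma orient_dc:
  assumes "(p, q) \<in> orient \<sigma> ` dc"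
  shows "p \<in> tparams T" "q \<in> tparams T" "snd p \<in> breaks" "snd q \<in> breaks"
  using assms dc_points by (auto simp: orient_def split: if_splits)

lemma orient_dc_points: "fst ` orient \<sigma> ` dc \<union> snd ` orient \<sigma> ` dc = fst ` dc \<union> snd ` dc"
  by (auto simp: orient_def image_iff split: if_splits prod.splits) (metis fst_conv snd_conv)+

lemma passageE:
  assumes "q \<in> passages L"
  obtains a b where "(a, b) \<in> crossings L" "q = a \<or> q = b" "pt L a = pt L q"
proof -
  obtain a b where ab: "(a, b) \<in> crossings L" "q = a \<or> q = b"
    using assms unfolding passages_def by (metis UnE imageE prod.collapse)
  then have "pt L a = pt L q" by (auto simp: crossings_def)
  then show ?thesis using that ab by blast
qed

lemma passage_iff_part:
  assumes "\<And>a b. (a, b) \<in> crossings L \<Longrightarrow> pt L a = pt L q \<Longrightarrow> (a, b) \<in> C" and "C \<subseteq> crossings L"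
  shows "q \<in> passages L \<longleftrightarrow> q \<in> fst ` C \<union> snd ` C"
proof
  assume "q \<in> passages L"
  then obtain a b where "(a, b) \<in> C" "q = a \<or> q = b" using assms(1) by (metis passageE)
  then show "q \<in> fst ` C \<union> snd ` C" by force
qed (use assms(2) in \<open>auto simp: passages_def\<close>)

lemma passage_place_iff:
  assumes "p \<in> tparams T"
  shows "place P p \<in> passages L \<longleftrightarrow> p \<in> fst ` dc \<union> snd ` dc"
proof -
  have "pt L (place P p) \<in> A" using assms place_image by blast
  then have "place P p \<in> passages L \<longleftrightarrow> place P p \<in> fst ` inner \<union> snd ` inner"
    by (intro passage_iff_part) (auto simp: inner_crossings)
  also have "\<dots> \<longleftrightarrow> place P p \<in> place P ` (fst ` orient \<sigma> ` dc \<union> snd ` orient \<sigma> ` dc)"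
    unfolding inner_def by (simp add: image_Un image_image)
  also have "\<dots> \<longleftrightarrow> p \<in> fst ` dc \<union> snd ` dc"
    unfolding orient_dc_points
  proof (rule inj_on_image_mem_iff[of "place P" "tparams T"])
    show "inj_on (place P) (tparams T)" using place_inj by (simp add: inj_on_def)
    show "fst ` dc \<union> snd ` dc \<subseteq> tparams T"
    proof
      fix x assume "x \<in> fst ` dc \<union> snd ` dc"
      then obtain p q where "(p, q) \<in> dc" "x = p \<or> x = q" by (metis UnE imageE prod.collapse)
      then show "x \<in> tparams T" using dc_points(1,2) by blast
    qed
  qed (rule assms)
  finally show ?thesis .
qed

lemma passage_outer_iff:
  assumes "q \<in> params L" "pt L q \<notin> A"
  shows "q \<in> passages L \<longleftrightarrow> q \<in> fst ` outer \<union> snd ` outer"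
  using assms by (intro passage_iff_part) (auto simp: outer_def)

lemma kind_place:
  assumes "p \<in> tparams T" "q \<in> tparams T"
  shows "kind_at L (place P p, place P q) = picture_kind T (p, q)"
  using assms by (simp add: kind_at_def picture_kind_def special_place over_place)

end

section \<open>Replacing a local picture\<close>

context finite_boltzmann_weight
begin

definition determined :: "picture \<Rightarrow> ((nat \<times> real) \<times> (nat \<times> real)) set \<Rightarrow> bool" where
  "determined T dc \<longleftrightarrow> (\<forall>\<sigma> v v'. local_coloring T dc \<sigma> v \<longrightarrow> local_coloring T dc \<sigma> v' \<longrightarrow>
     (\<forall>k < length (arcs T). v k 0 = v' k 0 \<and> v k 3 = v' k 3) \<longrightarrow>
     (\<forall>k < length (arcs T). v k 1 = v' k 1 \<and> v k 2 = v' k 2))"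

definition transfers where
  "transfers T dc T' dc' \<longleftrightarrow> (\<forall>\<sigma> v. local_coloring T dc \<sigma> v \<longrightarrow>
     (\<exists>v'. local_coloring T' dc' \<sigma> v' \<and> (\<forall>k < length (arcs T). v' k 0 = v k 0 \<and> v' k 3 = v k 3) \<and>
        local_weight T' dc' \<sigma> v' = local_weight T dc \<sigma> v))"

end

context occurrence
begin

definition labels :: "(nat \<times> complex \<Rightarrow> 'x) \<Rightarrow> nat \<Rightarrow> nat \<Rightarrow> 'x" where
  "labels g k j = g (place P (k, sample j))"

lemma sided_limits:
  assumes g: "flow L g" and k: "k < length (arcs T)" and t: "-1 \<le> t" "t \<le> 1"
  shows "\<forall>\<^sub>F u in if \<sigma> k then at_left t else at_right t. g (place P (k, u)) = g (place P (k, t))"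
    and "place P (k, t) \<notin> passages L \<Longrightarrow>
      \<forall>\<^sub>F u in if \<sigma> k then at_right t else at_left t. g (place P (k, u)) = g (place P (k, t))"
proof -
  have q: "place P (k, t) \<in> params L" using place_in k t by simp
  have "\<forall>\<^sub>F s in at_left 0. g (place P (k, t + s / slope k)) = g (place P (k, t))"
    using g q unfolding flow_def rot_place[OF k, symmetric] by blast
  then show "\<forall>\<^sub>F u in if \<sigma> k then at_left t else at_right t. g (place P (k, u)) = g (place P (k, t))"
    unfolding eventually_affine[OF slope_nonzero[OF k], of "\<lambda>u. g (place P (k, u)) = g (place P (k, t))"] \<sigma>_def .
  assume "place P (k, t) \<notin> passages L"
  then have "\<forall>\<^sub>F s in at_right 0. g (place P (k, t + s / slope k)) = g (place P (k, t))"
    using g q unfolding flow_def rot_place[OF k, symmetric] by blast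
  then show "\<forall>\<^sub>F u in if \<sigma> k then at_right t else at_left t. g (place P (k, u)) = g (place P (k, t))"
    unfolding eventually_affine[OF slope_nonzero[OF k], of "\<lambda>u. g (place P (k, u)) = g (place P (k, t))"] \<sigma>_def .
qed

lemma breaks_passages:
  assumes "(k, t) \<in> tparams T" "place P (k, t) \<in> passages L"
  shows "t \<in> breaks"
proof -
  obtain p q where "(p, q) \<in> dc" "(k, t) = p \<or> (k, t) = q"
    using passage_place_iff[OF assms(1)] assms(2) by (metis UnE imageE prod.collapse)
  then show ?thesis using dc_points(5,6) by (metis snd_conv)
qed

text \<open>
  Each piece is an interval, and a flow is locally constant on it: a break that belongs to the piece is its
  last point in the direction of the flow, where only the values before it matter.
\<close>

lemma flow_labels:
  assumes g: "flow L g" and k: "k < length (arcs T)" and t: "-1 \<le> t" "t \<le> 1"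
  shows "g (place P (k, t)) = val_in \<sigma> (labels g) (k, t)"
proof -
  \<comment> \<open>the piece that contains \<open>t\<close>\<close>
  define S where "S = {u \<in> {-1..1}. piece (\<sigma> k) u = piece (\<sigma> k) t}"
  have "g (place P (k, t)) = g (place P (k, sample (piece (\<sigma> k) t)))"
  proof (rule connected_local_const[where f = "\<lambda>u. g (place P (k, u))" and A = S])
    have "is_interval S"
      unfolding is_interval_1
    proof (intro ballI impI allI)
      fix a b x assume ab: "a \<in> S" "b \<in> S" "a \<le> x \<and> x \<le> b"
      then have "piece (\<sigma> k) a \<le> piece (\<sigma> k) x" "piece (\<sigma> k) x \<le> piece (\<sigma> k) b" by (auto intro: piece_mono)
      then show "x \<in> S" using ab by (auto simp: S_def)
    qed
    then show "connected S" by (simp add: is_interval_connected_1)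
    show "t \<in> S" using t by (simp add: S_def)
    show "sample (piece (\<sigma> k) t) \<in> S"
      using piece_sample[OF piece_le[of "\<sigma> k" t], of "\<sigma> k"] by (auto simp: S_def sample_def)
    show "\<forall>a\<in>S. \<forall>\<^sub>F b in at a within S. g (place P (k, a)) = g (place P (k, b))"
    proof
      fix a assume a: "a \<in> S"
      then have a1: "-1 \<le> a" "a \<le> 1" by (auto simp: S_def)
      have 1: "\<forall>\<^sub>F u in if \<sigma> k then at_left a else at_right a. u \<in> S \<longrightarrow> g (place P (k, u)) = g (place P (k, a))"
        using sided_limits(1)[OF g k a1] by eventually_elim simp
      have 2: "\<forall>\<^sub>F u in if \<sigma> k then at_right a else at_left a. u \<in> S \<longrightarrow> g (place P (k, u)) = g (place P (k, a))"
      proof (cases "a \<in> breaks")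
        case False
        then have "place P (k, a) \<notin> passages L" using breaks_passages[of k a] k a1 by auto
        then show ?thesis
          using sided_limits(2)[OF g k a1] by (auto elim: eventually_mono)
      next
        case True
        have "\<forall>\<^sub>F u in if \<sigma> k then at_right a else at_left a. piece (\<sigma> k) u = piece (\<not> \<sigma> k) a"
          using eventually_piece[of _ a] by auto
        then have "\<forall>\<^sub>F u in if \<sigma> k then at_right a else at_left a. u \<notin> S"
        proof eventually_elim
          case (elim u)
          then show ?case using a True piece_flip_iff[of "\<sigma> k" a] by (auto simp: S_def)
        qed
        then show ?thesis by eventually_elim simp
      qed
      have "\<forall>\<^sub>F u in at a. u \<in> S \<longrightarrow> g (place P (k, u)) = g (place P (k, a))"
        using 1 2 unfolding eventually_at_split by (auto split: if_splits)
      then have "\<forall>\<^sub>F u in at a within S. g (place P (k, u)) = g (place P (k, a))"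
        unfolding eventually_at_filter by eventually_elim auto
      then show "\<forall>\<^sub>F b in at a within S. g (place P (k, a)) = g (place P (k, b))"
        by eventually_elim simp
    qed
  qed
  then show ?thesis by (simp add: val_in_def labels_def)
qed

lemma label_limits:
  assumes g: "\<And>u. -1 \<le> u \<Longrightarrow> u \<le> 1 \<Longrightarrow> g (place P (k, u)) = val_in \<sigma> v (k, u)"
    and k: "k < length (arcs T)" and t: "-1 < t" "t < 1"
  shows "\<forall>\<^sub>F s in at_left 0. g (rot (place P (k, t)) s) = val_in \<sigma> v (k, t)"
    and "\<forall>\<^sub>F s in at_right 0. g (rot (place P (k, t)) s) = val_out \<sigma> v (k, t)"
proof -
  have "\<forall>\<^sub>F u in at t. u \<in> {-1<..<1}"
    using t by (intro eventually_at_in_open') auto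
  then have near: "\<forall>\<^sub>F u in at_left t. g (place P (k, u)) = val_in \<sigma> v (k, u)"
      "\<forall>\<^sub>F u in at_right t. g (place P (k, u)) = val_in \<sigma> v (k, u)"
    unfolding eventually_at_split using g by (auto elim!: eventually_mono)
  have l: "\<forall>\<^sub>F u in at_left t. g (place P (k, u)) = v k (piece True t)"
    using near(1) eventually_piece(1)[of "\<sigma> k" t] by eventually_elim (simp add: val_in_def)
  have r: "\<forall>\<^sub>F u in at_right t. g (place P (k, u)) = v k (piece False t)"
    using near(2) eventually_piece(2)[of "\<sigma> k" t] by eventually_elim (simp add: val_in_def)
  show "\<forall>\<^sub>F s in at_left 0. g (rot (place P (k, t)) s) = val_in \<sigma> v (k, t)"
    unfolding rot_place[OF k] eventually_affine(1)[OF slope_nonzero[OF k], of "\<lambda>u. g (place P (k, u)) = _"]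
    using l r by (simp add: val_in_def \<sigma>_def)
  show "\<forall>\<^sub>F s in at_right 0. g (rot (place P (k, t)) s) = val_out \<sigma> v (k, t)"
    unfolding rot_place[OF k] eventually_affine(2)[OF slope_nonzero[OF k], of "\<lambda>u. g (place P (k, u)) = _"]
    using l r by (simp add: val_out_def \<sigma>_def)
qed

lemma flow_labels_out:
  assumes g: "flow L g" and k: "k < length (arcs T)" and t: "-1 < t" "t < 1"
  shows "exit_value g (place P (k, t)) = val_out \<sigma> (labels g) (k, t)"
  using label_limits(2)[OF flow_labels[OF g k] k t] by (rule exit_value_eq)

lemma crossing_labels:
  assumes g: "flow L g" and p: "p \<in> tparams T" "snd p \<in> breaks"
  shows "g (place P p) = val_in \<sigma> (labels g) p" "exit_value g (place P p) = val_out \<sigma> (labels g) p"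
  using flow_labels[OF g, of "fst p" "snd p"] flow_labels_out[OF g, of "fst p" "snd p"] p
  by (auto simp: tparams_def breaks_def)

lemma inner_iff: "(p, q) \<in> orient \<sigma> ` dc \<Longrightarrow> (place P p, place P q) \<in> inner"
  unfolding inner_def by force

lemma flow_coloring_labels:
  assumes g: "flow_coloring L g"
  shows "local_coloring T dc \<sigma> (labels g)"
  unfolding local_coloring_def
proof (intro conjI allI impI ballI)
  have fl: "flow L g" using g by (simp add: flow_coloring_def)
  fix k t assume k: "k < length (arcs T)" and t: "t \<in> breaks" and "(k, t) \<notin> fst ` dc \<union> snd ` dc"
  then have t1: "-1 < t" "t < 1" and np: "place P (k, t) \<notin> passages L"
    using passage_place_iff[of "(k, t)"] by (auto simp: breaks_def)
  have q: "place P (k, t) \<in> params L" using k t1 by (intro place_in) simp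
  have "\<forall>\<^sub>F s in at_right 0. g (rot (place P (k, t)) s) = g (place P (k, t))"
    using fl q np by (simp add: flow_def)
  then have "exit_value g (place P (k, t)) = g (place P (k, t))" by (rule exit_value_eq)
  then have "val_out \<sigma> (labels g) (k, t) = val_in \<sigma> (labels g) (k, t)"
    using flow_labels[OF fl k, of t] flow_labels_out[OF fl k t1] t1 by simp
  then show "labels g k (piece True t) = labels g k (piece False t)"
    by (cases "\<sigma> k") (simp_all add: val_in_def val_out_def)
next
  have fl: "flow L g" using g by (simp add: flow_coloring_def)
  fix e assume e: "e \<in> orient \<sigma> ` dc"
  obtain p q where pq: "e = (p, q)" by (cases e)
  note o = orient_dc[OF e[unfolded pq]]
  have "(place P p, place P q) \<in> crossings L" using inner_iff[OF e[unfolded pq]] crossings_split(1) by blast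
  then have "fits (kind_at L (place P p, place P q)) (g (place P p)) (exit_value g (place P p)) (g (place P q)) (exit_value g (place P q))"
    using g unfolding flow_coloring_def by blast
  then show "case e of (p, q) \<Rightarrow> fits (picture_kind T (p, q)) (val_in \<sigma> (labels g) p) (val_out \<sigma> (labels g) p)
      (val_in \<sigma> (labels g) q) (val_out \<sigma> (labels g) q)"
    using o by (simp add: pq kind_place crossing_labels[OF fl])
qed

lemma finite_crossings: "finite (crossings L)"
  using L by (simp add: link_diagram_def)

lemma flow_weight_labels:
  assumes lab: "\<And>p. p \<in> tparams T \<Longrightarrow> snd p \<in> breaks \<Longrightarrow>
      g (place P p) = val_in \<sigma> v p \<and> exit_value g (place P p) = val_out \<sigma> v p"
  shows "flow_weight L g =
    (\<Sum>(a, b) \<in> outer. wgt (kind_at L (a, b)) (g a) (exit_value g b)) + local_weight T dc \<sigma> v"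
proof -
  have fin: "finite outer" "finite inner"
    using finite_crossings crossings_split(1) by (metis finite_Un)+
  have inj: "inj_on (map_prod (place P) (place P)) (orient \<sigma> ` dc)"
  proof (rule inj_onI)
    fix e e' assume e: "e \<in> orient \<sigma> ` dc" "e' \<in> orient \<sigma> ` dc"
      and eq: "map_prod (place P) (place P) e = map_prod (place P) (place P) e'"
    obtain p q p' q' where d: "e = (p, q)" "e' = (p', q')" by (metis surj_pair)
    then show "e = e'"
      using eq orient_dc(1,2)[OF e(1)[unfolded d]] orient_dc(1,2)[OF e(2)[unfolded d]] by (simp add: place_inj)
  qed
  have "flow_weight L g = (\<Sum>(a, b) \<in> outer. wgt (kind_at L (a, b)) (g a) (exit_value g b)) +
     (\<Sum>(a, b) \<in> inner. wgt (kind_at L (a, b)) (g a) (exit_value g b))"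
    unfolding flow_weight_def crossings_split(1) by (rule sum.union_disjoint[OF fin crossings_split(2)])
  also have "(\<Sum>(a, b) \<in> inner. wgt (kind_at L (a, b)) (g a) (exit_value g b)) = local_weight T dc \<sigma> v"
    unfolding inner_def local_weight_def sum.reindex[OF inj]
  proof (rule sum.cong[OF refl])
    fix e assume e: "e \<in> orient \<sigma> ` dc"
    obtain p q where pq: "e = (p, q)" by (cases e)
    show "((\<lambda>(a, b). wgt (kind_at L (a, b)) (g a) (exit_value g b)) \<circ> map_prod (place P) (place P)) e =
       (case e of (p, q) \<Rightarrow> wgt (picture_kind T (p, q)) (val_in \<sigma> v p) (val_out \<sigma> v q))"
      using orient_dc[OF e[unfolded pq]] lab by (simp add: pq kind_place)
  qed
  finally show ?thesis .
qed

lemma mem_M: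
  assumes "k < length (arcs T)" "-1 \<le> t" "t \<le> 1"
  shows "place P (k, t) \<in> M \<longleftrightarrow> \<bar>t\<bar> \<le> 1/2"
proof
  assume "place P (k, t) \<in> M"
  then obtain l s where s: "place P (k, t) = place P (l, s)" "l < length (arcs T)" "-1/2 \<le> s" "s \<le> 1/2"
    unfolding M_def by auto
  then have "t = s" using place_inj[of "(k, t)" "(l, s)"] assms by simp
  then show "\<bar>t\<bar> \<le> 1/2" using s by simp
next
  assume "\<bar>t\<bar> \<le> 1/2"
  then have "(k, t) \<in> {..<length (arcs T)} \<times> {-1/2..1/2}" using assms(1) by auto
  then show "place P (k, t) \<in> M" unfolding M_def by (rule imageI)
qed

lemma M_inside: "q \<in> M \<Longrightarrow> pt L q \<in> A"
proof -
  assume "q \<in> M"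
  then have "q \<in> place P ` tparams T" unfolding M_def tparams_def by auto
  then show "pt L q \<in> A" using place_image by blast
qed

text \<open>
  Outside \<open>M\<close> lie the ends of the arcs, whose labels determine the labels inside.
\<close>

lemma flow_coloring_unique:
  assumes det: "determined T dc" and g: "flow_coloring L g" "flow_coloring L g'"
    and eq: "\<And>q. q \<in> params L - M \<Longrightarrow> g q = g' q"
  shows "g = g'"
proof (rule extensionalityI[of _ "params L"])
  have fl: "flow L g" "flow L g'" using g by (auto simp: flow_coloring_def)
  then show "g \<in> extensional (params L)" "g' \<in> extensional (params L)" by (auto simp: flow_def)
  have ends: "labels g k 0 = labels g' k 0 \<and> labels g k 3 = labels g' k 3" if "k < length (arcs T)" for k
    using that eq[of "place P (k, -1)"] eq[of "place P (k, 1)"] mem_M[of k "-1"] mem_M[of k 1]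
      place_in[of "(k, -1)"] place_in[of "(k, 1)"]
    by (simp add: labels_def sample_def)
  then have mids: "labels g k 1 = labels g' k 1 \<and> labels g k 2 = labels g' k 2" if "k < length (arcs T)" for k
    using det flow_coloring_labels[OF g(1)] flow_coloring_labels[OF g(2)] that
    unfolding determined_def by blast
  fix q assume q: "q \<in> params L"
  show "g q = g' q"
  proof (cases "q \<in> M")
    case True
    then obtain k t where kt: "q = place P (k, t)" "k < length (arcs T)" "-1 \<le> t" "t \<le> 1"
      unfolding M_def by auto
    have "labels g k j = labels g' k j" if "j \<le> 3" for j
    proof -
      have "j = 0 \<or> j = 1 \<or> j = 2 \<or> j = 3" using that by auto
      then show ?thesis using ends[OF kt(2)] mids[OF kt(2)] by auto
    qed
    then show ?thesis
      using flow_labels[OF fl(1) kt(2-4)] flow_labels[OF fl(2) kt(2-4)] piece_le kt(1) by (simp add: val_in_def)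
  qed (use eq q in simp)
qed

end

text \<open>
  The two diagrams of a local move.  The directions in which the arcs are traversed are the same in both,
  because they depend on \<open>P\<close> only.
\<close>

locale replacement = occurrence ut ot ub ob \<phi> \<psi> L T dc h P + new: occurrence ut ot ub ob \<phi> \<psi> L' T' dc' h P
  for ut :: "'x::finite \<Rightarrow> 'x \<Rightarrow> 'x"  (infixl "\<triangleright>\<^sub>u" 70)
    and ot :: "'x \<Rightarrow> 'x \<Rightarrow> 'x"  (infixl "\<triangleright>\<^sub>o" 70)
    and ub :: "'x \<Rightarrow> 'x \<Rightarrow> 'x"  (infixl "\<bullet>\<^sub>u" 70)
    and ob :: "'x \<Rightarrow> 'x \<Rightarrow> 'x"  (infixl "\<bullet>\<^sub>o" 70)
    and \<phi> \<psi> :: "'x \<Rightarrow> 'x \<Rightarrow> 'r::comm_ring_1" and L T dc h P L' T' dc' +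
  assumes len: "length (arcs T') = length (arcs T)" and agree: "agree_outside (h ` square) L L'"
begin

lemma params_eq: "params L' = params L"
  using agree by (simp add: agree_outside_def params_def)

lemma tparams_eq: "tparams T' = tparams T"
  by (simp add: tparams_def len)

lemma M_eq: "new.M = M"
  by (simp add: M_def new.M_def len)

lemma A_iff:
  assumes "q \<in> params L"
  shows "pt L' q \<in> A \<longleftrightarrow> pt L q \<in> A"
  using place_image new.place_image assms unfolding tparams_eq params_eq by blast

lemma outside:
  assumes "q \<in> params L" "pt L q \<notin> A"
  shows "pt L' q = pt L q" "q \<in> over L' \<longleftrightarrow> q \<in> over L" "pt L' q \<in> special L' \<longleftrightarrow> pt L q \<in> special L"
proof -
  show pt: "pt L' q = pt L q" and "q \<in> over L' \<longleftrightarrow> q \<in> over L"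
    using agree assms unfolding agree_outside_def A_def by auto
  have "special L - A = special L' - A" using agree by (simp add: agree_outside_def A_def)
  then show "pt L' q \<in> special L' \<longleftrightarrow> pt L q \<in> special L" using assms(2) pt by auto
qed

lemma velocity_outside:
  assumes "q \<in> params L" "pt L q \<notin> A"
  shows "velocity L' q = velocity L q"
proof (rule velocity_eqI)
  have ev: "\<forall>\<^sub>F s in nhds 0. pt L (rot q s) = pt L' (rot q s)"
    using eventually_outside[OF assms] by eventually_elim (use assms in \<open>simp add: outside\<close>)
  have "((\<lambda>s. pt L (rot q s)) has_vector_derivative velocity L q) (at 0) =
     ((\<lambda>s. pt L' (rot q s)) has_vector_derivative velocity L q) (at 0)"
    using eventually_mono[OF ev] eventually_nhds_x_imp_x[OF ev]
    by (intro has_vector_derivative_cong_ev) auto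
  then show "((\<lambda>s. pt L' (rot q s)) has_vector_derivative velocity L q) (at 0)"
    using has_velocity[OF L assms(1)] by simp
qed

lemma outer_eq: "new.outer = outer"
proof -
  have "(a, b) \<in> new.outer \<longleftrightarrow> (a, b) \<in> outer" for a b
  proof (cases "a \<in> params L \<and> b \<in> params L \<and> pt L a \<notin> A \<and> pt L b \<notin> A")
    case True
    then show ?thesis
      by (simp add: outer_def new.outer_def crossings_def params_eq outside velocity_outside)
  next
    case False
    then show ?thesis
      using A_iff[of a] A_iff[of b] by (auto simp: outer_def new.outer_def crossings_def params_eq)
  qed
  then show ?thesis by auto
qed

lemma agree_outside_sym: "agree_outside (h ` square) L' L"
  unfolding agree_outside_def
  using agree outside A_iff params_eq by (auto simp: agree_outside_def A_def)

lemma passages_off_M: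
  assumes "q \<in> params L" "q \<notin> M" "q \<notin> passages L'"
  shows "q \<notin> passages L"
proof (cases "pt L q \<in> A")
  case True
  then obtain k t where kt: "(k, t) \<in> tparams T" "q = place P (k, t)" using place_image assms(1) by force
  then have "t \<notin> breaks" using mem_M[of k t] assms(2) by (auto simp: breaks_def)
  then show ?thesis using breaks_passages[of k t] kt by blast
next
  case False
  then show ?thesis
    using passage_outer_iff[of q] new.passage_outer_iff[of q] assms A_iff[of q] by (simp add: params_eq outer_eq)
qed

text \<open>
  The flow \<open>g\<close> with its labels on \<open>M\<close> replaced by \<open>v\<close>.  If \<open>v\<close> has the same end labels as \<open>g\<close>, then the
  result has the labels \<open>v\<close> on the whole arcs, which extend beyond \<open>M\<close> on both sides.  Continuity can thus
  be checked inside the arcs and outside the closed set \<open>M\<close> separately.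
\<close>

definition glue :: "(nat \<times> complex \<Rightarrow> 'x) \<Rightarrow> (nat \<Rightarrow> nat \<Rightarrow> 'x) \<Rightarrow> nat \<times> complex \<Rightarrow> 'x" where
  "glue g v q = (if q \<in> M then val_in \<sigma> v (inv_into (tparams T) (place P) q) else g q)"

lemma glue_off: "q \<notin> M \<Longrightarrow> glue g v q = g q"
  by (simp add: glue_def)

lemma glue_place:
  assumes g: "flow L g" and ends: "\<And>k. k < length (arcs T) \<Longrightarrow> v k 0 = labels g k 0 \<and> v k 3 = labels g k 3"
    and k: "k < length (arcs T)" and t: "-1 \<le> t" "t \<le> 1"
  shows "glue g v (place P (k, t)) = val_in \<sigma> v (k, t)"
proof (cases "place P (k, t) \<in> M")
  case True
  have "inj_on (place P) (tparams T)" using place_inj by (simp add: inj_on_def)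
  then have "inv_into (tparams T) (place P) (place P (k, t)) = (k, t)" using k t by (intro inv_into_f_f) auto
  then show ?thesis using True by (simp add: glue_def)
next
  case False
  then have "piece (\<sigma> k) t = 0 \<or> piece (\<sigma> k) t = 3" using mem_M[OF k t] by (auto simp: piece_def)
  then show ?thesis using False flow_labels[OF g k t] ends[OF k] by (auto simp: glue_def val_in_def)
qed

text \<open>
  Outside the square neither the crossings nor the colors change; inside, the labels satisfy the conditions
  of the new picture.
\<close>

lemma transfer_flow_coloring:
  assumes tr: "transfers T dc T' dc'" and g: "flow_coloring L g"
  obtains g' where "flow_coloring L' g'" "\<And>q. q \<in> params L - M \<Longrightarrow> g' q = g q"
    "flow_weight L' g' = flow_weight L g"
proof -
  have fl: "flow L g" using g by (simp add: flow_coloring_def)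
  obtain v where v: "local_coloring T' dc' \<sigma> v"
    and ends: "\<And>k. k < length (arcs T) \<Longrightarrow> v k 0 = labels g k 0 \<and> v k 3 = labels g k 3"
    and w: "local_weight T' dc' \<sigma> v = local_weight T dc \<sigma> (labels g)"
    using tr flow_coloring_labels[OF g] unfolding transfers_def by blast
  define g' where "g' = glue g v"
  have off: "g' q = g q" if "q \<notin> M" for q using that by (simp add: g'_def glue_off)
  have on: "g' (place P (k, t)) = val_in \<sigma> v (k, t)" if "k < length (arcs T)" "-1 \<le> t" "t \<le> 1" for k t
    unfolding g'_def using fl ends that by (rule glue_place)
  have near: "\<forall>\<^sub>F s in nhds 0. g' (rot q s) = g (rot q s)" if "q \<notin> M" for q
    using eventually_not_M[OF that] by eventually_elim (rule off)
  have near_left: "\<forall>\<^sub>F s in at_left 0. g' (rot q s) = g (rot q s)"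
    and near_right: "\<forall>\<^sub>F s in at_right 0. g' (rot q s) = g (rot q s)" if "q \<notin> M" for q
    using near[OF that] by (auto simp: eventually_at_filter elim: eventually_mono)
  have M_cases: "\<exists>k t. q = place P (k, t) \<and> k < length (arcs T) \<and> -1 < t \<and> t < 1 \<and> \<bar>t\<bar> \<le> 1/2" if "q \<in> M" for q
    using that unfolding M_def by fastforce
  have lims: "\<forall>\<^sub>F s in at_left 0. g' (rot (place P (k, t)) s) = val_in \<sigma> v (k, t)"
     "\<forall>\<^sub>F s in at_right 0. g' (rot (place P (k, t)) s) = val_out \<sigma> v (k, t)"
    if "k < length (arcs T)" "-1 < t" "t < 1" for k t
    using label_limits[OF on that] that(1) by blast+
  have fl': "flow L' g'"
    unfolding flow_def params_eq
  proof (intro conjI ballI impI)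
    have "M \<subseteq> params L" using place_in unfolding M_def by auto
    then have "g' q = undefined" if "q \<notin> params L" for q
      using off[of q] fl that extensional_arb[of g "params L" q] by (auto simp: flow_def)
    then show "g' \<in> extensional (params L)" by (simp add: extensional_def)
    fix q assume q: "q \<in> params L"
    show "\<forall>\<^sub>F s in at_left 0. g' (rot q s) = g' q"
    proof (cases "q \<in> M")
      case True
      then obtain k t where "q = place P (k, t)" "k < length (arcs T)" "-1 < t" "t < 1" using M_cases by blast
      then show ?thesis using lims(1)[of k t] on[of k t] by simp
    next
      case False
      have "\<forall>\<^sub>F s in at_left 0. g (rot q s) = g q" using fl q by (simp add: flow_def)
      then show ?thesis using near_left[OF False] by eventually_elim (simp add: off[OF False])
    qed
    show "\<exists>v. \<forall>\<^sub>F s in at_right 0. g' (rot q s) = v"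
    proof (cases "q \<in> M")
      case True
      then obtain k t where "q = place P (k, t)" "k < length (arcs T)" "-1 < t" "t < 1" using M_cases by blast
      then show ?thesis using lims(2)[of k t] by blast
    next
      case False
      have "\<forall>\<^sub>F s in at_right 0. g (rot q s) = exit_value g q" using flow_out[OF fl q] .
      then have "\<forall>\<^sub>F s in at_right 0. g' (rot q s) = exit_value g q"
        using near_right[OF False] by eventually_elim simp
      then show ?thesis by blast
    qed
    assume np: "q \<notin> passages L'"
    show "\<forall>\<^sub>F s in at_right 0. g' (rot q s) = g' q"
    proof (cases "q \<in> M")
      case True
      then obtain k t where kt: "q = place P (k, t)" "k < length (arcs T)" "-1 < t" "t < 1" using M_cases by blast
      have "(k, t) \<notin> fst ` dc' \<union> snd ` dc'"
        using new.passage_place_iff[of "(k, t)"] np kt by (simp add: len)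
      then have "v k (piece True t) = v k (piece False t)"
        using v kt piece_flip_iff[of True t] unfolding local_coloring_def by (cases "t \<in> breaks") (auto simp: len)
      then have "val_out \<sigma> v (k, t) = val_in \<sigma> v (k, t)"
        by (cases "\<sigma> k") (simp_all add: val_in_def val_out_def)
      then show ?thesis using lims(2)[of k t] on[of k t] kt by simp
    next
      case False
      have "\<forall>\<^sub>F s in at_right 0. g (rot q s) = g q"
        using fl q passages_off_M[OF q False np] by (simp add: flow_def)
      then show ?thesis using near_right[OF False] by eventually_elim (simp add: off[OF False])
    qed
  qed
  have out_off: "exit_value g' q = exit_value g q" if "q \<in> params L" "q \<notin> M" for q
  proof (rule exit_value_eq)
    show "\<forall>\<^sub>F s in at_right 0. g' (rot q s) = exit_value g q"
      using flow_out[OF fl that(1)] near_right[OF that(2)] by eventually_elim simp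
  qed
  have lab: "g' (place P p) = val_in \<sigma> v p \<and> exit_value g' (place P p) = val_out \<sigma> v p"
    if p: "p \<in> tparams T" "snd p \<in> breaks" for p
  proof -
    obtain k t where kt: "p = (k, t)" "k < length (arcs T)" "-1 < t" "t < 1"
      using p by (cases p) (auto simp: breaks_def)
    then show ?thesis using on[of k t] exit_value_eq[OF lims(2)[of k t]] by simp
  qed
  have outer_data: "kind_at L' (a, b) = kind_at L (a, b) \<and> g' a = g a \<and> g' b = g b \<and> exit_value g' a = exit_value g a \<and> exit_value g' b = exit_value g b"
    if ab: "(a, b) \<in> outer" for a b
  proof -
    have m: "a \<in> params L" "b \<in> params L" "pt L a \<notin> A" "pt L b \<notin> A"
      using ab by (auto simp: outer_def crossings_def)
    then have "a \<notin> M" "b \<notin> M" using M_inside by blast+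
    then show ?thesis using m outside(3)[of a] by (simp add: kind_at_def outside off out_off)
  qed
  have "flow_coloring L' g'"
    unfolding flow_coloring_def
  proof (intro conjI fl' ballI)
    fix c assume "c \<in> crossings L'"
    then have "c \<in> outer \<or> c \<in> new.inner" using new.crossings_split(1) outer_eq by blast
    then show "case c of (a, b) \<Rightarrow> fits (kind_at L' (a, b)) (g' a) (exit_value g' a) (g' b) (exit_value g' b)"
    proof
      assume c: "c \<in> outer"
      obtain a b where ab: "c = (a, b)" by (cases c)
      have "(a, b) \<in> crossings L" using c crossings_split(1) ab by blast
      then have "fits (kind_at L (a, b)) (g a) (exit_value g a) (g b) (exit_value g b)"
        using g unfolding flow_coloring_def by blast
      then show ?thesis using outer_data[of a b] c ab by simp
    next
      assume "c \<in> new.inner"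
      then obtain e where e: "c = map_prod (place P) (place P) e" "e \<in> orient \<sigma> ` dc'"
        unfolding new.inner_def by (rule imageE)
      obtain p q where pq: "e = (p, q)" by (cases e)
      note o = new.orient_dc[OF e(2)[unfolded pq]]
      have "fits (picture_kind T' (p, q)) (val_in \<sigma> v p) (val_out \<sigma> v p) (val_in \<sigma> v q) (val_out \<sigma> v q)"
        using bspec[OF conjunct2[OF v[unfolded local_coloring_def]] e(2)] by (simp add: pq)
      then show ?thesis
        using o lab[of p] lab[of q] by (simp add: e(1) pq new.kind_place tparams_eq)
    qed
  qed
  moreover have "flow_weight L' g' = flow_weight L g"
  proof -
    have "flow_weight L' g' =
      (\<Sum>(a, b) \<in> outer. wgt (kind_at L' (a, b)) (g' a) (exit_value g' b)) + local_weight T' dc' \<sigma> v"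
      using new.flow_weight_labels[of g' v] lab unfolding tparams_eq outer_eq by blast
    also have "(\<Sum>(a, b) \<in> outer. wgt (kind_at L' (a, b)) (g' a) (exit_value g' b)) =
       (\<Sum>(a, b) \<in> outer. wgt (kind_at L (a, b)) (g a) (exit_value g b))"
    proof (rule sum.cong[OF refl])
      fix c assume "c \<in> outer"
      then show "(case c of (a, b) \<Rightarrow> wgt (kind_at L' (a, b)) (g' a) (exit_value g' b)) =
          (case c of (a, b) \<Rightarrow> wgt (kind_at L (a, b)) (g a) (exit_value g b))"
        using outer_data[of "fst c" "snd c"] by (cases c) simp
    qed
    also have "\<dots> + local_weight T' dc' \<sigma> v = flow_weight L g"
      using flow_weight_labels[of g "labels g"] crossing_labels[OF fl] w by simp
    finally show ?thesis .
  qed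
  ultimately show ?thesis using that[of g'] off by blast
qed

end

lemma sum_eq_by_restriction:
  assumes inj: "inj_on R C" "inj_on R C'"
    and 1: "\<And>c. c \<in> C \<Longrightarrow> \<exists>c' \<in> C'. R c' = R c \<and> w' c' = w c"
    and 2: "\<And>c'. c' \<in> C' \<Longrightarrow> \<exists>c \<in> C. R c = R c' \<and> w c = w' c'"
  shows "(\<Sum>c \<in> C. f (w c)) = (\<Sum>c' \<in> C'. f (w' c'))"
proof -
  obtain F where F: "\<And>c. c \<in> C \<Longrightarrow> F c \<in> C' \<and> R (F c) = R c \<and> w' (F c) = w c" using 1 by metis
  have "bij_betw F C C'"
    unfolding bij_betw_def
  proof
    show "inj_on F C"
    proof (rule inj_onI)
      fix c d assume "c \<in> C" "d \<in> C" "F c = F d"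
      then show "c = d" using F inj(1) by (metis inj_onD)
    qed
    show "F ` C = C'"
    proof (intro equalityI subsetI)
      fix c' assume c': "c' \<in> C'"
      then obtain c where "c \<in> C" "R c = R c'" using 2 by blast
      then have "F c = c'" using F c' inj(2) by (metis inj_onD)
      then show "c' \<in> F ` C" using \<open>c \<in> C\<close> by blast
    qed (use F in auto)
  qed
  then have "(\<Sum>c \<in> C. f (w' (F c))) = (\<Sum>c' \<in> C'. f (w' c'))" by (rule sum.reindex_bij_betw)
  moreover have "(\<Sum>c \<in> C. f (w' (F c))) = (\<Sum>c \<in> C. f (w c))" using F by (intro sum.cong) auto
  ultimately show ?thesis by simp
qed

context finite_boltzmann_weight
begin

text \<open>
  Restricting a coloring to the complement of \<open>M\<close> loses nothing, and both diagrams have the same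
  restrictions with the same weights.
\<close>

theorem Phi_local_move:
  assumes move: "local_move T T' L L'"
    and dc: "double_points T dc" "double_points T' dc'" and len: "length (arcs T') = length (arcs T)"
    and tr: "transfers T dc T' dc'" "transfers T' dc' T dc"
    and det: "determined T dc" "determined T' dc'"
  shows "polynomial L = polynomial L'"
proof -
  obtain h P where L: "link_diagram L" "link_diagram L'" and hP: "plane_diffeo h" "occurs T h P L" "occurs T' h P L'"
    "agree_outside (h ` square) L L'"
    using move unfolding local_move_def by blast
  interpret r: replacement ut ot ub ob \<phi> \<psi> L T dc h P L' T' dc'
    using L hP dc len by unfold_locales auto
  interpret s: replacement ut ot ub ob \<phi> \<psi> L' T' dc' h P L T dc
    using L hP dc len r.agree_outside_sym by unfold_locales auto
  define R where "R g = restrict g (params L - r.M)" for g :: "nat \<times> complex \<Rightarrow> 'x"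
  have R_eq: "R g = R g' \<longleftrightarrow> (\<forall>q \<in> params L - r.M. g q = g' q)" for g g'
    unfolding R_def by (metis restrict_apply' restrict_ext)
  have "(\<Sum>g | flow_coloring L g. Poly_Mapping.single (flow_weight L g) (1::int)) =
     (\<Sum>g | flow_coloring L' g. Poly_Mapping.single (flow_weight L' g) 1)"
  proof (rule sum_eq_by_restriction[where R = R and f = "\<lambda>w. Poly_Mapping.single w 1"])
    show "inj_on R {g. flow_coloring L g}"
      using r.flow_coloring_unique[OF det(1)] by (intro inj_onI) (auto simp: R_eq)
    show "inj_on R {g. flow_coloring L' g}"
      using r.new.flow_coloring_unique[OF det(2)] by (intro inj_onI) (auto simp: R_eq r.params_eq r.M_eq)
  next
    fix g assume "g \<in> {g. flow_coloring L g}"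
    then show "\<exists>g' \<in> {g. flow_coloring L' g}. R g' = R g \<and> flow_weight L' g' = flow_weight L g"
      using r.transfer_flow_coloring[OF tr(1), of g] unfolding R_eq by (metis mem_Collect_eq)
  next
    fix g assume "g \<in> {g. flow_coloring L' g}"
    then show "\<exists>g' \<in> {g. flow_coloring L g}. R g' = R g \<and> flow_weight L g' = flow_weight L' g"
      using s.transfer_flow_coloring[OF tr(2), of g] unfolding R_eq r.params_eq r.M_eq by (metis mem_Collect_eq)
  qed
  then show ?thesis by (simp add: Phi_eq_sum_over_flows L)
qed

end

section \<open>Double points of the local pictures\<close>

lemma has_vector_derivative_Complex:
  assumes "(f has_real_derivative f') (at t)" "(g has_real_derivative g') (at t)"
  shows "((\<lambda>t. Complex (f t) (g t)) has_vector_derivative Complex f' g') (at t)"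
proof -
  have "((\<lambda>t. of_real (f t) + \<i> * of_real (g t)) has_vector_derivative of_real f' + \<i> * of_real g') (at t)"
    using assms by (intro has_vector_derivative_add has_vector_derivative_mult_right has_vector_derivative_of_real)
  then show ?thesis by (simp add: complex_eq_iff Complex_eq)
qed

lemma bump_derivative: "(bump has_real_derivative - 4 * t * (1 - t\<^sup>2)) (at t)"
  unfolding bump_def by (auto intro!: derivative_eq_intros simp: field_simps power2_eq_square)

lemma bump_eq_iff:
  assumes "-1 \<le> t" "t \<le> 1"
  shows "bump t = 9/16 \<longleftrightarrow> t = 1/2 \<or> t = -1/2"
proof
  assume "bump t = 9/16"
  then have "(1 - t\<^sup>2)\<^sup>2 = (3/4)\<^sup>2" by (simp add: bump_def power2_eq_square)
  moreover have "0 \<le> 1 - t\<^sup>2" using assms abs_square_le_1[of t] by (simp add: abs_le_iff)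
  ultimately have "1 - t\<^sup>2 = 3/4" by (subst (asm) power2_eq_iff_nonneg) auto
  then have "(t - 1/2) * (t + 1/2) = 0" by (simp add: algebra_simps power2_eq_square)
  then show "t = 1/2 \<or> t = -1/2" by auto
qed (elim disjE; hypsubst; simp add: bump_def power2_eq_square)

text \<open>
  The difference of the two sides is a multiple of \<open>(2 t - 1) (4 t\<^sup>3 + 2 t\<^sup>2 - 7 t - 8)\<close>, and the second
  factor is negative for \<open>0 \<le> t \<le> 1\<close>.
\<close>

lemma bump_graph_iff:
  assumes "-1 \<le> t" "t \<le> 1"
  shows "8 / 9 * bump t = t \<longleftrightarrow> t = 1/2"
proof
  assume eq: "8 / 9 * bump t = t"
  then have "0 \<le> t" by (metis bump_def mult_nonneg_nonneg zero_le_power2 divide_nonneg_nonneg zero_le_numeral)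
  have "(2 * t - 1) * (4 * t ^ 3 + 2 * t\<^sup>2 - 7 * t - 8) = 0"
    using eq by (simp add: bump_def algebra_simps power2_eq_square power3_eq_cube)
  moreover have "4 * t ^ 3 + 2 * t\<^sup>2 - 7 * t - 8 < 0"
  proof -
    have "t ^ 3 \<le> t" "t\<^sup>2 \<le> t"
      using power_decreasing[of 1 3 t] power_decreasing[of 1 2 t] \<open>0 \<le> t\<close> assms by auto
    then show ?thesis using \<open>0 \<le> t\<close> by simp
  qed
  ultimately show "t = 1/2" by auto
next
  assume "t = 1/2"
  then show "8 / 9 * bump t = t" by hypsubst (simp add: bump_def power2_eq_square)
qed

lemma transverseI:
  assumes "(arcs T ! k has_vector_derivative u) (at s)" "(arcs T ! l has_vector_derivative v) (at t)"
    and "0 < det2 u v" "k < length (arcs T)" "l < length (arcs T)" "s \<in> breaks" "t \<in> breaks"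
    and "e = ((k, s), (l, t))"
  shows "case e of (p, q) \<Rightarrow> p \<in> tparams T \<and> q \<in> tparams T \<and> snd p \<in> breaks \<and> snd q \<in> breaks \<and>
        (\<exists>u v. (arcs T ! fst p has_vector_derivative u) (at (snd p)) \<and>
               (arcs T ! fst q has_vector_derivative v) (at (snd q)) \<and> 0 < det2 u v)"
proof -
  have "-1 \<le> s \<and> s \<le> 1" "-1 \<le> t \<and> t \<le> 1" using assms(6,7) by (auto simp: breaks_def)
  then show ?thesis using assms by (simp add: tparams_mem) blast
qed

lemma double_points_plain:
  assumes "arcs T = [plain_arc]"
  shows "double_points T {}"
  using assms by (auto simp: double_points_def picture_pt_def tparams_mem plain_arc_def)

definition kink_crossing :: "((nat \<times> real) \<times> (nat \<times> real)) set" where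
  "kink_crossing = {((0, -1/2), (0, 1/2))}"

lemma double_points_kink:
  assumes "arcs T = [kink_arc]"
  shows "double_points T kink_crossing"
  unfolding double_points_def
proof (intro conjI ballI)
  show "finite kink_crossing" by (simp add: kink_crossing_def)
next
  fix p q assume pq: "p \<in> tparams T" "q \<in> tparams T"
  obtain s t where st: "p = (0, s)" "q = (0, t)" "-1 \<le> s" "s \<le> 1" "-1 \<le> t" "t \<le> 1"
    using pq by (cases p, cases q) (auto simp: tparams_mem assms)
  have "kink_arc s = kink_arc t \<and> s \<noteq> t \<longleftrightarrow> s = -1/2 \<and> t = 1/2 \<or> s = 1/2 \<and> t = -1/2"
  proof
    assume a: "kink_arc s = kink_arc t \<and> s \<noteq> t"
    then have "s\<^sup>2 = t\<^sup>2" by (simp add: kink_arc_def)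
    then have s: "s = - t" using a by (auto simp: power2_eq_iff)
    then have "bump s = bump t" by (simp add: bump_def)
    moreover have "s - 16/9 * s * bump s = t - 16/9 * t * bump t" using a by (simp add: kink_arc_def)
    ultimately have "t * (1 - 16/9 * bump t) = 0" using s by (simp add: algebra_simps)
    moreover have "t \<noteq> 0" using a s by auto
    ultimately have "1 - 16/9 * bump t = 0" using mult_eq_0_iff by blast
    then have "bump t = 9/16" by linarith
    then show "s = -1/2 \<and> t = 1/2 \<or> s = 1/2 \<and> t = -1/2"
      using bump_eq_iff[OF st(5,6)] s by auto
  qed (elim disjE conjE; hypsubst; simp add: kink_arc_def bump_def power2_eq_square)
  then show "(p \<noteq> q \<and> picture_pt T p = picture_pt T q) = ((p, q) \<in> kink_crossing \<or> (q, p) \<in> kink_crossing)"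
    using st by (auto simp: picture_pt_def assms kink_crossing_def)
next
  have arc_eq: "arcs T ! 0 = kink_arc" by (simp add: assms)
  have d: "(kink_arc has_vector_derivative
      Complex (1 - 16/9 * (bump t + t * (- 4 * t * (1 - t\<^sup>2)))) (2 * t)) (at t)" for t
    unfolding kink_arc_def
    by (intro has_vector_derivative_Complex)
       (auto intro!: derivative_eq_intros bump_derivative simp: field_simps)
  fix e assume "e \<in> kink_crossing"
  then have e: "e = ((0, -1/2), (0, 1/2))" by (simp add: kink_crossing_def)
  show "case e of (p, q) \<Rightarrow> p \<in> tparams T \<and> q \<in> tparams T \<and> snd p \<in> breaks \<and> snd q \<in> breaks \<and>
        (\<exists>u v. (arcs T ! fst p has_vector_derivative u) (at (snd p)) \<and>
               (arcs T ! fst q has_vector_derivative v) (at (snd q)) \<and> 0 < det2 u v)"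
    by (rule transverseI[OF _ _ _ _ _ _ _ e, OF d[folded arc_eq] d[folded arc_eq]])
       (simp_all add: assms breaks_def det2_def bump_def power2_eq_square)
qed

lemma nat_less_2: "k < 2 \<longleftrightarrow> k = 0 \<or> k = (1::nat)" by auto
lemma nat_less_3: "k < 3 \<longleftrightarrow> k = 0 \<or> k = 1 \<or> k = (2::nat)" by auto

lemma double_points_apart:
  assumes "arcs T = apart_arcs"
  shows "double_points T {}"
  using assms by (auto simp: double_points_def picture_pt_def tparams_mem apart_arcs_def nat_less_2 less_Suc_eq)

definition bigon_crossings :: "((nat \<times> real) \<times> (nat \<times> real)) set" where
  "bigon_crossings = {((0, -1/2), (1, -1/2)), ((1, 1/2), (0, 1/2))}"

lemma double_points_bigon:
  assumes "arcs T = bigon_arcs"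
  shows "double_points T bigon_crossings"
  unfolding double_points_def
proof (intro conjI ballI)
  show "finite bigon_crossings" by (simp add: bigon_crossings_def)
next
  fix p q assume pq: "p \<in> tparams T" "q \<in> tparams T"
  obtain k s l t where st: "p = (k, s)" "q = (l, t)" "-1 \<le> s" "s \<le> 1" "-1 \<le> t" "t \<le> 1"
    "k = 0 \<or> k = 1" "l = 0 \<or> l = 1"
    using pq by (cases p, cases q) (auto simp: tparams_mem assms bigon_arcs_def less_Suc_eq)
  have "picture_pt T p = picture_pt T q \<longleftrightarrow> s = t \<and> (k = l \<or> bump s = 9/16)"
    using st(7,8) unfolding st(1,2) by (elim disjE) (auto simp: picture_pt_def assms bigon_arcs_def)
  then show "(p \<noteq> q \<and> picture_pt T p = picture_pt T q) = ((p, q) \<in> bigon_crossings \<or> (q, p) \<in> bigon_crossings)"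
    using st(7,8) unfolding st(1,2) bump_eq_iff[OF st(3,4)]
    by (elim disjE) (auto simp: bigon_crossings_def)
next
  have arcs_eq: "arcs T ! 0 = (\<lambda>t. Complex t (9/16 - bump t))" "arcs T ! 1 = (\<lambda>t. Complex t (bump t - 9/16))"
    by (simp_all add: assms bigon_arcs_def)
  have d: "((\<lambda>t. Complex t (9/16 - bump t)) has_vector_derivative Complex 1 (4 * t * (1 - t\<^sup>2))) (at t)"
    "((\<lambda>t. Complex t (bump t - 9/16)) has_vector_derivative Complex 1 (- 4 * t * (1 - t\<^sup>2))) (at t)" for t
    by (intro has_vector_derivative_Complex; auto intro!: derivative_eq_intros bump_derivative)+
  note d = d[folded arcs_eq]
  fix e assume "e \<in> bigon_crossings"
  then consider "e = ((0, -1/2), (1, -1/2))" | "e = ((1, 1/2), (0, 1/2))"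
    by (auto simp: bigon_crossings_def)
  then show "case e of (p, q) \<Rightarrow> p \<in> tparams T \<and> q \<in> tparams T \<and> snd p \<in> breaks \<and> snd q \<in> breaks \<and>
        (\<exists>u v. (arcs T ! fst p has_vector_derivative u) (at (snd p)) \<and>
               (arcs T ! fst q has_vector_derivative v) (at (snd q)) \<and> 0 < det2 u v)"
  proof cases
    case 1
    show ?thesis
      by (rule transverseI[OF _ _ _ _ _ _ _ 1, OF d(1) d(2)])
         (simp_all add: assms bigon_arcs_def breaks_def det2_def power2_eq_square)
  next
    case 2
    show ?thesis
      by (rule transverseI[OF _ _ _ _ _ _ _ 2, OF d(2) d(1)])
         (simp_all add: assms bigon_arcs_def breaks_def det2_def power2_eq_square)
  qed
qed

definition triangle_crossings :: "real \<Rightarrow> ((nat \<times> real) \<times> (nat \<times> real)) set" where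
  "triangle_crossings e = {((1, 0), (0, 0)), ((2, e/2), (0, e/2)), ((1, -e/2), (2, -e/2))}"

lemma double_points_triangle:
  assumes "arcs T = triangle_arcs e" and e: "e = 1 \<or> e = -1"
  shows "double_points T (triangle_crossings e)"
  unfolding double_points_def
proof (intro conjI ballI)
  show "finite (triangle_crossings e)" by (simp add: triangle_crossings_def)
next
  fix p q assume pq: "p \<in> tparams T" "q \<in> tparams T"
  obtain k s l t where st: "p = (k, s)" "q = (l, t)" "-1 \<le> s" "s \<le> 1" "-1 \<le> t" "t \<le> 1"
    "k = 0 \<or> k = 1 \<or> k = 2" "l = 0 \<or> l = 1 \<or> l = 2"
    using pq by (cases p, cases q) (auto simp: tparams_mem assms triangle_arcs_def less_Suc_eq)
  have graph: "e * (8/9) * bump s = s \<longleftrightarrow> s = e/2" if "-1 \<le> s" "s \<le> 1" for s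
  proof -
    have "bump (e * s) = bump s" "e * (8/9) * bump s = s \<longleftrightarrow> 8/9 * bump s = e * s" "e * s = 1/2 \<longleftrightarrow> s = e/2"
      using e by (elim disjE; force simp: bump_def)+
    moreover have "8/9 * bump (e * s) = e * s \<longleftrightarrow> e * s = 1/2"
      using that e by (intro bump_graph_iff) auto
    ultimately show ?thesis by simp
  qed
  have "bump (- s) = bump s" by (simp add: bump_def)
  then have graph': "e * (8/9) * bump s = - s \<longleftrightarrow> s = - e/2" using graph[of "- s"] st(3,4) by auto
  have "picture_pt T p = picture_pt T q \<longleftrightarrow> s = t \<and> (k = l \<or> {k, l} = {0, 1} \<and> s = 0 \<or>
      {k, l} = {0, 2} \<and> e * (8/9) * bump s = s \<or> {k, l} = {1, 2} \<and> e * (8/9) * bump s = - s)"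
    using st(7,8) unfolding st(1,2)
    by (elim disjE) (auto simp: picture_pt_def assms triangle_arcs_def doubleton_eq_iff)
  then show "(p \<noteq> q \<and> picture_pt T p = picture_pt T q) = ((p, q) \<in> triangle_crossings e \<or> (q, p) \<in> triangle_crossings e)"
    using st(7,8) unfolding st(1,2) graph[OF st(3,4)] graph'
    by (elim disjE) (auto simp: triangle_crossings_def doubleton_eq_iff)
next
  have arcs_eq: "arcs T ! 0 = (\<lambda>t. Complex t t)" "arcs T ! 1 = (\<lambda>t. Complex t (- t))"
      "arcs T ! 2 = (\<lambda>t. Complex t (e * (8/9) * bump t))"
    by (simp_all add: assms triangle_arcs_def)
  have d: "((\<lambda>t. Complex t t) has_vector_derivative Complex 1 1) (at t)"
    "((\<lambda>t. Complex t (- t)) has_vector_derivative Complex 1 (- 1)) (at t)"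
    "((\<lambda>t. Complex t (e * (8/9) * bump t)) has_vector_derivative Complex 1 (e * (8/9) * (- 4 * t * (1 - t\<^sup>2)))) (at t)" for t
    by (intro has_vector_derivative_Complex; auto intro!: derivative_eq_intros bump_derivative)+
  note d = d[folded arcs_eq]
  have len: "length (arcs T) = 3" by (simp add: assms triangle_arcs_def)
  have br: "e / 2 \<in> breaks" "- e / 2 \<in> breaks" "0 \<in> breaks" using e by (auto simp: breaks_def)
  fix c assume "c \<in> triangle_crossings e"
  then consider "c = ((1, 0), (0, 0))" | "c = ((2, e/2), (0, e/2))" | "c = ((1, -e/2), (2, -e/2))"
    by (auto simp: triangle_crossings_def)
  then show "case c of (p, q) \<Rightarrow> p \<in> tparams T \<and> q \<in> tparams T \<and> snd p \<in> breaks \<and> snd q \<in> breaks \<and>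
        (\<exists>u v. (arcs T ! fst p has_vector_derivative u) (at (snd p)) \<and>
               (arcs T ! fst q has_vector_derivative v) (at (snd q)) \<and> 0 < det2 u v)"
  proof cases
    case 1
    show ?thesis
      by (rule transverseI[OF _ _ _ _ _ _ _ 1, OF d(2) d(1)]) (use len br in \<open>simp_all add: det2_def\<close>)
  next
    case 2
    show ?thesis
      by (rule transverseI[OF _ _ _ _ _ _ _ 2, OF d(3) d(1)])
         (use len br e in \<open>auto simp add: det2_def power2_eq_square\<close>)
  next
    case 3
    show ?thesis
      by (rule transverseI[OF _ _ _ _ _ _ _ 3, OF d(2) d(3)])
         (use len br e in \<open>auto simp add: det2_def power2_eq_square\<close>)
  qed
qed

section \<open>Kinks and bigons\<close>

lemma piece_at_breaks [simp]:
  "piece b (-1/2) = (if b then 0 else 1)" "piece b (-(1/2)) = (if b then 0 else 1)"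
  "piece b 0 = (if b then 1 else 2)" "piece b (1/2) = (if b then 2 else 3)"
  by (auto simp: piece_def)

text \<open>
  For a double point \<open>(p, q)\<close> with positive determinant the arc of \<open>q\<close> crosses the arc of \<open>p\<close> from right to
  left, and the arc of \<open>p\<close> crosses that of \<open>q\<close> from left to right, as seen in the directions of increasing
  parameters.  The functions \<open>side_p\<close> and \<open>side_q\<close> give the labels of the two arcs next to the double point
  as functions of the side of the other strand; traversing the latter backward exchanges its sides.
\<close>

definition side_p :: "(nat \<Rightarrow> bool) \<Rightarrow> (nat \<Rightarrow> nat \<Rightarrow> 'x) \<Rightarrow> nat \<times> real \<Rightarrow> nat \<times> real \<Rightarrow> bool \<Rightarrow> 'x" where
  "side_p \<sigma> v p q s = v (fst p) (piece (s \<noteq> \<sigma> (fst q)) (snd p))"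

definition side_q :: "(nat \<Rightarrow> bool) \<Rightarrow> (nat \<Rightarrow> nat \<Rightarrow> 'x) \<Rightarrow> nat \<times> real \<Rightarrow> nat \<times> real \<Rightarrow> bool \<Rightarrow> 'x" where
  "side_q \<sigma> v p q s = v (fst q) (piece (s = \<sigma> (fst p)) (snd q))"

context finite_boltzmann_weight
begin

text \<open>
  The crossing type for the strands in the order \<open>(p, q)\<close>.  The kind of a crossing in a diagram refers to
  the order of a negative determinant, which is the other one if both arcs have the same direction.
\<close>

definition pair_kind ::
  "picture \<Rightarrow> (nat \<Rightarrow> bool) \<Rightarrow> nat \<times> real \<Rightarrow> nat \<times> real \<Rightarrow> ('x, 'r) kind" where
  "pair_kind T \<sigma> p q = (if \<sigma> (fst p) = \<sigma> (fst q) then flip (picture_kind T (q, p)) else picture_kind T (p, q))"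

lemma rigid_picture_kind: "rigid (picture_kind T e)"
  by (auto simp: picture_kind_def rigid_classical rigid_singular rigid_flip split: prod.splits)

lemma rigid_pair_kind: "rigid (pair_kind T \<sigma> p q)"
  by (simp add: pair_kind_def rigid_picture_kind rigid_flip)

text \<open>
  In terms of sides the condition at a crossing does not depend on the directions of the arcs.
\<close>

lemma fits_orient:
  "(case orient \<sigma> (p, q) of (a, b) \<Rightarrow>
      fits (picture_kind T (a, b)) (val_in \<sigma> v a) (val_out \<sigma> v a) (val_in \<sigma> v b) (val_out \<sigma> v b)) \<longleftrightarrow>
   face (pair_kind T \<sigma> p q) (side_p \<sigma> v p q) (side_q \<sigma> v p q)"
  by (cases p; cases q; cases "\<sigma> (fst p)"; cases "\<sigma> (fst q)")
     (simp_all add: orient_def pair_kind_def face_def val_in_def val_out_def side_p_def side_q_def)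

lemma wgt_orient:
  "(case orient \<sigma> (p, q) of (a, b) \<Rightarrow> wgt (picture_kind T (a, b)) (val_in \<sigma> v a) (val_out \<sigma> v b)) =
   (if \<sigma> (fst p) = \<sigma> (fst q) then -1 else 1) *
      wgt (pair_kind T \<sigma> p q) (side_p \<sigma> v p q True) (side_q \<sigma> v p q True)"
  by (cases p; cases q; cases "\<sigma> (fst p)"; cases "\<sigma> (fst q)")
     (simp_all add: orient_def pair_kind_def val_in_def val_out_def side_p_def side_q_def)

lemma local_coloring_faces:
  "local_coloring T dc \<sigma> v \<longleftrightarrow>
     (\<forall>k < length (arcs T). \<forall>t \<in> breaks. (k, t) \<notin> fst ` dc \<union> snd ` dc \<longrightarrow> v k (piece True t) = v k (piece False t)) \<and>
     (\<forall>(p, q) \<in> dc. face (pair_kind T \<sigma> p q) (side_p \<sigma> v p q) (side_q \<sigma> v p q))"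
proof -
  have "(\<forall>(a, b) \<in> orient \<sigma> ` dc.
      fits (picture_kind T (a, b)) (val_in \<sigma> v a) (val_out \<sigma> v a) (val_in \<sigma> v b) (val_out \<sigma> v b)) \<longleftrightarrow>
    (\<forall>(p, q) \<in> dc. face (pair_kind T \<sigma> p q) (side_p \<sigma> v p q) (side_q \<sigma> v p q))"
    unfolding ball_simps by (intro ball_cong refl) (simp only: fits_orient split_paired_all prod.case)
  then show ?thesis unfolding local_coloring_def by simp
qed

lemma local_weight_faces:
  assumes "inj_on (orient \<sigma>) dc"
  shows "local_weight T dc \<sigma> v = (\<Sum>(p, q) \<in> dc. (if \<sigma> (fst p) = \<sigma> (fst q) then -1 else 1) *
      wgt (pair_kind T \<sigma> p q) (side_p \<sigma> v p q True) (side_q \<sigma> v p q True))"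
  unfolding local_weight_def sum.reindex[OF assms] o_def
  by (rule sum.cong[OF refl]) (simp only: wgt_orient split_paired_all prod.case)

lemma local_weight_empty: "local_weight T {} \<sigma> v = 0"
  by (simp add: local_weight_def)

lemma local_coloring_plain:
  assumes "arcs T = [plain_arc]"
  shows "local_coloring T {} \<sigma> v \<longleftrightarrow> v 0 0 = v 0 1 \<and> v 0 1 = v 0 2 \<and> v 0 2 = v 0 3"
  by (simp add: local_coloring_faces assms breaks_def)

lemma local_coloring_kink:
  assumes "arcs T = [kink_arc]"
  shows "local_coloring T kink_crossing \<sigma> v \<longleftrightarrow> v 0 1 = v 0 2 \<and>
    face (pair_kind T \<sigma> (0, -1/2) (0, 1/2)) (\<lambda>s. v 0 (if s = \<sigma> 0 then 1 else 0)) (\<lambda>s. v 0 (if s = \<sigma> 0 then 2 else 3))"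
proof -
  have "side_p \<sigma> v (0, -1/2) (0, 1/2) = (\<lambda>s. v 0 (if s = \<sigma> 0 then 1 else 0))"
    "side_q \<sigma> v (0, -1/2) (0, 1/2) = (\<lambda>s. v 0 (if s = \<sigma> 0 then 2 else 3))"
    by (auto simp: side_p_def side_q_def)
  then show ?thesis by (simp add: local_coloring_faces assms breaks_def kink_crossing_def)
qed

lemma local_weight_kink:
  "local_weight T kink_crossing \<sigma> v =
     - wgt (pair_kind T \<sigma> (0, -1/2) (0, 1/2)) (v 0 (if \<sigma> 0 then 1 else 0)) (v 0 (if \<sigma> 0 then 2 else 3))"
  by (subst local_weight_faces) (simp_all add: kink_crossing_def side_p_def side_q_def)

text \<open>
  If the loop lies on the left, its color determines equal colors at the ends; if it lies on the right, the
  colors at the ends agree by \<open>kink_closes\<close>.  The weight is that of a pair of equal colors.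
\<close>

theorem Phi_kink:
  assumes move: "local_move T T' L L'" and T: "arcs T = [plain_arc]" and T': "arcs T' = [kink_arc]"
    and K: "\<And>\<sigma> x. act1 (pair_kind T' \<sigma> (0, -1/2) (0, 1/2)) x x = act2 (pair_kind T' \<sigma> (0, -1/2) (0, 1/2)) x x"
      "\<And>\<sigma> x. wgt (pair_kind T' \<sigma> (0, -1/2) (0, 1/2)) x x = 0"
  shows "polynomial L = polynomial L'"
proof (rule Phi_local_move[OF move double_points_plain[OF T] double_points_kink[OF T']])
  show "length (arcs T') = length (arcs T)" by (simp add: T T')
  define K where "K \<sigma> = pair_kind T' \<sigma> (0, -1/2) (0, 1/2)" for \<sigma> :: "nat \<Rightarrow> bool"
  have rig: "rigid (K \<sigma>)" for \<sigma> by (simp add: K_def rigid_pair_kind)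
  have diag: "act1 (K \<sigma>) x x = act2 (K \<sigma>) x x" "wgt (K \<sigma>) x x = 0" for \<sigma> x
    unfolding K_def by - (rule K)+
  have diag_fits: "fits (K \<sigma>) x (act1 (K \<sigma>) x x) (act1 (K \<sigma>) x x) x" for \<sigma> x
    by (simp add: fits_def diag)
  have loop: "fits (K \<sigma>) x m m y \<Longrightarrow> x = y" for \<sigma> x y m
    by (rule kink_closes[OF rig diag(1)])
  have loc: "local_coloring T' kink_crossing \<sigma> v \<longleftrightarrow> v 0 1 = v 0 2 \<and>
      (if \<sigma> 0 then fits (K \<sigma>) (v 0 1) (v 0 0) (v 0 3) (v 0 2) else fits (K \<sigma>) (v 0 0) (v 0 1) (v 0 2) (v 0 3))" for \<sigma> v
    by (simp add: local_coloring_kink[OF T'] face_def K_def)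
  have closed: "v 0 0 = v 0 3 \<and> v 0 1 = v 0 2 \<and> local_weight T' kink_crossing \<sigma> v = 0"
    if "local_coloring T' kink_crossing \<sigma> v" for \<sigma> v
  proof (cases "\<sigma> 0")
    case True
    then have f: "fits (K \<sigma>) (v 0 1) (v 0 0) (v 0 3) (v 0 2)" and e: "v 0 1 = v 0 2" using that loc by auto
    then have "v 0 0 = v 0 3" by (simp add: fits_def diag)
    then show ?thesis using True e diag(2) by (simp add: local_weight_kink K_def)
  next
    case False
    then have f: "fits (K \<sigma>) (v 0 0) (v 0 1) (v 0 2) (v 0 3)" and e: "v 0 1 = v 0 2" using that loc by auto
    then have "v 0 0 = v 0 3" using loop[of \<sigma> "v 0 0" "v 0 2"] by simp
    then show ?thesis using False e diag(2) by (simp add: local_weight_kink K_def)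
  qed
  show "transfers T {} T' kink_crossing"
    unfolding transfers_def
  proof (intro allI impI)
    fix \<sigma> v assume "local_coloring T {} \<sigma> v"
    then have v: "v 0 0 = v 0 3" by (simp add: local_coloring_plain[OF T])
    have "\<exists>m. if \<sigma> 0 then fits (K \<sigma>) m (v 0 0) (v 0 0) m else fits (K \<sigma>) (v 0 0) m m (v 0 0)"
    proof (cases "\<sigma> 0")
      case True
      obtain a b where f: "fits (K \<sigma>) a (v 0 0) (v 0 0) b" using fits_existence(3)[OF rig] by blast
      then show ?thesis using loop[OF f] True by auto
    next
      case False
      then show ?thesis using diag_fits[of \<sigma> "v 0 0"] by auto
    qed
    then obtain m where m: "if \<sigma> 0 then fits (K \<sigma>) m (v 0 0) (v 0 0) m else fits (K \<sigma>) (v 0 0) m m (v 0 0)" ..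
    define v' where "v' = (\<lambda>(k::nat) j. if j = 1 \<or> j = 2 then m else v k j)"
    have v': "local_coloring T' kink_crossing \<sigma> v'" using m v by (cases "\<sigma> 0") (simp_all add: loc v'_def)
    show "\<exists>v'. local_coloring T' kink_crossing \<sigma> v' \<and> (\<forall>k < length (arcs T). v' k 0 = v k 0 \<and> v' k 3 = v k 3) \<and>
        local_weight T' kink_crossing \<sigma> v' = local_weight T {} \<sigma> v"
      using v' closed[OF v'] by (intro exI[of _ v']) (simp add: v'_def local_weight_empty)
  qed
  show "transfers T' kink_crossing T {}"
    unfolding transfers_def
  proof (intro allI impI)
    fix \<sigma> v assume "local_coloring T' kink_crossing \<sigma> v"
    note c = closed[OF this]
    show "\<exists>v'. local_coloring T {} \<sigma> v' \<and> (\<forall>k < length (arcs T'). v' k 0 = v k 0 \<and> v' k 3 = v k 3) \<and>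
        local_weight T {} \<sigma> v' = local_weight T' kink_crossing \<sigma> v"
      using c by (intro exI[of _ "\<lambda>k j. v k 0"]) (simp add: local_coloring_plain[OF T] T' local_weight_empty)
  qed
  show "determined T {}" by (auto simp: determined_def local_coloring_plain[OF T] T)
  show "determined T' kink_crossing"
    unfolding determined_def
  proof (intro allI impI)
    fix \<sigma> v v' k
    assume v: "local_coloring T' kink_crossing \<sigma> v" "local_coloring T' kink_crossing \<sigma> v'"
      and e: "\<forall>k<length (arcs T'). v k 0 = v' k 0 \<and> v k 3 = v' k 3" and k: "k < length (arcs T')"
    have e0: "v 0 0 = v' 0 0" "v 0 3 = v' 0 3" using e by (simp_all add: T')
    have "v 0 1 = v' 0 1"
    proof (cases "\<sigma> 0")
      case True
      then have "fits (K \<sigma>) (v 0 1) (v 0 0) (v 0 3) (v 0 2)" "fits (K \<sigma>) (v' 0 1) (v' 0 0) (v' 0 3) (v' 0 2)"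
        using v by (auto simp: loc)
      from fits_unique(4)[OF rig this] show ?thesis using e0 by simp
    next
      case False
      then have "fits (K \<sigma>) (v 0 0) (v 0 1) (v 0 2) (v 0 3)" "fits (K \<sigma>) (v' 0 0) (v' 0 1) (v' 0 2) (v' 0 3)"
        using v by (auto simp: loc)
      from fits_unique(1)[OF rig this] show ?thesis using e0 by simp
    qed
    then show "v k 1 = v' k 1 \<and> v k 2 = v' k 2" using k closed[OF v(1)] closed[OF v(2)] by (simp add: T')
  qed
qed

lemma local_coloring_apart:
  assumes "arcs T = apart_arcs"
  shows "local_coloring T {} \<sigma> v \<longleftrightarrow> (\<forall>k < 2. v k 0 = v k 1 \<and> v k 1 = v k 2 \<and> v k 2 = v k 3)"
  by (simp add: local_coloring_faces assms apart_arcs_def breaks_def numeral_2_eq_2)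

text \<open>
  The labels of the two crossings of a bigon: \<open>K1\<close> refers to the arcs in the order (0, 1) at the parameter
  \<open>-1/2\<close> and \<open>K3\<close> to the order (1, 0) at \<open>1/2\<close>, for which the determinants are positive.
\<close>

definition bigon_coloring where
  "bigon_coloring K1 K3 a b v \<longleftrightarrow> v 0 1 = v 0 2 \<and> v 1 1 = v 1 2 \<and>
     face K1 (\<lambda>s. v 0 (if s = b then 1 else 0)) (\<lambda>s. v (Suc 0) (if s = a then 0 else 1)) \<and>
     face K3 (\<lambda>s. v (Suc 0) (if s = a then 3 else 2)) (\<lambda>s. v 0 (if s = b then 2 else (3::nat)))"

definition bigon_weight :: "('x, 'r) kind \<Rightarrow> ('x, 'r) kind \<Rightarrow> bool \<Rightarrow> bool \<Rightarrow> (nat \<Rightarrow> nat \<Rightarrow> 'x) \<Rightarrow> 'r" where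
  "bigon_weight K1 K3 a b v = (if a = b then -1 else 1) *
     (wgt K1 (v 0 (if b then 1 else 0)) (v 1 (if a then 0 else 1)) +
      wgt K3 (v 1 (if a then 3 else 2)) (v 0 (if b then 2 else 3)))"

lemma local_coloring_bigon:
  assumes "arcs T = bigon_arcs"
  shows "local_coloring T bigon_crossings \<sigma> v \<longleftrightarrow>
    bigon_coloring (pair_kind T \<sigma> (0, -1/2) (1, -1/2)) (pair_kind T \<sigma> (1, 1/2) (0, 1/2)) (\<sigma> 0) (\<sigma> 1) v"
proof -
  have "side_p \<sigma> v (0, -1/2) (1, -1/2) = (\<lambda>s. v 0 (if s = \<sigma> 1 then 1 else 0))"
    "side_q \<sigma> v (0, -1/2) (1, -1/2) = (\<lambda>s. v 1 (if s = \<sigma> 0 then 0 else 1))"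
    "side_p \<sigma> v (1, 1/2) (0, 1/2) = (\<lambda>s. v 1 (if s = \<sigma> 0 then 3 else 2))"
    "side_q \<sigma> v (1, 1/2) (0, 1/2) = (\<lambda>s. v 0 (if s = \<sigma> 1 then 2 else 3))"
    by (auto simp: side_p_def side_q_def)
  moreover have "length (arcs T) = 2" by (simp add: assms bigon_arcs_def)
  ultimately show ?thesis
    by (auto simp: local_coloring_faces breaks_def bigon_crossings_def bigon_coloring_def nat_less_2)
qed

lemma inj_orient_bigon: "inj_on (orient \<sigma>) bigon_crossings"
  by (auto simp: inj_on_def orient_def bigon_crossings_def)

lemma local_weight_bigon:
  "local_weight T bigon_crossings \<sigma> v =
    bigon_weight (pair_kind T \<sigma> (0, -1/2) (1, -1/2)) (pair_kind T \<sigma> (1, 1/2) (0, 1/2)) (\<sigma> 0) (\<sigma> 1) v"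
  by (subst local_weight_faces[OF inj_orient_bigon])
     (auto simp: bigon_crossings_def side_p_def side_q_def bigon_weight_def)

lemma bigon_coloring_unique:
  assumes "rigid K1" "bigon_coloring K1 K3 a b v" "bigon_coloring K1 K3 a b v'"
    and "v 0 0 = v' 0 0" "v 1 0 = v' 1 0"
  shows "v 0 1 = v' 0 1" "v 1 1 = v' 1 1"
proof -
  note r = rigidD[of K1 "\<lambda>s. v 0 (if s = b then 1 else 0)" "\<lambda>s. v 1 (if s = a then 0 else 1)"
      "\<lambda>s. v' 0 (if s = b then 1 else 0)" "\<lambda>s. v' 1 (if s = a then 0 else 1)" "\<not> b" a]
  show "v 0 1 = v' 0 1"
    using fun_cong[OF r(1), of b] assms by (simp add: bigon_coloring_def)
  show "v 1 1 = v' 1 1"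
    using fun_cong[OF r(2), of "\<not> a"] assms by (simp add: bigon_coloring_def)
qed

lemma determined_bigon:
  assumes "arcs T = bigon_arcs"
  shows "determined T bigon_crossings"
  unfolding determined_def
proof (intro allI impI)
  fix \<sigma> v v' k
  assume v: "local_coloring T bigon_crossings \<sigma> v" "local_coloring T bigon_crossings \<sigma> v'"
    and e: "\<forall>k<length (arcs T). v k 0 = v' k 0 \<and> v k 3 = v' k 3" and k: "k < length (arcs T)"
  have len: "length (arcs T) = 2" by (simp add: assms bigon_arcs_def)
  have e0: "v 0 0 = v' 0 0" "v 1 0 = v' 1 0" using e by (simp_all add: len)
  note v = v[unfolded local_coloring_bigon[OF assms]]
  have "v 0 1 = v' 0 1" "v 1 1 = v' 1 1"
    using bigon_coloring_unique[OF rigid_pair_kind v e0] by auto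
  moreover have "v 0 2 = v 0 1" "v 1 2 = v 1 1" "v' 0 2 = v' 0 1" "v' 1 2 = v' 1 1"
    using v by (auto simp: bigon_coloring_def)
  ultimately show "v k 1 = v' k 1 \<and> v k 2 = v' k 2" using k by (auto simp: len nat_less_2)
qed

definition with_mids :: "(nat \<Rightarrow> nat \<Rightarrow> 'x) \<Rightarrow> 'x \<Rightarrow> 'x \<Rightarrow> nat \<Rightarrow> nat \<Rightarrow> 'x" where
  "with_mids v x y = (\<lambda>k j. if j = 1 \<or> j = 2 then (if k = 0 then x else y) else v k j)"

text \<open>
  Both crossings impose the same condition, and they share the two inner semiarcs, which are adjacent.
  Hence the outer colors before and after the bigon agree, and the inner ones can be filled in.
\<close>

theorem Phi_bigon:
  assumes move: "local_move T T' L L'" and T: "arcs T = apart_arcs" and T': "arcs T' = bigon_arcs"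
    and K: "\<And>\<sigma>. pair_kind T' \<sigma> (1, 1/2) (0, 1/2) = flip (pair_kind T' \<sigma> (0, -1/2) (1, -1/2))"
  shows "polynomial L = polynomial L'"
proof (rule Phi_local_move[OF move double_points_apart[OF T] double_points_bigon[OF T']])
  have len: "length (arcs T) = 2" "length (arcs T') = 2" by (simp_all add: T T' apart_arcs_def bigon_arcs_def)
  then show "length (arcs T') = length (arcs T)" by simp
  show "determined T' bigon_crossings" by (rule determined_bigon[OF T'])
  show "determined T {}" by (auto simp: determined_def local_coloring_apart[OF T] len)
  define K1 where "K1 \<sigma> = pair_kind T' \<sigma> (0, -1/2) (1, -1/2)" for \<sigma> :: "nat \<Rightarrow> bool"
  have rig: "rigid (K1 \<sigma>)" for \<sigma> by (simp add: K1_def rigid_pair_kind)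
  have loc: "local_coloring T' bigon_crossings \<sigma> v \<longleftrightarrow> bigon_coloring (K1 \<sigma>) (flip (K1 \<sigma>)) (\<sigma> 0) (\<sigma> 1) v"
    and wt: "local_weight T' bigon_crossings \<sigma> v = bigon_weight (K1 \<sigma>) (flip (K1 \<sigma>)) (\<sigma> 0) (\<sigma> 1) v" for \<sigma> v
    unfolding local_coloring_bigon[OF T'] local_weight_bigon K K1_def by - (rule refl)+
  have closed: "v 0 0 = v 0 3 \<and> v 1 0 = v 1 3 \<and> bigon_weight K (flip K) a b v = 0"
    if c: "bigon_coloring K (flip K) a b v" and K: "rigid K" for a b v K
  proof -
    let ?X = "\<lambda>s. v 0 (if s = b then 1 else 0)" and ?Y = "\<lambda>s. v 1 (if s = a then 0 else 1)"
    let ?X' = "\<lambda>s. v 0 (if s = b then 2 else 3)" and ?Y' = "\<lambda>s. v 1 (if s = a then 3 else 2)"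
    have f: "face K ?X ?Y" "face K ?X' ?Y'" "v 0 1 = v 0 2" "v 1 1 = v 1 2"
      using c by (simp_all add: bigon_coloring_def)
    have eq: "?X = ?X'" "?Y = ?Y'"
      using rigidD[OF K f(1,2), of b "\<not> a"] f(3,4) by simp_all
    show ?thesis
      using fun_cong[OF eq(1), of "\<not> b"] fun_cong[OF eq(2), of a] f(3,4)
      by (auto simp: bigon_weight_def)
  qed
  show "transfers T {} T' bigon_crossings"
    unfolding transfers_def
  proof (intro allI impI)
    fix \<sigma> v assume "local_coloring T {} \<sigma> v"
    then have v: "v 0 0 = v 0 3" "v 1 0 = v 1 3" by (simp_all add: local_coloring_apart[OF T])
    obtain p q where pq: "face (K1 \<sigma>) p q" "p (\<not> \<sigma> 1) = v 0 0" "q (\<sigma> 0) = v 1 0"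
      using face_exists[OF rig] by blast
    define v' where "v' = with_mids v (p (\<sigma> 1)) (q (\<not> \<sigma> 0))"
    have "(\<lambda>s. v' 0 (if s = \<sigma> 1 then 1 else 0)) = p" "(\<lambda>s. v' 1 (if s = \<sigma> 0 then 0 else 1)) = q"
      "(\<lambda>s. v' 0 (if s = \<sigma> 1 then 2 else 3)) = p" "(\<lambda>s. v' 1 (if s = \<sigma> 0 then 3 else 2)) = q"
      using pq v by (auto simp: v'_def with_mids_def)
    then have c: "bigon_coloring (K1 \<sigma>) (flip (K1 \<sigma>)) (\<sigma> 0) (\<sigma> 1) v'"
      using pq(1) by (simp add: bigon_coloring_def) (simp add: v'_def with_mids_def)
    show "\<exists>v'. local_coloring T' bigon_crossings \<sigma> v' \<and> (\<forall>k < length (arcs T). v' k 0 = v k 0 \<and> v' k 3 = v k 3) \<and>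
        local_weight T' bigon_crossings \<sigma> v' = local_weight T {} \<sigma> v"
      using c closed[OF c rig] by (intro exI[of _ v']) (simp add: loc wt local_weight_empty, simp add: v'_def with_mids_def)
  qed
  show "transfers T' bigon_crossings T {}"
    unfolding transfers_def
  proof (intro allI impI)
    fix \<sigma> v assume "local_coloring T' bigon_crossings \<sigma> v"
    note c = closed[OF this[unfolded loc] rig]
    show "\<exists>v'. local_coloring T {} \<sigma> v' \<and> (\<forall>k < length (arcs T'). v' k 0 = v k 0 \<and> v' k 3 = v k 3) \<and>
        local_weight T {} \<sigma> v' = local_weight T' bigon_crossings \<sigma> v"
      using c by (intro exI[of _ "\<lambda>k j. v k 0"])
        (auto simp: local_coloring_apart[OF T] len wt local_weight_empty nat_less_2)
  qed
qed

lemma bigon_coloring_with_mids: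
  "bigon_coloring K1 K3 a b (with_mids v x y) \<longleftrightarrow>
     face K1 (\<lambda>s. if s = b then x else v 0 0) (\<lambda>s. if s = a then v 1 0 else y) \<and>
     face K3 (\<lambda>s. if s = a then v 1 3 else y) (\<lambda>s. if s = b then x else v 0 3)"
proof -
  have "(\<lambda>s. with_mids v x y 0 (if s = b then 1 else 0)) = (\<lambda>s. if s = b then x else v 0 0)"
    "(\<lambda>s. with_mids v x y (Suc 0) (if s = a then 0 else 1)) = (\<lambda>s. if s = a then v 1 0 else y)"
    "(\<lambda>s. with_mids v x y (Suc 0) (if s = a then 3 else 2)) = (\<lambda>s. if s = a then v 1 3 else y)"
    "(\<lambda>s. with_mids v x y 0 (if s = b then 2 else 3)) = (\<lambda>s. if s = b then x else v 0 3)"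
    by (auto simp: with_mids_def)
  then show ?thesis unfolding bigon_coloring_def by (simp only:) (simp add: with_mids_def)
qed

text \<open>
  Exchanging two crossings on a bigon, for parallel strands, for antiparallel strands with the bigon on the
  right, and with the bigon on the left of both crossings.
\<close>

definition exchangeable :: "('x, 'r) kind \<Rightarrow> ('x, 'r) kind \<Rightarrow> bool" where
  "exchangeable J K \<longleftrightarrow>
     (\<forall>ul ur lr ll l r. fits J ul r ur l \<longrightarrow> fits K l lr r ll \<longrightarrow>
        (\<exists>l' r'. fits K ul r' ur l' \<and> fits J l' lr r' ll \<and>
           wgt K ul l' + wgt J l' ll = wgt J ul l + wgt K l ll)) \<and>
     (\<forall>a b c d u v. fits J a v u b \<longrightarrow> fits K c u v d \<longrightarrow>
        (\<exists>p q. fits K a q p b \<and> fits J c p q d \<and> wgt K a b + wgt J c d = wgt J a b + wgt K c d)) \<and>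
     (\<forall>a b u v r l. fits J a v u b \<longrightarrow> fits K b r l a \<longrightarrow>
        (\<exists>a' b'. fits K a' v u b' \<and> fits J b' r l a' \<and>
           wgt K a' b' + wgt J b' a' = wgt J a b + wgt K b a))"

lemma exchangeable_singular:
  assumes "is_classical K"
  shows "exchangeable singular K" "exchangeable K singular"
proof -
  note par = parallel_twist[OF assms] and left = antiparallel_twist_left[OF assms]
  show "exchangeable singular K"
    unfolding exchangeable_def kind_simps
  proof (intro conjI allI impI)
    fix ul ur lr ll l r assume "fits singular ul r ur l" "fits K l lr r ll"
    then show "\<exists>l' r'. fits K ul r' ur l' \<and> fits singular l' lr r' ll \<and>
        wgt K ul l' + \<psi> l' ll = \<psi> ul l + wgt K l ll"
      using par[of ul ur lr ll "\<psi> ul l + wgt K l ll"] by metis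
  next
    fix a b c d u v assume "fits singular a v u b" "fits K c u v d"
    from antiparallel_twist_right[OF assms this]
    show "\<exists>p q. fits K a q p b \<and> fits singular c p q d \<and> wgt K a b + \<psi> c d = \<psi> a b + wgt K c d"
      by metis
  next
    fix a b u v r l assume "fits singular a v u b" "fits K b r l a"
    then show "\<exists>a' b'. fits K a' v u b' \<and> fits singular b' r l a' \<and>
        wgt K a' b' + \<psi> b' a' = \<psi> a b + wgt K b a"
      using left[of v u r l "\<psi> a b + wgt K b a"] by metis
  qed
  show "exchangeable K singular"
    unfolding exchangeable_def kind_simps
  proof (intro conjI allI impI)
    fix ul ur lr ll l r assume "fits K ul r ur l" "fits singular l lr r ll"
    then show "\<exists>l' r'. fits singular ul r' ur l' \<and> fits K l' lr r' ll \<and>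
        \<psi> ul l' + wgt K l' ll = wgt K ul l + \<psi> l ll"
      using par[of ul ur lr ll "wgt K ul l + \<psi> l ll"] by metis
  next
    fix a b c d u v assume "fits K a v u b" "fits singular c u v d"
    from antiparallel_twist_right[OF assms this(2,1)]
    show "\<exists>p q. fits singular a q p b \<and> fits K c p q d \<and> \<psi> a b + wgt K c d = wgt K a b + \<psi> c d"
      by (metis add.commute)
  next
    fix a b u v r l assume "fits K a v u b" "fits singular b r l a"
    then show "\<exists>a' b'. fits singular a' v u b' \<and> fits K b' r l a' \<and>
        \<psi> a' b' + wgt K b' a' = wgt K a b + \<psi> b a"
      using left[of v u r l "wgt K a b + \<psi> b a"] by metis
  qed
qed

text \<open>
  The four cases are the directions of the two arcs.
\<close>

lemma bigon_exchange:
  fixes a b :: bool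
  defines "F \<equiv> (\<lambda>K. if a = b then flip K else K)"
  assumes ex: "exchangeable J K" "exchangeable K J" and c: "bigon_coloring (F J) (F K) a b v"
  shows "\<exists>x y. bigon_coloring (F K) (F J) a b (with_mids v x y) \<and>
        bigon_weight (F K) (F J) a b (with_mids v x y) = bigon_weight (F J) (F K) a b v"
proof -
  note result = bigon_coloring_with_mids F_def face_def bigon_weight_def with_mids_def bigon_coloring_def add.commute
  show ?thesis
  proof (cases a; cases b)
    assume ab: a b
    have "fits J (v 1 0) (v 1 1) (v 0 0) (v 0 1)" "fits K (v 0 1) (v 0 3) (v 1 1) (v 1 3)"
      using c ab by (auto simp: bigon_coloring_def F_def face_def)
    then obtain l r where "fits K (v 1 0) r (v 0 0) l" "fits J l (v 0 3) r (v 1 3)"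
        "wgt K (v 1 0) l + wgt J l (v 1 3) = wgt J (v 1 0) (v 0 1) + wgt K (v 0 1) (v 1 3)"
      using ex(1) unfolding exchangeable_def by blast
    then show ?thesis using ab c by - (rule exI[of _ l], rule exI[of _ r], simp add: result)
  next
    assume ab: "\<not> a" "\<not> b"
    have "fits K (v 0 3) (v 0 1) (v 1 3) (v 1 1)" "fits J (v 1 1) (v 1 0) (v 0 1) (v 0 0)"
      using c ab by (auto simp: bigon_coloring_def F_def face_def)
    then obtain l r where "fits J (v 0 3) r (v 1 3) l" "fits K l (v 1 0) r (v 0 0)"
        "wgt J (v 0 3) l + wgt K l (v 0 0) = wgt K (v 0 3) (v 1 1) + wgt J (v 1 1) (v 0 0)"
      using ex(2) unfolding exchangeable_def by blast
    then show ?thesis using ab c by - (rule exI[of _ r], rule exI[of _ l], simp add: result)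
  next
    assume ab: a "\<not> b"
    have "fits J (v 0 0) (v 0 1) (v 1 1) (v 1 0)" "fits K (v 1 3) (v 1 1) (v 0 1) (v 0 3)"
      using c ab by (auto simp: bigon_coloring_def F_def face_def)
    then obtain p q where "fits K (v 0 0) q p (v 1 0)" "fits J (v 1 3) p q (v 0 3)"
      "wgt K (v 0 0) (v 1 0) + wgt J (v 1 3) (v 0 3) = wgt J (v 0 0) (v 1 0) + wgt K (v 1 3) (v 0 3)"
      using ex(1) unfolding exchangeable_def by blast
    then show ?thesis using ab c by - (rule exI[of _ q], rule exI[of _ p], simp add: result)
  next
    assume ab: "\<not> a" b
    have "fits J (v 0 1) (v 0 0) (v 1 0) (v 1 1)" "fits K (v 1 1) (v 1 3) (v 0 3) (v 0 1)"
      using c ab by (auto simp: bigon_coloring_def F_def face_def)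
    then obtain x y where "fits K x (v 0 0) (v 1 0) y" "fits J y (v 1 3) (v 0 3) x"
        "wgt K x y + wgt J y x = wgt J (v 0 1) (v 1 1) + wgt K (v 1 1) (v 0 1)"
      using ex(1) unfolding exchangeable_def by blast
    then show ?thesis using ab c by - (rule exI[of _ x], rule exI[of _ y], simp add: result)
  qed
qed

end

section \<open>Triangles\<close>

context finite_boltzmann_weight
begin

text \<open>
  The type of the crossing of two strands at the heights \<open>m\<close> and \<open>n\<close>: in \<open>classical\<close> the first strand is the
  lower one.
\<close>

definition layer_kind :: "nat \<Rightarrow> nat \<Rightarrow> ('x, 'r) kind" where
  "layer_kind m n = (if m < n then classical else flip classical)"

lemma layer_kind_flip: "m \<noteq> n \<Longrightarrow> flip (layer_kind m n) = layer_kind n m"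
  by (auto simp: layer_kind_def)

lemma compatible_layers:
  assumes "distinct [a, b, c]"
  shows "compatible (layer_kind a b) (layer_kind a c) (layer_kind b c)"
proof -
  have 1: "compatible (layer_kind a b) (layer_kind a c) (layer_kind b c)" if "a < b" "b < c" for a b c
    using that compatible_classical by (simp add: layer_kind_def)
  have 2: "compatible (layer_kind a b) (layer_kind a c) (layer_kind b c)" if "a \<noteq> b" "a < c" "b < c" for a b c
  proof (cases "a < b")
    case False
    then show ?thesis using compatible_swap01[OF 1[of b a c]] that by (simp add: layer_kind_flip)
  qed (use 1 that in auto)
  have 3: "compatible (layer_kind a b) (layer_kind a c) (layer_kind b c)" if "distinct [a, b, c]" "a < b \<or> a < c" for a b c
  proof (cases "b < c")
    case True
    then show ?thesis using 2[of a b c] that by auto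
  next
    case False
    then have "compatible (layer_kind a c) (layer_kind a b) (layer_kind c b)" using 2[of a c b] that by auto
    from compatible_swap12[OF this] show ?thesis using that by (simp add: layer_kind_flip)
  qed
  show ?thesis
  proof (cases "a < b \<or> a < c")
    case False
    then have "compatible (layer_kind b a) (layer_kind b c) (layer_kind a c)" using 3[of b a c] assms by auto
    from compatible_swap01[OF this] show ?thesis using assms by (simp add: layer_kind_flip)
  qed (use 3 assms in auto)
qed

text \<open>
  The strands 0 and 1 cross at the special crossing, and strand 2 passes over both or under both.
\<close>

lemma compatible_special:
  assumes "K = singular \<or> K = flip singular" and "m \<noteq> n"
  shows "compatible K (layer_kind m n) (layer_kind m n)"
proof -
  have "compatible singular (layer_kind m n) (layer_kind m n)"
  proof (cases "m < n")
    case True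
    then show ?thesis using compatible_strand_over by (simp add: layer_kind_def)
  next
    case False
    have "compatible singular (flip classical) (flip classical)"
      using compatible_swap12[OF compatible_swap01[OF compatible_strand_under]] by simp
    then show ?thesis using False by (simp add: layer_kind_def)
  qed
  then show ?thesis using compatible_swap01[of singular] assms by auto
qed

text \<open>
  Since the only other parameter at the crossing is that of the other strand, the heights of the two strands
  decide which of them is over.
\<close>

lemma layered_pair_kind:
  assumes dp: "double_points (layered as ht S) dc" and pq: "(p, q) \<in> dc"
    and only: "\<And>r. (p, r) \<in> dc \<or> (r, p) \<in> dc \<Longrightarrow> r = q" "\<And>r. (q, r) \<in> dc \<or> (r, q) \<in> dc \<Longrightarrow> r = p"
    and ht: "ht ! fst p \<noteq> ht ! fst q" and S: "picture_pt (layered as ht S) p \<notin> S"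
  shows "pair_kind (layered as ht S) \<sigma> p q = layer_kind (ht ! fst p) (ht ! fst q)"
proof -
  let ?T = "layered as ht S"
  have mem: "p \<in> tparams ?T" "q \<in> tparams ?T" and eq: "picture_pt ?T p = picture_pt ?T q" and ne: "p \<noteq> q"
    using dp pq unfolding double_points_def by fast+
  have over: "x \<in> tover ?T \<longleftrightarrow> ht ! fst y < ht ! fst x"
    if x: "x \<in> tparams ?T" "y \<in> tparams ?T" "picture_pt ?T x = picture_pt ?T y" "x \<noteq> y" "picture_pt ?T x \<notin> S"
      and o: "\<And>r. (x, r) \<in> dc \<or> (r, x) \<in> dc \<Longrightarrow> r = y" for x y
  proof
    assume a: "x \<in> tover ?T"
    then obtain l t' where l: "l < length as" "t' \<in> {-1..1}" "(as ! l) t' = picture_pt ?T x" "ht ! l < ht ! fst x"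
      by (cases x) (auto simp: layered_def picture_pt_def)
    then have r: "(l, t') \<in> tparams ?T" "picture_pt ?T (l, t') = picture_pt ?T x" "(l, t') \<noteq> x"
      by (auto simp: tparams_mem picture_pt_def layered_def)
    then have "(x, (l, t')) \<in> dc \<or> ((l, t'), x) \<in> dc" using dp x(1) unfolding double_points_def by metis
    then have "(l, t') = y" by (rule o)
    then show "ht ! fst y < ht ! fst x" using l(4) by auto
  next
    assume "ht ! fst y < ht ! fst x"
    then show "x \<in> tover ?T"
      using x by (cases x; cases y) (force simp: layered_def picture_pt_def tparams_def)
  qed
  have "p \<in> tover ?T \<longleftrightarrow> ht ! fst q < ht ! fst p" "q \<in> tover ?T \<longleftrightarrow> ht ! fst p < ht ! fst q"
    using over[OF mem eq ne S only(1)] over[OF mem(2,1) eq[symmetric] ne[symmetric] _ only(2)] S eq by auto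
  moreover have "tspecial ?T = S" by (simp add: layered_def)
  ultimately show ?thesis
    using S eq ht by (auto simp: pair_kind_def picture_kind_def layer_kind_def)
qed

lemma special_pair_kind:
  assumes "picture_pt T p \<in> tspecial T" "picture_pt T q = picture_pt T p"
  shows "pair_kind T \<sigma> p q = (if \<sigma> (fst p) = \<sigma> (fst q) then flip singular else singular)"
  using assms by (simp add: pair_kind_def picture_kind_def)

end

text \<open>
  The conditions at the three crossings of the triangle above the origin.  The arguments \<open>a\<close>, \<open>b\<close>, \<open>c\<close> are the
  directions of the arcs 0, 1, 2.
\<close>

definition upper_triangle where
  "upper_triangle K01 K02 K12 a b c v \<longleftrightarrow>
     v 0 0 = v 0 1 \<and> v (Suc 0) 2 = v (Suc 0) 3 \<and> v 2 1 = v 2 2 \<and>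
     face K01 (\<lambda>s. v 0 (if s = b then 1 else 2)) (\<lambda>s. v (Suc 0) (if s = a then 2 else 1)) \<and>
     face K02 (\<lambda>s. v 0 (if s = c then 2 else 3)) (\<lambda>s. v 2 (if s = a then 3 else 2)) \<and>
     face K12 (\<lambda>s. v (Suc 0) (if s = c then 1 else 0)) (\<lambda>s. v (2::nat) (if s = b then 0 else (1::nat)))"

definition sign :: "bool \<Rightarrow> bool \<Rightarrow> 'r::comm_ring_1" where
  "sign a b = (if a = b then 1 else - 1)"

definition upper_weight where
  "upper_weight K01 K02 K12 a b c v =
     sign a b * wgt K01 (v 0 (if b then 1 else 2)) (v (Suc 0) (if a then 2 else 1)) +
     sign a c * wgt K02 (v 0 (if c then 2 else 3)) (v 2 (if a then 3 else 2)) -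
     sign b c * wgt K12 (v (Suc 0) (if c then 1 else 0)) (v (2::nat) (if b then 0 else (1::nat)))"

text \<open>
  The labels of the triangle that shows the three faces of the cube at the vertex \<open>(\<not> a, \<not> b, c)\<close>.
\<close>

definition upper_section where
  "upper_section X Y Z a b c k j =
     (if k = (0::nat) then (if j \<le> (1::nat) then X b c else if j = 2 then X (\<not> b) c else X (\<not> b) (\<not> c))
      else if k = 1 then (if j = 0 then Y (\<not> a) (\<not> c) else if j = 1 then Y (\<not> a) c else Y a c)
      else (if j = 0 then Z (\<not> a) b else if j \<le> 2 then Z (\<not> a) (\<not> b) else Z a (\<not> b)))"

lemma cube_section:
  assumes "cube_coloring K01 K02 K12 X Y Z"
  shows "upper_triangle K01 K02 K12 a b c (upper_section X Y Z a b c)"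
proof -
  have "face K01 (\<lambda>t. X t c) (\<lambda>t. Y t c)" "face K02 (X (\<not> b)) (\<lambda>t. Z t (\<not> b))" "face K12 (Y (\<not> a)) (Z (\<not> a))"
    using assms by (auto simp: cube_coloring_def)
  then show ?thesis
    by (cases a; cases b; cases c) (simp_all add: upper_triangle_def upper_section_def face_def)
qed

text \<open>
  Negating all directions passes to the opposite vertex of the cube.  The signs of the three crossings are
  such that the difference of the two weights is the alternating sum over all faces, up to sign.
\<close>

lemma opposite_sections_weight:
  assumes comp: "compatible K01 K02 K12" and c: "cube_coloring K01 K02 K12 X Y Z"
  shows "upper_weight K01 K02 K12 (\<not> a) (\<not> b) (\<not> c) (upper_section X Y Z (\<not> a) (\<not> b) (\<not> c)) =
     upper_weight K01 K02 K12 a b c (upper_section X Y Z a b c)"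
proof -
  have "wgt K01 (X True True) (Y True True) - wgt K01 (X True False) (Y True False) +
      (wgt K12 (Y True True) (Z True True) - wgt K12 (Y False True) (Z False True)) =
      wgt K02 (X True True) (Z True True) - wgt K02 (X False True) (Z True False)"
    using comp c unfolding compatible_def by blast
  then have "wgt K01 (X True True) (Y True True) =
     wgt K01 (X True False) (Y True False) - (wgt K12 (Y True True) (Z True True) - wgt K12 (Y False True) (Z False True))
     + (wgt K02 (X True True) (Z True True) - wgt K02 (X False True) (Z True False))"
    by (simp add: algebra_simps)
  then show ?thesis
    by (cases a; cases b; cases c) (simp_all add: upper_weight_def upper_section_def sign_def)
qed

lemma upper_triangle_extends:
  fixes K01 K02 K12 :: "('x::finite, 'r::comm_ring_1) kind"
  assumes comp: "compatible K01 K02 K12" and rig: "rigid K01" "rigid K02" "rigid K12"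
    and v: "upper_triangle K01 K02 K12 a b c v"
  obtains X Y Z where "cube_coloring K01 K02 K12 X Y Z"
    "\<And>k j. k < 3 \<Longrightarrow> j \<le> 3 \<Longrightarrow> upper_section X Y Z a b c k j = v k j"
proof -
  define X where "X = (\<lambda>s t. v 0 (if s = b then 0 else if t = c then 2 else 3))"
  define Y where "Y = (\<lambda>s t. v (Suc 0) (if s = a then 2 else if t = c then 1 else 0))"
  define Z where "Z = (\<lambda>s t. v 2 (if s = a then 3 else if t = b then 0 else (1::nat)))"
  have "face K01 (\<lambda>t. X t c) (\<lambda>t. Y t c)" "face K02 (\<lambda>t. X (\<not> b) t) (\<lambda>t. Z t (\<not> b))"
     "face K12 (\<lambda>t. Y (\<not> a) t) (\<lambda>t. Z (\<not> a) t)"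
    using v by (cases a; cases b; cases c; simp add: upper_triangle_def X_def Y_def Z_def face_def)+
  from cube_extension[of K01 K02 K12 X c Y "\<not> b" Z "\<not> a", OF comp rig this] obtain X' Y' Z' where c: "cube_coloring K01 K02 K12 X' Y' Z'"
    and e: "(\<lambda>t. X' t c) = (\<lambda>t. X t c)" "(\<lambda>t. Y' t c) = (\<lambda>t. Y t c)" "X' (\<not> b) = X (\<not> b)"
    "(\<lambda>t. Z' t (\<not> b)) = (\<lambda>t. Z t (\<not> b))" "Y' (\<not> a) = Y (\<not> a)" "Z' (\<not> a) = Z (\<not> a)" .
  have "upper_section X' Y' Z' a b c k j = v k j" if "k < 3" "j \<le> 3" for k j
  proof -
    have "j = 0 \<or> j = 1 \<or> j = 2 \<or> j = 3" "k = 0 \<or> k = 1 \<or> k = 2" using that by auto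
    then show ?thesis
      using v fun_cong[OF e(1), of b] fun_cong[OF e(1), of "\<not> b"] fun_cong[OF e(3), of "\<not> c"]
        fun_cong[OF e(2), of a] fun_cong[OF e(2), of "\<not> a"] fun_cong[OF e(5), of "\<not> c"]
        fun_cong[OF e(4), of a] fun_cong[OF e(4), of "\<not> a"] fun_cong[OF e(6), of b]
      by (elim disjE) (simp_all add: upper_section_def upper_triangle_def X_def Y_def Z_def)
  qed
  then show ?thesis using that c by blast
qed

text \<open>
  Extend the coloring to the cube and take the opposite three faces.
\<close>

lemma triangle_opposite:
  fixes K01 K02 K12 :: "('x::finite, 'r::comm_ring_1) kind"
  assumes K: "compatible K01 K02 K12" "rigid K01" "rigid K02" "rigid K12"
    and v: "upper_triangle K01 K02 K12 a b c v"
  shows "\<exists>u. upper_triangle K01 K02 K12 (\<not> a) (\<not> b) (\<not> c) u \<and> (\<forall>k < 3. u k 0 = v k 3 \<and> u k 3 = v k 0) \<and>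
      upper_weight K01 K02 K12 (\<not> a) (\<not> b) (\<not> c) u = upper_weight K01 K02 K12 a b c v"
proof -
  obtain X Y Z where cube: "cube_coloring K01 K02 K12 X Y Z"
    and s: "\<And>k j. k < 3 \<Longrightarrow> j \<le> 3 \<Longrightarrow> upper_section X Y Z a b c k j = v k j"
    using upper_triangle_extends[OF K v] by blast
  define u where "u = upper_section X Y Z (\<not> a) (\<not> b) (\<not> c)"
  have "u k 0 = upper_section X Y Z a b c k 3 \<and> u k 3 = upper_section X Y Z a b c k 0" for k
    by (simp add: u_def upper_section_def)
  then have ends: "\<forall>k < 3. u k 0 = v k 3 \<and> u k 3 = v k 0" using s by simp
  have "upper_weight K01 K02 K12 a b c (upper_section X Y Z a b c) = upper_weight K01 K02 K12 a b c v"
    using s by (simp add: upper_weight_def)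
  then have "upper_weight K01 K02 K12 (\<not> a) (\<not> b) (\<not> c) u = upper_weight K01 K02 K12 a b c v"
    unfolding u_def opposite_sections_weight[OF K(1) cube] .
  then show ?thesis using cube_section[OF cube] ends unfolding u_def by blast
qed

lemma upper_triangle_unique:
  assumes rig: "rigid K01" "rigid K02" and v: "upper_triangle K01 K02 K12 a b c v" "upper_triangle K01 K02 K12 a b c v'"
    and e: "\<And>k. k < 3 \<Longrightarrow> v k 0 = v' k 0 \<and> v k 3 = v' k 3" and k: "k < 3"
  shows "v k 1 = v' k 1 \<and> v k 2 = v' k 2"
proof -
  have "(\<lambda>s. v 0 (if s = b then 1 else 2)) = (\<lambda>s. v' 0 (if s = b then 1 else 2))"
    "(\<lambda>s. v (Suc 0) (if s = a then 2 else 1)) = (\<lambda>s. v' (Suc 0) (if s = a then 2 else 1))"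
    using rigidD[of K01 "\<lambda>s. v 0 (if s = b then 1 else 2)" "\<lambda>s. v (Suc 0) (if s = a then 2 else 1)"
      "\<lambda>s. v' 0 (if s = b then 1 else 2)" "\<lambda>s. v' (Suc 0) (if s = a then 2 else 1)" b a]
      rig v e[of 0] e[of 1] by (simp_all add: upper_triangle_def)
  from fun_cong[OF this(1), of "\<not> b"] fun_cong[OF this(2), of "\<not> a"]
  have 1: "v 0 2 = v' 0 2" "v 1 1 = v' 1 1" by simp_all
  have "(\<lambda>s. v 2 (if s = a then 3 else 2)) = (\<lambda>s. v' 2 (if s = a then 3 else 2))"
    using rigidD(2)[of K02 "\<lambda>s. v 0 (if s = c then 2 else 3)" "\<lambda>s. v 2 (if s = a then 3 else 2)"
      "\<lambda>s. v' 0 (if s = c then 2 else 3)" "\<lambda>s. v' 2 (if s = a then 3 else 2)" "\<not> c" a]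
      rig v e[of 0] e[of 2] by (simp add: upper_triangle_def)
  from fun_cong[OF this, of "\<not> a"] have 2: "v 2 2 = v' 2 2" by simp
  have "k = 0 \<or> k = 1 \<or> k = 2" using k by auto
  then show ?thesis using 1 2 v e[of 0] e[of 1] by (elim disjE) (simp_all add: upper_triangle_def)
qed

text \<open>
  A half-turn of the plane maps the triangle below the origin to the one above it and reverses all arcs,
  so the pieces are numbered backward and the directions are negated.
\<close>

definition half_turn :: "(nat \<Rightarrow> nat \<Rightarrow> 'x) \<Rightarrow> nat \<Rightarrow> nat \<Rightarrow> 'x" where
  "half_turn v k j = v k (3 - j)"

definition lower_triangle where
  "lower_triangle K01 K02 K12 a b c v \<longleftrightarrow> upper_triangle K01 K02 K12 (\<not> a) (\<not> b) (\<not> c) (half_turn v)"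

definition lower_weight where
  "lower_weight K01 K02 K12 a b c v = upper_weight K01 K02 K12 (\<not> a) (\<not> b) (\<not> c) (half_turn v)"

lemma half_turn_twice:
  "upper_triangle K01 K02 K12 a b c (half_turn (half_turn v)) = upper_triangle K01 K02 K12 a b c v"
  "upper_weight K01 K02 K12 a b c (half_turn (half_turn v)) = upper_weight K01 K02 K12 a b c v"
  by (simp_all add: upper_triangle_def upper_weight_def half_turn_def if_distrib cong: if_cong)

lemma triangle_exchange:
  fixes K01 K02 K12 :: "('x::finite, 'r::comm_ring_1) kind"
  assumes K: "compatible K01 K02 K12" "rigid K01" "rigid K02" "rigid K12"
  shows "upper_triangle K01 K02 K12 a b c v \<Longrightarrow> \<exists>v'. lower_triangle K01 K02 K12 a b c v' \<and>
      (\<forall>k < 3. v' k 0 = v k 0 \<and> v' k 3 = v k 3) \<and> lower_weight K01 K02 K12 a b c v' = upper_weight K01 K02 K12 a b c v"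
    and "lower_triangle K01 K02 K12 a b c v \<Longrightarrow> \<exists>v'. upper_triangle K01 K02 K12 a b c v' \<and>
      (\<forall>k < 3. v' k 0 = v k 0 \<and> v' k 3 = v k 3) \<and> upper_weight K01 K02 K12 a b c v' = lower_weight K01 K02 K12 a b c v"
proof -
  assume "upper_triangle K01 K02 K12 a b c v"
  then obtain u where "upper_triangle K01 K02 K12 (\<not> a) (\<not> b) (\<not> c) u" "\<forall>k < 3. u k 0 = v k 3 \<and> u k 3 = v k 0"
      "upper_weight K01 K02 K12 (\<not> a) (\<not> b) (\<not> c) u = upper_weight K01 K02 K12 a b c v"
    using triangle_opposite[OF K] by blast
  then show "\<exists>v'. lower_triangle K01 K02 K12 a b c v' \<and>
      (\<forall>k < 3. v' k 0 = v k 0 \<and> v' k 3 = v k 3) \<and> lower_weight K01 K02 K12 a b c v' = upper_weight K01 K02 K12 a b c v"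
    unfolding lower_triangle_def lower_weight_def
    by (intro exI[of _ "half_turn u"]) (simp add: half_turn_twice, simp add: half_turn_def)
next
  assume "lower_triangle K01 K02 K12 a b c v"
  then obtain u where "upper_triangle K01 K02 K12 a b c u" "\<forall>k < 3. u k 0 = half_turn v k 3 \<and> u k 3 = half_turn v k 0"
      "upper_weight K01 K02 K12 a b c u = upper_weight K01 K02 K12 (\<not> a) (\<not> b) (\<not> c) (half_turn v)"
    using triangle_opposite[OF K, of "\<not> a" "\<not> b" "\<not> c" "half_turn v"] unfolding lower_triangle_def by auto
  then show "\<exists>v'. upper_triangle K01 K02 K12 a b c v' \<and>
      (\<forall>k < 3. v' k 0 = v k 0 \<and> v' k 3 = v k 3) \<and> upper_weight K01 K02 K12 a b c v' = lower_weight K01 K02 K12 a b c v"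
    unfolding lower_weight_def by (intro exI[of _ u]) (simp add: half_turn_def)
qed

lemma lower_triangle_unique:
  assumes "rigid K01" "rigid K02" and "lower_triangle K01 K02 K12 a b c v" "lower_triangle K01 K02 K12 a b c v'"
    and "\<And>k. k < 3 \<Longrightarrow> v k 0 = v' k 0 \<and> v k 3 = v' k 3" and "k < 3"
  shows "v k 1 = v' k 1 \<and> v k 2 = v' k 2"
  using upper_triangle_unique[OF assms(1-2) assms(3,4)[unfolded lower_triangle_def] _ assms(6)] assms(5)
  by (simp add: half_turn_def numeral_3_eq_3 numeral_2_eq_2)

section \<open>The Reidemeister moves\<close>

context finite_boltzmann_weight
begin

theorem Phi_bigon_exchange:
  fixes K :: "(nat \<Rightarrow> bool) \<Rightarrow> ('x, 'r) kind"
  defines "turn \<equiv> \<lambda>\<sigma> J. if \<sigma> (0::nat) = (\<sigma> 1 :: bool) then flip J else (J :: ('x, 'r) kind)"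
  assumes move: "local_move T T' L L'" and T: "arcs T = bigon_arcs" "arcs T' = bigon_arcs"
    and cl: "\<And>\<sigma>. is_classical (K \<sigma>)"
    and kinds: "\<And>\<sigma>. pair_kind T \<sigma> (0, -1/2) (1, -1/2) = turn \<sigma> singular"
      "\<And>\<sigma>. pair_kind T \<sigma> (1, 1/2) (0, 1/2) = turn \<sigma> (K \<sigma>)"
      "\<And>\<sigma>. pair_kind T' \<sigma> (0, -1/2) (1, -1/2) = turn \<sigma> (K \<sigma>)"
      "\<And>\<sigma>. pair_kind T' \<sigma> (1, 1/2) (0, 1/2) = turn \<sigma> singular"
  shows "polynomial L = polynomial L'"
proof (rule Phi_local_move[OF move double_points_bigon[OF T(1)] double_points_bigon[OF T(2)]])
  show "length (arcs T') = length (arcs T)" by (simp add: T)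
  show "determined T bigon_crossings" "determined T' bigon_crossings" using determined_bigon T by auto
  have ends: "with_mids v x y k 0 = v k 0 \<and> with_mids v x y k 3 = v k 3" for v x y k
    by (simp add: with_mids_def)
  note forms = local_coloring_bigon[OF T(1)] local_coloring_bigon[OF T(2)] local_weight_bigon kinds turn_def
  show "transfers T bigon_crossings T' bigon_crossings"
    unfolding transfers_def forms
    by (intro allI impI) (drule bigon_exchange[OF exchangeable_singular[OF cl]], use ends in blast)
  show "transfers T' bigon_crossings T bigon_crossings"
    unfolding transfers_def forms
    by (intro allI impI) (drule bigon_exchange[OF exchangeable_singular(2,1)[OF cl]], use ends in blast)
qed

lemma inj_orient_triangle: "inj_on (orient \<sigma>) (triangle_crossings e)"
  by (auto simp: inj_on_def orient_def triangle_crossings_def split: if_splits)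

lemma local_coloring_upper:
  assumes "arcs T = triangle_arcs 1"
  shows "local_coloring T (triangle_crossings 1) \<sigma> v \<longleftrightarrow>
    upper_triangle (flip (pair_kind T \<sigma> (1, 0) (0, 0))) (flip (pair_kind T \<sigma> (2, 1/2) (0, 1/2)))
      (pair_kind T \<sigma> (1, -1/2) (2, -1/2)) (\<sigma> 0) (\<sigma> 1) (\<sigma> 2) v"
proof -
  have "side_p \<sigma> v (1, 0) (0, 0) = (\<lambda>s. v 1 (if s = \<sigma> 0 then 2 else 1))"
    "side_q \<sigma> v (1, 0) (0, 0) = (\<lambda>s. v 0 (if s = \<sigma> 1 then 1 else 2))"
    "side_p \<sigma> v (2, 1/2) (0, 1/2) = (\<lambda>s. v 2 (if s = \<sigma> 0 then 3 else 2))"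
    "side_q \<sigma> v (2, 1/2) (0, 1/2) = (\<lambda>s. v 0 (if s = \<sigma> 2 then 2 else 3))"
    "side_p \<sigma> v (1, -1/2) (2, -1/2) = (\<lambda>s. v 1 (if s = \<sigma> 2 then 1 else 0))"
    "side_q \<sigma> v (1, -1/2) (2, -1/2) = (\<lambda>s. v 2 (if s = \<sigma> 1 then 0 else 1))"
    by (auto simp: side_p_def side_q_def)
  moreover have "length (arcs T) = 3" by (simp add: assms triangle_arcs_def)
  ultimately show ?thesis
    by (auto simp: local_coloring_faces breaks_def triangle_crossings_def upper_triangle_def nat_less_3)
qed

lemma swap_sides: "(\<lambda>s. if s = (\<not> a) then x else y) = (\<lambda>s. if s = a then y else x)"
  by auto

lemma local_coloring_lower:
  assumes "arcs T = triangle_arcs (-1)"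
  shows "local_coloring T (triangle_crossings (-1)) \<sigma> v \<longleftrightarrow>
    lower_triangle (flip (pair_kind T \<sigma> (1, 0) (0, 0))) (flip (pair_kind T \<sigma> (2, -1/2) (0, -1/2)))
      (pair_kind T \<sigma> (1, 1/2) (2, 1/2)) (\<sigma> 0) (\<sigma> 1) (\<sigma> 2) v"
proof -
  have "side_p \<sigma> v (1, 0) (0, 0) = (\<lambda>s. v 1 (if s = \<sigma> 0 then 2 else 1))"
    "side_q \<sigma> v (1, 0) (0, 0) = (\<lambda>s. v 0 (if s = \<sigma> 1 then 1 else 2))"
    "side_p \<sigma> v (2, -1/2) (0, -1/2) = (\<lambda>s. v 2 (if s = \<sigma> 0 then 1 else 0))"
    "side_q \<sigma> v (2, -1/2) (0, -1/2) = (\<lambda>s. v 0 (if s = \<sigma> 2 then 0 else 1))"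
    "side_p \<sigma> v (1, 1/2) (2, 1/2) = (\<lambda>s. v 1 (if s = \<sigma> 2 then 3 else 2))"
    "side_q \<sigma> v (1, 1/2) (2, 1/2) = (\<lambda>s. v 2 (if s = \<sigma> 1 then 2 else 3))"
    by (auto simp: side_p_def side_q_def)
  moreover have "length (arcs T) = 3" by (simp add: assms triangle_arcs_def)
  ultimately show ?thesis
    by (auto simp: local_coloring_faces breaks_def triangle_crossings_def lower_triangle_def
        upper_triangle_def half_turn_def nat_less_3 if_distrib swap_sides cong: if_cong)
qed

lemma local_weight_upper:
  "local_weight T (triangle_crossings 1) \<sigma> v =
    upper_weight (flip (pair_kind T \<sigma> (1, 0) (0, 0))) (flip (pair_kind T \<sigma> (2, 1/2) (0, 1/2)))
      (pair_kind T \<sigma> (1, -1/2) (2, -1/2)) (\<sigma> 0) (\<sigma> 1) (\<sigma> 2) v"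
  by (subst local_weight_faces[OF inj_orient_triangle])
     (auto simp: triangle_crossings_def side_p_def side_q_def upper_weight_def sign_def)

lemma local_weight_lower:
  "local_weight T (triangle_crossings (-1)) \<sigma> v =
    lower_weight (flip (pair_kind T \<sigma> (1, 0) (0, 0))) (flip (pair_kind T \<sigma> (2, -1/2) (0, -1/2)))
      (pair_kind T \<sigma> (1, 1/2) (2, 1/2)) (\<sigma> 0) (\<sigma> 1) (\<sigma> 2) v"
  by (subst local_weight_faces[OF inj_orient_triangle])
     (auto simp: triangle_crossings_def side_p_def side_q_def lower_weight_def upper_weight_def half_turn_def sign_def)

theorem Phi_triangle:
  fixes K01 K02 K12 :: "(nat \<Rightarrow> bool) \<Rightarrow> ('x, 'r) kind"
  assumes move: "local_move T T' L L'" and T: "arcs T = triangle_arcs 1" and T': "arcs T' = triangle_arcs (-1)"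
    and comp: "\<And>\<sigma>. compatible (K01 \<sigma>) (K02 \<sigma>) (K12 \<sigma>)"
    and kinds: "\<And>\<sigma>. flip (pair_kind T \<sigma> (1, 0) (0, 0)) = K01 \<sigma>"
      "\<And>\<sigma>. flip (pair_kind T \<sigma> (2, 1/2) (0, 1/2)) = K02 \<sigma>"
      "\<And>\<sigma>. pair_kind T \<sigma> (1, -1/2) (2, -1/2) = K12 \<sigma>"
    and kinds': "\<And>\<sigma>. flip (pair_kind T' \<sigma> (1, 0) (0, 0)) = K01 \<sigma>"
      "\<And>\<sigma>. flip (pair_kind T' \<sigma> (2, -1/2) (0, -1/2)) = K02 \<sigma>"
      "\<And>\<sigma>. pair_kind T' \<sigma> (1, 1/2) (2, 1/2) = K12 \<sigma>"
  shows "polynomial L = polynomial L'"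
proof (rule Phi_local_move[OF move])
  show "double_points T (triangle_crossings 1)" "double_points T' (triangle_crossings (-1))"
    using double_points_triangle[OF T] double_points_triangle[OF T'] by auto
  have len: "length (arcs T) = 3" "length (arcs T') = 3" by (simp_all add: T T' triangle_arcs_def)
  then show "length (arcs T') = length (arcs T)" by simp
  have rig: "rigid (K01 \<sigma>)" "rigid (K02 \<sigma>)" "rigid (K12 \<sigma>)" for \<sigma>
    unfolding kinds[symmetric] by (rule rigid_flip rigid_pair_kind)+
  note forms = local_coloring_upper[OF T] local_coloring_lower[OF T'] local_weight_upper local_weight_lower
    kinds kinds' len
  show "transfers T (triangle_crossings 1) T' (triangle_crossings (-1))"
    unfolding transfers_def forms using triangle_exchange(1)[OF comp rig] by blast
  show "transfers T' (triangle_crossings (-1)) T (triangle_crossings 1)"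
    unfolding transfers_def forms using triangle_exchange(2)[OF comp rig] by blast
  show "determined T (triangle_crossings 1)"
    unfolding determined_def forms
  proof (intro allI impI)
    fix \<sigma> v v' and k :: nat
    assume "upper_triangle (K01 \<sigma>) (K02 \<sigma>) (K12 \<sigma>) (\<sigma> 0) (\<sigma> 1) (\<sigma> 2) v"
      "upper_triangle (K01 \<sigma>) (K02 \<sigma>) (K12 \<sigma>) (\<sigma> 0) (\<sigma> 1) (\<sigma> 2) v'"
      "\<forall>k<3. v k 0 = v' k 0 \<and> v k 3 = v' k 3" "k < 3"
    then show "v k 1 = v' k 1 \<and> v k 2 = v' k 2" using upper_triangle_unique[OF rig(1,2)] by meson
  qed
  show "determined T' (triangle_crossings (-1))"
    unfolding determined_def forms
  proof (intro allI impI)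
    fix \<sigma> v v' and k :: nat
    assume "lower_triangle (K01 \<sigma>) (K02 \<sigma>) (K12 \<sigma>) (\<sigma> 0) (\<sigma> 1) (\<sigma> 2) v"
      "lower_triangle (K01 \<sigma>) (K02 \<sigma>) (K12 \<sigma>) (\<sigma> 0) (\<sigma> 1) (\<sigma> 2) v'"
      "\<forall>k<3. v k 0 = v' k 0 \<and> v k 3 = v' k 3" "k < 3"
    then show "v k 1 = v' k 1 \<and> v k 2 = v' k 2" using lower_triangle_unique[OF rig(1,2)] by meson
  qed
qed

lemma Phi_move_I:
  assumes "move_I L L'"
  shows "polynomial L = polynomial L'"
proof -
  obtain t where "local_move \<lparr>arcs = [plain_arc], tover = {}, tspecial = {}\<rparr>
                \<lparr>arcs = [kink_arc], tover = {(0, t)}, tspecial = {}\<rparr> L L'"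
    using assms unfolding move_I_def by blast
  then show ?thesis
    by (rule Phi_kink) (auto simp: pair_kind_def picture_kind_def diagonal weight_diagonal)
qed

lemma Phi_move_pI:
  assumes "pI_adequate (\<bullet>\<^sub>u) (\<bullet>\<^sub>o)" "pI_adequate_weight \<psi>" and "move_pI L L'"
  shows "polynomial L = polynomial L'"
proof (rule Phi_kink)
  show "local_move \<lparr>arcs = [plain_arc], tover = {}, tspecial = {}\<rparr>
                   \<lparr>arcs = [kink_arc], tover = {}, tspecial = {\<i> / 4}\<rparr> L L'"
    using assms(3) unfolding move_pI_def .
  have "kink_arc (-1/2) = \<i> / 4" "kink_arc (1/2) = \<i> / 4"
    by (simp_all add: kink_arc_def bump_def complex_eq_iff power2_eq_square)
  then have "pair_kind \<lparr>arcs = [kink_arc], tover = {}, tspecial = {\<i> / 4}\<rparr> \<sigma> (0, -1/2) (0, 1/2) = flip singular" for \<sigma>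
    by (subst special_pair_kind)
       (simp_all only: picture_pt_def prod.case picture.select_convs nth_Cons_0 singletonI fst_conv if_True refl simp_thms)
  then show "act1 (pair_kind \<lparr>arcs = [kink_arc], tover = {}, tspecial = {\<i> / 4}\<rparr> \<sigma> (0, -1/2) (0, 1/2)) x x =
      act2 (pair_kind \<lparr>arcs = [kink_arc], tover = {}, tspecial = {\<i> / 4}\<rparr> \<sigma> (0, -1/2) (0, 1/2)) x x"
    "wgt (pair_kind \<lparr>arcs = [kink_arc], tover = {}, tspecial = {\<i> / 4}\<rparr> \<sigma> (0, -1/2) (0, 1/2)) x x = 0" for \<sigma> x
    using assms(1,2) unfolding pI_adequate_def pI_adequate_weight_def by simp_all
qed simp_all

lemma Phi_move_II:
  assumes "move_II L L'"
  shows "polynomial L = polynomial L'"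
proof -
  obtain ht where ht: "length ht = 2" "distinct ht"
    and move: "local_move (layered apart_arcs ht {}) (layered bigon_arcs ht {}) L L'"
    using assms unfolding move_II_def by blast
  have ne: "ht ! 0 \<noteq> ht ! 1" using ht by (simp add: nth_eq_iff_index_eq)
  let ?T = "layered bigon_arcs ht {}"
  have dp: "double_points ?T bigon_crossings" by (rule double_points_bigon) (simp add: layered_def)
  show ?thesis
  proof (rule Phi_bigon[OF move])
    fix \<sigma>
    have "pair_kind ?T \<sigma> (1, 1/2) (0, 1/2) = layer_kind (ht ! fst (1, 1/2 :: real)) (ht ! fst (0, 1/2 :: real))"
      using ne by (intro layered_pair_kind[OF dp]) (auto simp: bigon_crossings_def)
    moreover have "pair_kind ?T \<sigma> (0, -1/2) (1, -1/2) = layer_kind (ht ! fst (0, -1/2 :: real)) (ht ! fst (1, -1/2 :: real))"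
      using ne by (intro layered_pair_kind[OF dp]) (auto simp: bigon_crossings_def)
    ultimately show "pair_kind ?T \<sigma> (1, 1/2) (0, 1/2) = flip (pair_kind ?T \<sigma> (0, -1/2) (1, -1/2))"
      by (simp only: fst_conv layer_kind_flip[OF ne])
  qed (simp_all add: layered_def)
qed

text \<open>
  Among the three crossings only that of the two diagonals lies at the origin.
\<close>

lemma triangle_pair_kinds:
  assumes e: "e = 1 \<or> e = -1" and ht: "ht ! 0 \<noteq> ht ! 2" "ht ! 1 \<noteq> ht ! 2" and S: "S \<subseteq> {0}"
  shows "flip (pair_kind (layered (triangle_arcs e) ht S) \<sigma> (2, e/2) (0, e/2)) = layer_kind (ht ! 0) (ht ! 2)"
    and "pair_kind (layered (triangle_arcs e) ht S) \<sigma> (1, -e/2) (2, -e/2) = layer_kind (ht ! 1) (ht ! 2)"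
    and "S = {} \<Longrightarrow> ht ! 0 \<noteq> ht ! 1 \<Longrightarrow>
      flip (pair_kind (layered (triangle_arcs e) ht S) \<sigma> (1, 0) (0, 0)) = layer_kind (ht ! 0) (ht ! 1)"
    and "S = {0} \<Longrightarrow> flip (pair_kind (layered (triangle_arcs e) ht S) \<sigma> (1, 0) (0, 0)) = singular \<or>
       flip (pair_kind (layered (triangle_arcs e) ht S) \<sigma> (1, 0) (0, 0)) = flip singular"
proof -
  let ?T = "layered (triangle_arcs e) ht S"
  have dp: "double_points ?T (triangle_crossings e)"
    using e by (intro double_points_triangle) (simp_all add: layered_def)
  have picture_pt: "picture_pt ?T (0, t) = Complex t t" "picture_pt ?T (1, t) = Complex t (- t)" for t
    by (simp_all add: picture_pt_def layered_def triangle_arcs_def)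
  have z: "Complex s t \<in> S \<Longrightarrow> s = 0" for s t using S by (auto simp: complex_eq_iff)
  have "pair_kind ?T \<sigma> (2, e/2) (0, e/2) = layer_kind (ht ! fst (2, e/2)) (ht ! fst (0, e/2))"
  proof (rule layered_pair_kind[OF dp])
    have "((2, e/2), (0, e/2)) \<in> triangle_crossings e" by (simp add: triangle_crossings_def)
    then have "picture_pt ?T (2, e/2) = picture_pt ?T (0, e/2)"
      using dp unfolding double_points_def by fast
    then show "picture_pt ?T (2, e/2) \<notin> S" using z[of "e/2" "e/2"] e by (auto simp: picture_pt)
  qed (use e ht in \<open>auto simp: triangle_crossings_def\<close>)
  then show "flip (pair_kind ?T \<sigma> (2, e/2) (0, e/2)) = layer_kind (ht ! 0) (ht ! 2)"
    using ht by (simp add: layer_kind_flip)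
  have "pair_kind ?T \<sigma> (1, -e/2) (2, -e/2) = layer_kind (ht ! fst (1, -e/2)) (ht ! fst (2, -e/2))"
  proof (rule layered_pair_kind[OF dp])
    show "picture_pt ?T (1, -e/2) \<notin> S"
      unfolding picture_pt(2) using z[of "-e/2" "-(-e/2)"] e by auto
  qed (use e ht in \<open>auto simp: triangle_crossings_def\<close>)
  then show "pair_kind ?T \<sigma> (1, -e/2) (2, -e/2) = layer_kind (ht ! 1) (ht ! 2)" by simp
  show "flip (pair_kind ?T \<sigma> (1, 0) (0, 0)) = layer_kind (ht ! 0) (ht ! 1)" if "S = {}" "ht ! 0 \<noteq> ht ! 1"
  proof -
    have "pair_kind ?T \<sigma> (1, 0) (0, 0) = layer_kind (ht ! fst (1, 0 :: real)) (ht ! fst (0, 0 :: real))"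
      using e that by (intro layered_pair_kind[OF dp]) (auto simp: triangle_crossings_def)
    then show ?thesis using that(2) by (simp add: layer_kind_flip)
  qed
  show "flip (pair_kind ?T \<sigma> (1, 0) (0, 0)) = singular \<or> flip (pair_kind ?T \<sigma> (1, 0) (0, 0)) = flip singular" if "S = {0}"
  proof -
    have "picture_pt ?T (1, 0) \<in> tspecial ?T" "picture_pt ?T (0, 0) = picture_pt ?T (1, 0)"
      unfolding picture_pt using that by (simp_all add: layered_def complex_eq_iff)
    then show ?thesis by (simp add: special_pair_kind)
  qed
qed

lemma Phi_move_III:
  assumes "move_III L L'"
  shows "polynomial L = polynomial L'"
proof -
  obtain ht where ht: "length ht = 3" "distinct ht"
    and move: "local_move (layered (triangle_arcs 1) ht {}) (layered (triangle_arcs (-1)) ht {}) L L'"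
    using assms unfolding move_III_def by blast
  have ne: "ht ! 0 \<noteq> ht ! 1" "ht ! 0 \<noteq> ht ! 2" "ht ! 1 \<noteq> ht ! 2"
    using ht by (simp_all add: nth_eq_iff_index_eq)
  have upper: "flip (pair_kind (layered (triangle_arcs 1) ht {}) \<sigma> (1, 0) (0, 0)) = layer_kind (ht ! 0) (ht ! 1)"
      "flip (pair_kind (layered (triangle_arcs 1) ht {}) \<sigma> (2, 1/2) (0, 1/2)) = layer_kind (ht ! 0) (ht ! 2)"
      "pair_kind (layered (triangle_arcs 1) ht {}) \<sigma> (1, -1/2) (2, -1/2) = layer_kind (ht ! 1) (ht ! 2)" for \<sigma>
    using triangle_pair_kinds[of 1 ht "{}" \<sigma>] ne by simp_all
  have lower: "flip (pair_kind (layered (triangle_arcs (-1)) ht {}) \<sigma> (1, 0) (0, 0)) = layer_kind (ht ! 0) (ht ! 1)"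
      "flip (pair_kind (layered (triangle_arcs (-1)) ht {}) \<sigma> (2, -1/2) (0, -1/2)) = layer_kind (ht ! 0) (ht ! 2)"
      "pair_kind (layered (triangle_arcs (-1)) ht {}) \<sigma> (1, 1/2) (2, 1/2) = layer_kind (ht ! 1) (ht ! 2)" for \<sigma>
    using triangle_pair_kinds[of "-1" ht "{}" \<sigma>] ne by simp_all
  show ?thesis
    by (rule Phi_triangle[OF move _ _ _ upper lower])
       (use compatible_layers[of "ht ! 0" "ht ! 1" "ht ! 2"] ne in \<open>simp_all add: layered_def\<close>)
qed

lemma Phi_move_V:
  assumes "move_V L L'"
  shows "polynomial L = polynomial L'"
proof -
  obtain ht where ht: "ht = [1, 1, 2] \<or> ht = [1, 1, 0]"
    and move: "local_move (layered (triangle_arcs 1) ht {0}) (layered (triangle_arcs (-1)) ht {0}) L L'"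
    using assms unfolding move_V_def by blast
  have ne: "ht ! 0 = ht ! 1" "ht ! 0 \<noteq> ht ! 2" "ht ! 1 \<noteq> ht ! 2" using ht by auto
  define K where "K \<sigma> = flip (pair_kind (layered (triangle_arcs 1) ht {0}) \<sigma> (1, 0) (0, 0))" for \<sigma>
  have special: "K \<sigma> = singular \<or> K \<sigma> = flip singular" for \<sigma>
    unfolding K_def using triangle_pair_kinds(4)[of 1 ht "{0}" \<sigma>] ne by simp
  have "flip (pair_kind (layered (triangle_arcs (-1)) ht {0}) \<sigma> (1, 0) (0, 0)) = K \<sigma>" for \<sigma>
    unfolding K_def
    by (subst (1 2) special_pair_kind) (auto simp: picture_pt_def layered_def triangle_arcs_def complex_eq_iff)
  note center = K_def[symmetric] this
  have upper: "flip (pair_kind (layered (triangle_arcs 1) ht {0}) \<sigma> (2, 1/2) (0, 1/2)) = layer_kind (ht ! 0) (ht ! 2)"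
      "pair_kind (layered (triangle_arcs 1) ht {0}) \<sigma> (1, -1/2) (2, -1/2) = layer_kind (ht ! 0) (ht ! 2)" for \<sigma>
    using triangle_pair_kinds(1,2)[of 1 ht "{0}" \<sigma>] ne by simp_all
  have lower: "flip (pair_kind (layered (triangle_arcs (-1)) ht {0}) \<sigma> (2, -1/2) (0, -1/2)) = layer_kind (ht ! 0) (ht ! 2)"
      "pair_kind (layered (triangle_arcs (-1)) ht {0}) \<sigma> (1, 1/2) (2, 1/2) = layer_kind (ht ! 0) (ht ! 2)" for \<sigma>
    using triangle_pair_kinds(1,2)[of "-1" ht "{0}" \<sigma>] ne by simp_all
  show ?thesis
    by (rule Phi_triangle[OF move _ _ _ center(1) upper center(2) lower])
       (use compatible_special[OF special, of "ht ! 0" "ht ! 2"] ne in \<open>simp_all add: layered_def\<close>)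
qed

text \<open>
  The over arc changes from one side to the other, but so does the order of the strands: on both sides the
  classical crossing has the type \<open>K \<sigma>\<close>.
\<close>

lemma Phi_move_IV:
  assumes "move_IV L L'"
  shows "polynomial L = polynomial L'"
proof -
  obtain k :: nat where k: "k = 0 \<or> k = 1" and move: "local_move
       \<lparr>arcs = bigon_arcs, tover = {(k, 1/2)}, tspecial = {-1/2}\<rparr>
       \<lparr>arcs = bigon_arcs, tover = {(1 - k, -1/2)}, tspecial = {1/2}\<rparr> L L'"
    using assms unfolding move_IV_def by blast
  let ?T = "\<lparr>arcs = bigon_arcs, tover = {(k, 1/2)}, tspecial = {-1/2}\<rparr>"
  let ?T' = "\<lparr>arcs = bigon_arcs, tover = {(1 - k, -1/2)}, tspecial = {1/2}\<rparr>"
  have picture_pt: "picture_pt ?T (l, -1/2) = -1/2" "picture_pt ?T (l, 1/2) = 1/2" "picture_pt ?T' (l, -1/2) = -1/2" "picture_pt ?T' (l, 1/2) = 1/2"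
    if "l = 0 \<or> l = 1" for l
    using that by (auto simp: picture_pt_def bigon_arcs_def bump_def complex_eq_iff power2_eq_square)
  define K where "K \<sigma> = (if (if \<sigma> 0 = \<sigma> 1 then k = 1 else k = 0) then classical else flip classical)"
    for \<sigma> :: "nat \<Rightarrow> bool"
  have ne: "(1/2 :: complex) \<noteq> -1/2" "(-1/2 :: complex) \<noteq> 1/2" by (simp_all add: complex_eq_iff)
  note kind_defs = pair_kind_def picture_kind_def prod.case fst_conv
    picture_pt[of 0, OF disjI1[OF refl]] picture_pt[of 1, OF disjI2[OF refl]]
  show ?thesis
  proof (rule Phi_bigon_exchange[OF move, of K])
    fix \<sigma> :: "nat \<Rightarrow> bool"
    show "is_classical (K \<sigma>)" by (simp add: is_classical_def K_def)
    show "pair_kind ?T \<sigma> (0, -1/2) (1, -1/2) = (if \<sigma> 0 = \<sigma> 1 then flip singular else singular)"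
      "pair_kind ?T' \<sigma> (1, 1/2) (0, 1/2) = (if \<sigma> 0 = \<sigma> 1 then flip singular else singular)"
      "pair_kind ?T \<sigma> (1, 1/2) (0, 1/2) = (if \<sigma> 0 = \<sigma> 1 then flip (K \<sigma>) else K \<sigma>)"
      "pair_kind ?T' \<sigma> (0, -1/2) (1, -1/2) = (if \<sigma> 0 = \<sigma> 1 then flip (K \<sigma>) else K \<sigma>)"
      unfolding kind_defs using k ne by (auto simp: K_def)
  qed simp_all
qed

lemma Phi_singular_step:
  assumes "singular_step L L'"
  shows "polynomial L = polynomial L'"
  using assms Phi_planar_isotopy Phi_move_I Phi_move_II Phi_move_III Phi_move_IV Phi_move_V
  unfolding singular_step_def by blast

end

lemma equivclp_invariant:
  assumes "equivclp r x y" and "\<And>x y. r x y \<Longrightarrow> f x = f y"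
  shows "f x = f y"
  using assms(1) by (induction rule: equivclp_induct) (auto dest: assms(2))

theorem proposition2:
  fixes ut ot ub ob :: "'x::finite \<Rightarrow> 'x \<Rightarrow> 'x"
    and \<phi> \<psi> :: "'x \<Rightarrow> 'x \<Rightarrow> 'r::comm_ring_1"
  assumes "psyquandle ut ot ub ob"
    and "boltzmann_weight ut ot ub ob \<phi> \<psi>"
  shows "(\<forall>L L'. link_diagram L \<and> link_diagram L' \<and> singular_equivalent L L' \<longrightarrow>
            Phi ut ot ub ob \<phi> \<psi> L = Phi ut ot ub ob \<phi> \<psi> L') \<and>
         (pI_adequate ub ob \<and> pI_adequate_weight \<psi> \<longrightarrow>
            (\<forall>L L'. link_diagram L \<and> link_diagram L' \<and> pseudo_equivalent L L' \<longrightarrow>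
               Phi ut ot ub ob \<phi> \<psi> L = Phi ut ot ub ob \<phi> \<psi> L'))"
proof -
  interpret finite_boltzmann_weight ut ot ub ob \<phi> \<psi>
    using assms(2) by (simp add: finite_boltzmann_weight_def)
  have "Phi ut ot ub ob \<phi> \<psi> L = Phi ut ot ub ob \<phi> \<psi> L'" if "singular_equivalent L L'" for L L'
    using that Phi_singular_step unfolding singular_equivalent_def by (rule equivclp_invariant)
  moreover have "Phi ut ot ub ob \<phi> \<psi> L = Phi ut ot ub ob \<phi> \<psi> L'"
    if p: "pI_adequate ub ob" "pI_adequate_weight \<psi>" and "pseudo_equivalent L L'" for L L'
    using that(3) unfolding pseudo_equivalent_def
  proof (rule equivclp_invariant)
    fix L L' assume "pseudo_step L L'"
    then show "Phi ut ot ub ob \<phi> \<psi> L = Phi ut ot ub ob \<phi> \<psi> L'"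
      using Phi_singular_step Phi_move_pI[OF p] unfolding pseudo_step_def by blast
  qed
  ultimately show ?thesis by blast
qed

end
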